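(* Let $m$ be an even positive integer and let $1\le i\le m$. Let $U_i$ be the $GL(V_m)$-submodule of $S^i(S^m(V_m^* ))$ generated by $v_o^{\otimes i}$, and let $\mathcal I_{m\delta_i}$ be the isotypic component of $S^i(S^m(V_m^* ))$ corresponding to the irreducible $GL(V_m)$-module $V_m(m\delta_i)^*$. If there exists a pattern $\mathcal B$ of size $(i,m)$ such that $\sharp L^+_{\mathcal B}\neq\sharp L^-_{\mathcal B}$, then $U_i\cap\mathcal I_{m\delta_i}\neq(0)$. In particular, if $\sharp CELS(m)\ne\sharp COLS(m)$, then $U_i\cap\mathcal I_{m\delta_i}\neq(0)$ for all $1\le i\le m$. For $i=m$: $U_m\cap\mathcal I_{m\delta_m}\neq(0)$ if and only if $\sharp CELS(m)\ne\sharp COLS(m)$.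
   Context: $V_m=\mathbb C^m$ with standard basis $v_1,\dots,v_m$ and dual basis $v_1^*,\dots,v_m^*$; $S^k(W)\subset\otimes^kW$ is the space of symmetric tensors; $$v_o=\frac1{m!}\sum_{\sigma\in\mathfrak S_m}v^*_{\sigma(1)}\otimes\cdots\otimes v^*_{\sigma(m)}\in S^m(V_m^* ).$$ $\delta_i$ is the partition $(1,\dots,1)$ with $i$ ones, and $V_m(\mu)$ is the irreducible $GL(V_m)$-module with highest weight the partition $\mu$. A Latin $(i,m)$-rectangle ($1\le i\le m$) is an $i\times m$ matrix $A=(a_p^q)$ (row $p$, column $q$) each of whose rows is a permutation of $[m]=\{1,\dots,m\}$ and each of whose columns consists of distinct numbers. The sign of column $q$ is $\epsilon(A^q)=$ sign of $\prod_{1\le p<p'\le i}(a_{p'}^q-a_p^q)$; $A$ is column-even if $\epsilon_c(A)=\prod_{q=1}^m\epsilon(A^q)=+1$, and column-odd otherwise. A pattern of size $(i,m)$ is an $m$-tuple $\mathcal A=(\mathcal A^1,\dots,\mathcal A^m)$ of subsets of $[m]$, each of cardinality $i$, such that every $q\in[m]$ lies in exactly $i$ of the sets. A Latin $(i,m)$-rectangle $A$ has pattern $\mathcal A$ if for each $q$ the set of entries of its $q$-th column is $\mathcal A^q$. $L^+_{\mathcal A}$ (resp. $L^-_{\mathcal A}$) is the set of column-even (resp. column-odd) Latin $(i,m)$-rectangles with pattern $\mathcal A$. $CELS(m)$ (resp. $COLS(m)$) is the set of column-even (resp. column-odd) Latin $(m,m)$-rectangles (Latin squares). *)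

theory Defs
  imports
    "Jordan_Normal_Form.Determinant"
    "HOL-Combinatorics.Permutations"
    "HOL-Library.Function_Algebras"
    "HOL-Library.More_List"
    "HOL.Complex"
begin

text \<open>
  Throughout, the index set \<open>{1, \<dots>, m}\<close> is rendered order-isomorphically as \<open>{..<m}\<close>, and all rows,
  columns, entries and basis vectors are numbered from 0.
\<close>

section \<open>Latin rectangles and patterns\<close>

definition latin_rectangle :: "nat \<Rightarrow> nat \<Rightarrow> nat mat \<Rightarrow> bool" where
  "latin_rectangle i m A \<longleftrightarrow>
     A \<in> carrier_mat i m \<and>
     (\<forall>p<i. bij_betw (\<lambda>q. A $$ (p, q)) {..<m} {..<m}) \<and>
     (\<forall>q<m. inj_on (\<lambda>p. A $$ (p, q)) {..<i})"

definition column_sign :: "nat mat \<Rightarrow> nat \<Rightarrow> int" where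
  "column_sign A q =
     sgn (\<Prod>p'<dim_row A. \<Prod>p<p'. int (A $$ (p', q)) - int (A $$ (p, q)))"

definition column_even :: "nat mat \<Rightarrow> bool" where
  "column_even A \<longleftrightarrow> (\<Prod>q<dim_col A. column_sign A q) = 1"

abbreviation column_odd :: "nat mat \<Rightarrow> bool" where
  "column_odd A \<equiv> \<not> column_even A"

definition is_pattern :: "nat \<Rightarrow> nat \<Rightarrow> nat set list \<Rightarrow> bool" where
  "is_pattern i m P \<longleftrightarrow>
     length P = m \<and>
     (\<forall>j<m. P ! j \<subseteq> {..<m} \<and> card (P ! j) = i) \<and>
     (\<forall>q<m. card {j. j < m \<and> q \<in> P ! j} = i)"

definition has_pattern :: "nat mat \<Rightarrow> nat set list \<Rightarrow> bool" where
  "has_pattern A P \<longleftrightarrow>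
     length P = dim_col A \<and>
     (\<forall>q<dim_col A. (\<lambda>p. A $$ (p, q)) ` {..<dim_row A} = P ! q)"

definition L_plus :: "nat \<Rightarrow> nat \<Rightarrow> nat set list \<Rightarrow> nat mat set" where
  "L_plus i m P = {A. latin_rectangle i m A \<and> has_pattern A P \<and> column_even A}"

definition L_minus :: "nat \<Rightarrow> nat \<Rightarrow> nat set list \<Rightarrow> nat mat set" where
  "L_minus i m P = {A. latin_rectangle i m A \<and> has_pattern A P \<and> column_odd A}"

definition CELS :: "nat \<Rightarrow> nat mat set" where
  "CELS m = {A. latin_rectangle m m A \<and> column_even A}"

definition COLS :: "nat \<Rightarrow> nat mat set" where
  "COLS m = {A. latin_rectangle m m A \<and> column_odd A}"


section \<open>Complex vector spaces of functions\<close>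

text \<open>
  All vector spaces are realised as subspaces of spaces \<open>'x \<Rightarrow> complex\<close> with pointwise operations.
  Up to isomorphism this covers every complex vector space, and the class is closed under
  tensor powers (over \<open>'x list\<close>) and duals (over \<open>'x \<Rightarrow> complex\<close>).
\<close>

definition fscale :: "complex \<Rightarrow> ('x \<Rightarrow> complex) \<Rightarrow> 'x \<Rightarrow> complex" where
  "fscale c f = (\<lambda>x. c * f x)"

global_interpretation cfun: vector_space "fscale :: complex \<Rightarrow> ('x \<Rightarrow> complex) \<Rightarrow> 'x \<Rightarrow> complex"
  by unfold_locales (auto simp: fscale_def fun_eq_iff algebra_simps)

definition linear_map_on ::
    "('x \<Rightarrow> complex) set \<Rightarrow> (('x \<Rightarrow> complex) \<Rightarrow> ('y \<Rightarrow> complex)) \<Rightarrow> bool" where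
  "linear_map_on W F \<longleftrightarrow>
     (\<forall>x\<in>W. \<forall>y\<in>W. F (x + y) = F x + F y) \<and> (\<forall>c. \<forall>x\<in>W. F (fscale c x) = fscale c (F x))"

text \<open>Functionals on a subspace \<open>W\<close> are normalised to be 0 off \<open>W\<close>, so that each is represented once.\<close>

definition dual_space :: "('x \<Rightarrow> complex) set \<Rightarrow> (('x \<Rightarrow> complex) \<Rightarrow> complex) set" where
  "dual_space W =
     {\<phi>. (\<forall>x\<in>W. \<forall>y\<in>W. \<phi> (x + y) = \<phi> x + \<phi> y) \<and> (\<forall>c. \<forall>x\<in>W. \<phi> (fscale c x) = c * \<phi> x) \<and>
         (\<forall>x. x \<notin> W \<longrightarrow> \<phi> x = 0)}"

text \<open>The tensor \<open>w\<^sub>1 \<otimes> \<dots> \<otimes> w\<^sub>k\<close> of functions on \<open>X\<close> is the function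
  \<open>(b\<^sub>1, \<dots>, b\<^sub>k) \<mapsto> w\<^sub>1 b\<^sub>1 \<cdots> w\<^sub>k b\<^sub>k\<close> on \<open>X\<^sup>k\<close>.\<close>

definition pure_tensor :: "('x \<Rightarrow> complex) list \<Rightarrow> 'x list \<Rightarrow> complex" where
  "pure_tensor ws bs =
     (if length bs = length ws then \<Prod>j<length ws. (ws ! j) (bs ! j) else 0)"

definition tensor_power :: "nat \<Rightarrow> ('x \<Rightarrow> complex) set \<Rightarrow> ('x list \<Rightarrow> complex) set" where
  "tensor_power k W = cfun.span {pure_tensor ws |ws. length ws = k \<and> set ws \<subseteq> W}"

definition sym_tensors :: "nat \<Rightarrow> ('x \<Rightarrow> complex) set \<Rightarrow> ('x list \<Rightarrow> complex) set" where
  "sym_tensors k W =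
     {T \<in> tensor_power k W.
        \<forall>\<sigma>. \<sigma> permutes {..<k} \<longrightarrow> (\<forall>bs. length bs = k \<longrightarrow> T (permute_list \<sigma> bs) = T bs)}"


section \<open>Modules over the general linear group\<close>

definition GL :: "nat \<Rightarrow> complex mat monoid" where
  "GL m = units_of (ring_mat TYPE(complex) m ())"

text \<open>The coordinate ring of the algebraic group \<open>GL m\<close>: polynomials in the entries and in
  \<open>1 / det\<close>.\<close>

inductive_set regular_functions :: "nat \<Rightarrow> (complex mat \<Rightarrow> complex) set" for m where
  const: "(\<lambda>g. c) \<in> regular_functions m"
| entry: "p < m \<Longrightarrow> q < m \<Longrightarrow> (\<lambda>g. g $$ (p, q)) \<in> regular_functions m"
| inverse_det: "(\<lambda>g. 1 / det g) \<in> regular_functions m"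
| add: "f \<in> regular_functions m \<Longrightarrow> h \<in> regular_functions m \<Longrightarrow> (\<lambda>g. f g + h g) \<in> regular_functions m"
| mult: "f \<in> regular_functions m \<Longrightarrow> h \<in> regular_functions m \<Longrightarrow> (\<lambda>g. f g * h g) \<in> regular_functions m"

text \<open>A \<open>GL m\<close>-module is a finite-dimensional rational representation.\<close>

definition GL_module ::
    "nat \<Rightarrow> ('x \<Rightarrow> complex) set \<Rightarrow> (complex mat \<Rightarrow> ('x \<Rightarrow> complex) \<Rightarrow> 'x \<Rightarrow> complex) \<Rightarrow> bool" where
  "GL_module m W \<rho> \<longleftrightarrow>
     cfun.subspace W \<and> (\<exists>B. finite B \<and> cfun.span B = W) \<and>
     (\<forall>g\<in>carrier (GL m). \<rho> g ` W \<subseteq> W \<and> linear_map_on W (\<rho> g)) \<and>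
     (\<forall>x\<in>W. \<rho> \<one>\<^bsub>GL m\<^esub> x = x) \<and>
     (\<forall>g\<in>carrier (GL m). \<forall>h\<in>carrier (GL m). \<forall>x\<in>W. \<rho> (g \<otimes>\<^bsub>GL m\<^esub> h) x = \<rho> g (\<rho> h x)) \<and>
     (\<forall>x\<in>W. \<forall>\<phi>\<in>dual_space W. \<exists>f\<in>regular_functions m. \<forall>g\<in>carrier (GL m). \<phi> (\<rho> g x) = f g)"

definition GL_submodule ::
    "nat \<Rightarrow> (complex mat \<Rightarrow> ('x \<Rightarrow> complex) \<Rightarrow> 'x \<Rightarrow> complex) \<Rightarrow>
     ('x \<Rightarrow> complex) set \<Rightarrow> ('x \<Rightarrow> complex) set \<Rightarrow> bool" where
  "GL_submodule m \<rho> N W \<longleftrightarrow>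
     cfun.subspace N \<and> N \<subseteq> W \<and> (\<forall>g\<in>carrier (GL m). \<rho> g ` N \<subseteq> N)"

definition generated_GL_submodule ::
    "nat \<Rightarrow> (complex mat \<Rightarrow> ('x \<Rightarrow> complex) \<Rightarrow> 'x \<Rightarrow> complex) \<Rightarrow>
     ('x \<Rightarrow> complex) set \<Rightarrow> ('x \<Rightarrow> complex) \<Rightarrow> ('x \<Rightarrow> complex) set" where
  "generated_GL_submodule m \<rho> W x = \<Inter> {N. GL_submodule m \<rho> N W \<and> x \<in> N}"

definition GL_isomorphic ::
    "nat \<Rightarrow> ('x \<Rightarrow> complex) set \<Rightarrow> (complex mat \<Rightarrow> ('x \<Rightarrow> complex) \<Rightarrow> 'x \<Rightarrow> complex) \<Rightarrow>
     ('y \<Rightarrow> complex) set \<Rightarrow> (complex mat \<Rightarrow> ('y \<Rightarrow> complex) \<Rightarrow> 'y \<Rightarrow> complex) \<Rightarrow> bool" where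
  "GL_isomorphic m W \<rho> E \<tau> \<longleftrightarrow>
     (\<exists>F. linear_map_on W F \<and> bij_betw F W E \<and>
          (\<forall>g\<in>carrier (GL m). \<forall>x\<in>W. F (\<rho> g x) = \<tau> g (F x)))"

definition irreducible_GL_module ::
    "nat \<Rightarrow> ('x \<Rightarrow> complex) set \<Rightarrow> (complex mat \<Rightarrow> ('x \<Rightarrow> complex) \<Rightarrow> 'x \<Rightarrow> complex) \<Rightarrow> bool" where
  "irreducible_GL_module m W \<rho> \<longleftrightarrow>
     GL_module m W \<rho> \<and> W \<noteq> {0} \<and> (\<forall>N. GL_submodule m \<rho> N W \<longrightarrow> N = {0} \<or> N = W)"

text \<open>A highest weight vector is a nonzero eigenvector of the Borel subgroup of upper triangular
  matrices; \<open>\<mu>\<close> lists the parts of the weight, missing parts being 0.\<close>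

definition highest_weight_vector ::
    "nat \<Rightarrow> (complex mat \<Rightarrow> ('x \<Rightarrow> complex) \<Rightarrow> 'x \<Rightarrow> complex) \<Rightarrow> nat list \<Rightarrow> ('x \<Rightarrow> complex) \<Rightarrow> bool" where
  "highest_weight_vector m \<rho> \<mu> w \<longleftrightarrow>
     w \<noteq> 0 \<and>
     (\<forall>b\<in>carrier (GL m). upper_triangular b \<longrightarrow>
        \<rho> b w = fscale (\<Prod>j<m. (b $$ (j, j)) ^ nth_default 0 \<mu> j) w)"

definition irreducible_with_highest_weight ::
    "nat \<Rightarrow> nat list \<Rightarrow> ('x \<Rightarrow> complex) set \<Rightarrow>
     (complex mat \<Rightarrow> ('x \<Rightarrow> complex) \<Rightarrow> 'x \<Rightarrow> complex) \<Rightarrow> bool" where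
  "irreducible_with_highest_weight m \<mu> W \<rho> \<longleftrightarrow>
     irreducible_GL_module m W \<rho> \<and> (\<exists>w\<in>W. highest_weight_vector m \<rho> \<mu> w)"

definition dual_action ::
    "nat \<Rightarrow> ('x \<Rightarrow> complex) set \<Rightarrow> (complex mat \<Rightarrow> ('x \<Rightarrow> complex) \<Rightarrow> 'x \<Rightarrow> complex) \<Rightarrow>
     complex mat \<Rightarrow> (('x \<Rightarrow> complex) \<Rightarrow> complex) \<Rightarrow> ('x \<Rightarrow> complex) \<Rightarrow> complex" where
  "dual_action m W \<rho> g \<phi> = (\<lambda>x. if x \<in> W then \<phi> (\<rho> (inv\<^bsub>GL m\<^esub> g) x) else 0)"

definition isotypic_component ::
    "nat \<Rightarrow> ('x \<Rightarrow> complex) set \<Rightarrow> (complex mat \<Rightarrow> ('x \<Rightarrow> complex) \<Rightarrow> 'x \<Rightarrow> complex) \<Rightarrow>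
     ('y \<Rightarrow> complex) set \<Rightarrow> (complex mat \<Rightarrow> ('y \<Rightarrow> complex) \<Rightarrow> 'y \<Rightarrow> complex) \<Rightarrow>
     ('x \<Rightarrow> complex) set" where
  "isotypic_component m W \<rho> E \<tau> =
     cfun.span (\<Union> {N. GL_submodule m \<rho> N W \<and> GL_isomorphic m N \<rho> E \<tau>})"


section \<open>The module \<open>S\<^sup>i(S\<^sup>m(V\<^sub>m\<^sup>*))\<close>\<close>

text \<open>\<open>V\<^sub>m\<^sup>*\<close> in coordinates with respect to the dual basis: a function \<open>\<phi>\<close> supported in \<open>{..<m}\<close> stands
  for the functional with value \<open>\<phi> q\<close> at the standard basis vector with index \<open>q\<close>.\<close>

definition V_dual :: "nat \<Rightarrow> (nat \<Rightarrow> complex) set" where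
  "V_dual m = {\<phi>. \<forall>q. q \<notin> {..<m} \<longrightarrow> \<phi> q = 0}"

definition v_star :: "nat \<Rightarrow> nat \<Rightarrow> complex" where
  "v_star p = (\<lambda>q. if q = p then 1 else 0)"

definition v_o :: "nat \<Rightarrow> nat list \<Rightarrow> complex" where
  "v_o m = fscale (1 / fact m)
     (\<Sum>\<sigma> | \<sigma> permutes {..<m}. pure_tensor (map (\<lambda>j. v_star (\<sigma> j)) [0..<m]))"

text \<open>A linear endomorphism of the functions supported on a finite set \<open>B\<close> is given by its matrix
  \<open>K\<close>; the \<open>k\<close>-th tensor power of the endomorphism has as matrix the \<open>k\<close>-th Kronecker power of \<open>K\<close>.\<close>

definition kernel_map :: "'b set \<Rightarrow> ('b \<Rightarrow> 'b \<Rightarrow> complex) \<Rightarrow> ('b \<Rightarrow> complex) \<Rightarrow> 'b \<Rightarrow> complex" where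
  "kernel_map B K f = (\<lambda>b. if b \<in> B then \<Sum>c\<in>B. K b c * f c else 0)"

definition kernel_power :: "nat \<Rightarrow> ('b \<Rightarrow> 'b \<Rightarrow> complex) \<Rightarrow> 'b list \<Rightarrow> 'b list \<Rightarrow> complex" where
  "kernel_power k K bs cs = (\<Prod>j<k. K (bs ! j) (cs ! j))"

definition words :: "nat \<Rightarrow> 'b set \<Rightarrow> 'b list set" where
  "words k B = {bs. length bs = k \<and> set bs \<subseteq> B}"

text \<open>The contragredient action \<open>(g \<cdot> \<phi>) v = \<phi> (g\<inverse> v)\<close> on \<open>V\<^sub>m\<^sup>*\<close> sends \<open>\<phi>\<close> to the functional with value
  \<open>\<Sum>p. \<phi> p * (g\<inverse>)\<^bsub>p q\<^esub>\<close> at the basis vector with index \<open>q\<close>.\<close>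

definition V_dual_kernel :: "nat \<Rightarrow> complex mat \<Rightarrow> nat \<Rightarrow> nat \<Rightarrow> complex" where
  "V_dual_kernel m g q p = (inv\<^bsub>GL m\<^esub> g) $$ (p, q)"

definition S_S_space :: "nat \<Rightarrow> nat \<Rightarrow> (nat list list \<Rightarrow> complex) set" where
  "S_S_space i m = sym_tensors i (sym_tensors m (V_dual m))"

definition S_S_action ::
    "nat \<Rightarrow> nat \<Rightarrow> complex mat \<Rightarrow> (nat list list \<Rightarrow> complex) \<Rightarrow> nat list list \<Rightarrow> complex" where
  "S_S_action i m g =
     kernel_map (words i (words m {..<m})) (kernel_power i (kernel_power m (V_dual_kernel m g)))"

definition U :: "nat \<Rightarrow> nat \<Rightarrow> (nat list list \<Rightarrow> complex) set" where
  "U i m =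
     generated_GL_submodule m (S_S_action i m) (S_S_space i m) (pure_tensor (replicate i (v_o m)))"

text \<open>The partition \<open>m\<delta>\<^sub>i\<close>.\<close>

definition m_delta :: "nat \<Rightarrow> nat \<Rightarrow> nat list" where
  "m_delta m i = map ((*) m) (replicate i 1)"

text \<open>The isotypic component of \<open>S\<^sup>i(S\<^sup>m(V\<^sub>m\<^sup>*))\<close> corresponding to the dual of the module \<open>E\<close>.\<close>

definition dual_isotypic ::
    "nat \<Rightarrow> nat \<Rightarrow> ('x \<Rightarrow> complex) set \<Rightarrow> (complex mat \<Rightarrow> ('x \<Rightarrow> complex) \<Rightarrow> 'x \<Rightarrow> complex) \<Rightarrow>
     (nat list list \<Rightarrow> complex) set" where
  "dual_isotypic i m E \<tau> =
     isotypic_component m (S_S_space i m) (S_S_action i m) (dual_space E) (dual_action m E \<tau>)"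

end

(*
Write X' for the dual of X. A tensor f in S^i(S^m V') is determined by the polynomial P_f(x_1,
..., x_i), of degree m in each vector x_p, that it defines. Let E be irreducible with highest
weight m delta_i and highest weight vector w. Letting diag(1, s, s^2, ...) act on a functional and
passing to the limit s -> 0 yields phi_0 in E' with phi_0(g w) = D_i(g)^m, where D_i is the
leading i x i minor: this is checked on the big cell of LU-decomposable matrices and extended by
continuity. The tensor f_0 obtained from the m-th power of v_1' wedge ... wedge v_i' by
symmetrising each row has P_{f_0}(g v_1, ..., g v_i) = D_i(g)^m as well, so g phi_0 -> g f_0
embeds E' in S^i(S^m V').

The adjoint of g for the standard Hermitian form is again an element of GL(V), so the orthogonal
projection onto U_i is equivariant; it is nonzero on the copy of E' unless
<g f_0, v_o^i> = 0 for all g. This pairing is the polynomial of the column antisymmetrisation of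
v_o^i evaluated at the rows of g^{-1}, and the entries of that antisymmetrisation are, up to sign
and the factor (m!)^{-i}, the differences #L^+ - #L^-. For i = m the module E is det^m, the
component of its dual is the line through f_0, and <f_0, v_o^m> is a nonzero multiple of
#CELS - #COLS.
*)
theory Submission
  imports Defs Complex_Main "HOL-Library.FuncSet" "Jordan_Normal_Form.Char_Poly"
begin

text \<open>The module \<open>E\<close> is known only abstractly, so it is reached through matrix
  coefficients: a functional \<open>\<phi>\<close> on \<open>E\<close> corresponds to a tensor
  \<open>f\<close> when \<open>\<phi> (g w) = P_f (g v_1, ..., g v_i)\<close> for all invertible
  \<open>g\<close>. The orbit of \<open>w\<close> spans \<open>E\<close> and invertible matrices are
  dense, so each side determines the other, and irreducibility extends the single pair formed by
  phi_0 and f_0 to all of the dual. Two obstacles shape the combinatorics. Elements of the tensor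
  space must also be symmetric under exchange of rows of the \<open>i x m\<close> rectangle, while
  f_0 comes from a tensor alternating in each column; exchanging two rows costs one sign per column,
  which cancels because \<open>m\<close> is even. Secondly, the column antisymmetrisation of v_o^i
  is not row symmetric, so the vanishing of its polynomial does not directly annihilate its entries;
  positivity of the Hermitian norm closes this gap. Latin squares control all smaller
  \<open>i\<close> because the column group of the first \<open>i\<close> rows is a subgroup of that
  of the square.\<close>

section \<open>Difference products and signs of permutations\<close>

lemma endo_bij_betw: "finite A \<Longrightarrow> f ` A \<subseteq> A \<Longrightarrow> inj_on f A \<Longrightarrow> bij_betw f A A"
  by (simp add: bij_betw_def endo_inj_surj)

text \<open>A permutation acts on the unordered pairs of indices. The map \<open>r\<close> sends a
  pair to its image sorted again, and a factor changes sign exactly when sorting has to exchange the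
  two entries.\<close>

lemma prod_pairs_permute:
  fixes y :: "nat \<Rightarrow> int"
  assumes "\<tau> permutes {..<n}"
  shows "(\<Prod>p'<n. \<Prod>p<p'. y (\<tau> p') - y (\<tau> p)) =
    (\<Prod>p'<n. \<Prod>p<p'. if \<tau> p < \<tau> p' then 1 else -1) * (\<Prod>p'<n. \<Prod>p<p'. y p' - y p)"
proof -
  define S where "S = (SIGMA p':{..<n}. {..<p'})"
  have S: "(\<Prod>p'<n. \<Prod>p<p'. f p' p) = (\<Prod>(p', p)\<in>S. f p' p)" for f :: "nat \<Rightarrow> nat \<Rightarrow> int"
    unfolding S_def by (subst prod.Sigma) auto
  define r where "r = (\<lambda>(p', p). (max (\<tau> p') (\<tau> p), min (\<tau> p') (\<tau> p)))"
  have inj: "inj \<tau>" and img: "\<And>x. x < n \<Longrightarrow> \<tau> x < n"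
    using assms permutes_inj permutes_in_image[OF assms] by auto
  have fS: "finite S" unfolding S_def by auto
  have "inj_on r S"
    by (auto simp: inj_on_def r_def S_def max_def min_def inj_eq[OF inj] split: if_splits)
  moreover have "r ` S \<subseteq> S"
  proof
    fix x assume "x \<in> r ` S"
    then obtain p p' where x: "x = r (p', p)" "p' < n" "p < p'" by (auto simp: S_def)
    then have "\<tau> p \<noteq> \<tau> p'" "\<tau> p < n" "\<tau> p' < n" using img by (auto simp: inj_eq[OF inj])
    then show "x \<in> S" by (auto simp: x r_def S_def)
  qed
  ultimately have r: "bij_betw r S S"
    using fS by (rule_tac endo_bij_betw)
  have "(\<Prod>(p', p)\<in>S. y (\<tau> p') - y (\<tau> p)) =
      (\<Prod>x\<in>S. (case x of (p', p) \<Rightarrow> if \<tau> p < \<tau> p' then 1 else -1) * (case r x of (p', p) \<Rightarrow> y p' - y p))"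
    by (rule prod.cong) (auto simp: r_def max_def min_def)
  also have "\<dots> = (\<Prod>(p', p)\<in>S. if \<tau> p < \<tau> p' then 1 else -1) * (\<Prod>(p', p)\<in>S. y p' - y p)"
    by (simp only: prod.distrib prod.reindex_bij_betw[OF r])
  finally show ?thesis by (simp only: S)
qed

text \<open>The inversions are the pair \<open>(b, a)\<close> itself and, for every index strictly
  between, one pair with \<open>b\<close> and one with \<open>a\<close>. Their number is
  odd.\<close>

lemma inversion_sign_transpose:
  fixes a b n :: nat
  assumes "a < b" "b < n"
  shows "(\<Prod>p'<n. \<Prod>p<p'. if transpose a b p < transpose a b p' then 1 else -1) = (-1::int)"
proof -
  define S where "S = (SIGMA p':{..<n}. {..<p'})"
  define I where "I = {(p', p). p < p' \<and> p' < n \<and> transpose a b p' < transpose a b p}"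
  have "(\<Prod>p'<n. \<Prod>p<p'. if transpose a b p < transpose a b p' then 1 else -1)
      = (\<Prod>(p', p)\<in>S. if transpose a b p < transpose a b p' then 1 else -1 :: int)"
    unfolding S_def by (subst prod.Sigma) auto
  also have "\<dots> = (\<Prod>x\<in>S. if x \<in> I then -1 else 1)"
  proof (rule prod.cong[OF refl])
    fix x assume "x \<in> S"
    then obtain p' p where x: "x = (p', p)" "p' < n" "p < p'" by (auto simp: S_def)
    have "transpose a b p \<noteq> transpose a b p'" using x(3) by (auto simp: transpose_eq_iff)
    then show "(case x of (p', p) \<Rightarrow> if transpose a b p < transpose a b p' then 1 else -1)
        = (if x \<in> I then -1 else (1::int))"
      using x by (auto simp: I_def)
  qed
  also have "\<dots> = (-1) ^ card (S \<inter> I)"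
    by (subst prod.inter_restrict[symmetric]) (auto simp: S_def)
  also have "S \<inter> I = {(b, a)} \<union> {b} \<times> {a<..<b} \<union> {a<..<b} \<times> {a}"
    using assms by (auto simp: S_def I_def transpose_def split: if_splits)
  also have "card \<dots> = 1 + (b - Suc a) + (b - Suc a)"
  proof -
    have "card ({(b, a)} \<union> {b} \<times> {a<..<b} \<union> {a<..<b} \<times> {a})
        = card ({(b, a)} \<union> {b} \<times> {a<..<b}) + card ({a<..<b} \<times> {a})"
      by (rule card_Un_disjoint) auto
    also have "card ({(b, a)} \<union> {b} \<times> {a<..<b}) = card {(b, a)} + card ({b} \<times> {a<..<b})"
      by (rule card_Un_disjoint) auto
    finally show ?thesis by (simp add: card_cartesian_product)
  qed
  finally show ?thesis by (simp add: mult_2[symmetric] power_add)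
qed

text \<open>Connects the difference products in \<open>column_sign\<close> with the
  \<open>sign\<close> of Leibniz expansions. The inversion product \<open>v\<close> is the factor by
  which a nonzero difference product changes under a permutation, so it is multiplicative;
  comparison on transpositions suffices.\<close>

lemma sign_inversions:
  fixes n :: nat
  assumes "\<tau> permutes {..<n}"
  shows "(\<Prod>p'<n. \<Prod>p<p'. if \<tau> p < \<tau> p' then 1 else -1) = sign \<tau>"
proof -
  define v :: "(nat \<Rightarrow> nat) \<Rightarrow> int" where "v = (\<lambda>\<tau>. \<Prod>p'<n. \<Prod>p<p'. if \<tau> p < \<tau> p' then 1 else (-1::int))"
  define D where "D = (\<lambda>y. \<Prod>p'<n. \<Prod>p<p'. y p' - (y p :: int))"
  have D: "D (y \<circ> \<tau>) = v \<tau> * D y" if "\<tau> permutes {..<n}" for \<tau> y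
    using prod_pairs_permute[OF that, of y] by (simp add: v_def D_def)
  have D0: "D (int \<circ> \<tau>) \<noteq> 0" if "\<tau> permutes {..<n}" for \<tau>
    using permutes_inj[OF that] by (auto simp: D_def dest: injD)
  have v: "v (\<sigma> \<circ> \<tau>) = v \<sigma> * v \<tau>" if "\<sigma> permutes {..<n}" "\<tau> permutes {..<n}" for \<sigma> \<tau>
  proof -
    have "v (\<sigma> \<circ> \<tau>) * D int = D (int \<circ> \<sigma> \<circ> \<tau>)"
      using D[OF permutes_compose[OF that(2) that(1)], of int] by (simp add: o_assoc)
    also have "\<dots> = v \<tau> * (v \<sigma> * D int)" using D[OF that(2)] D[OF that(1)] by simp
    finally show ?thesis using D0[OF permutes_id] by simp
  qed
  have "v \<tau> = sign \<tau>"
    using assms finite_lessThan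
  proof (induction rule: permutes_induct)
    case id
    then show ?case by (auto simp: v_def)
  next
    case (swap a b p)
    have ab: "v (transpose a b) = -1"
      using swap(1-3) inversion_sign_transpose[of a b n] inversion_sign_transpose[of b a n]
      by (cases "a < b") (auto simp: v_def transpose_commute)
    have "permutation (transpose a b)" "permutation p"
      using swap by (auto intro: permutation_swap_id permutes_imp_permutation)
    moreover have "transpose a b permutes {..<n}" using swap by (intro permutes_swap_id)
    ultimately show ?case
      using swap(3-5) ab v[of "transpose a b" p] sign_compose[of "transpose a b" p] sign_swap_id[of a b]
      by metis
  qed
  then show ?thesis by (simp add: v_def)
qed

section \<open>Groups of permutations\<close>

abbreviation pinv :: "('a \<Rightarrow> 'a) \<Rightarrow> 'a \<Rightarrow> 'a" where
  "pinv \<equiv> inv_into UNIV"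

definition perm_group :: "'a set \<Rightarrow> ('a \<Rightarrow> 'a) set \<Rightarrow> bool" where
  "perm_group X G \<longleftrightarrow> (\<forall>\<pi>\<in>G. \<pi> permutes X \<and> pinv \<pi> \<in> G) \<and> id \<in> G \<and> (\<forall>\<pi>\<in>G. \<forall>\<kappa>\<in>G. \<pi> \<circ> \<kappa> \<in> G)"

lemma perm_groupD:
  assumes "perm_group X G" "\<pi> \<in> G"
  shows "\<pi> permutes X" "pinv \<pi> \<in> G" "bij \<pi>" "\<pi> \<circ> pinv \<pi> = id" "pinv \<pi> \<circ> \<pi> = id" "pinv (pinv \<pi>) = \<pi>"
    "\<kappa> \<in> G \<Longrightarrow> \<pi> \<circ> \<kappa> \<in> G"
proof -
  show *: "\<pi> permutes X" "pinv \<pi> \<in> G" "\<kappa> \<in> G \<Longrightarrow> \<pi> \<circ> \<kappa> \<in> G"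
    using assms by (auto simp: perm_group_def)
  show "bij \<pi>" "\<pi> \<circ> pinv \<pi> = id" "pinv \<pi> \<circ> \<pi> = id" "pinv (pinv \<pi>) = \<pi>"
    using *(1) permutes_bij permutes_inv_o permutes_inv_inv by blast+
qed

lemma perm_group_finite: "perm_group X G \<Longrightarrow> finite X \<Longrightarrow> finite G"
  by (rule finite_subset[of _ "{\<pi>. \<pi> permutes X}"]) (auto simp: perm_group_def finite_permutations)

lemma perm_group_card_pos: "perm_group X G \<Longrightarrow> finite X \<Longrightarrow> card G > 0"
  using perm_group_finite[of X G] by (auto simp: card_gt_0_iff perm_group_def)

lemma sum_perm_group_right:
  assumes "perm_group X G" "\<kappa> \<in> G"
  shows "(\<Sum>\<pi>\<in>G. F (\<pi> \<circ> \<kappa>)) = (\<Sum>\<pi>\<in>G. F \<pi>)"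
  by (rule sum.reindex_bij_witness[of _ "\<lambda>\<pi>. \<pi> \<circ> pinv \<kappa>" "\<lambda>\<pi>. \<pi> \<circ> \<kappa>"])
    (use assms in \<open>auto simp: comp_assoc perm_groupD(4,5) intro!: perm_groupD\<close>)

lemma sum_perm_group_left:
  assumes "perm_group X G" "\<kappa> \<in> G"
  shows "(\<Sum>\<pi>\<in>G. F (\<kappa> \<circ> \<pi>)) = (\<Sum>\<pi>\<in>G. F \<pi>)"
  by (rule sum.reindex_bij_witness[of _ "\<lambda>\<pi>. pinv \<kappa> \<circ> \<pi>" "\<lambda>\<pi>. \<kappa> \<circ> \<pi>"])
    (use assms in \<open>auto simp: comp_assoc[symmetric] perm_groupD(4,5) intro!: perm_groupD\<close>)

section \<open>Fillings of a rectangle\<close>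

definition cells :: "nat \<Rightarrow> nat \<Rightarrow> (nat \<times> nat) set" where
  "cells i m = {..<i} \<times> {..<m}"

text \<open>A filling is a multi-index of a tensor with \<open>i * m\<close> slots, row
  \<open>p\<close> being the index word of the \<open>p\<close>-th symmetric factor. Permutations of
  cells act by precomposition, so all symmetrisations become sums over subgroups.\<close>

definition fillings :: "nat \<Rightarrow> nat \<Rightarrow> (nat \<times> nat \<Rightarrow> nat) set" where
  "fillings i m = cells i m \<rightarrow>\<^sub>E {..<m}"

text \<open>This and \<open>col_group\<close> are the row and column stabilisers of the rectangular
  tableau, as in a Young symmetriser.\<close>

definition row_group :: "nat \<Rightarrow> nat \<Rightarrow> (nat \<times> nat \<Rightarrow> nat \<times> nat) set" where
  "row_group i m = {\<pi>. \<pi> permutes cells i m \<and> (\<forall>c. fst (\<pi> c) = fst c)}"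

definition col_group :: "nat \<Rightarrow> nat \<Rightarrow> (nat \<times> nat \<Rightarrow> nat \<times> nat) set" where
  "col_group i m = {\<pi>. \<pi> permutes cells i m \<and> (\<forall>c. snd (\<pi> c) = snd c)}"

text \<open>For a column permutation this is its ordinary sign, written as a product over columns to
  match the definition of column parity.\<close>

definition col_sign :: "nat \<Rightarrow> (nat \<times> nat \<Rightarrow> nat \<times> nat) \<Rightarrow> int" where
  "col_sign m \<pi> = (\<Prod>q<m. sign (\<lambda>p. fst (\<pi> (p, q))))"

lemma finite_cells [simp]: "finite (cells i m)"
  by (simp add: cells_def)

lemma finite_fillings [simp]: "finite (fillings i m)"
  by (simp add: fillings_def finite_PiE)

lemma prod_cells: "(\<Prod>c\<in>cells i m. F c) = (\<Prod>p<i. \<Prod>q<m. F (p, q))"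
  by (simp add: cells_def prod.cartesian_product)

lemma prod_cells': "(\<Prod>c\<in>cells i m. F c) = (\<Prod>q<m. \<Prod>p<i. F (p, q))"
  unfolding prod_cells by (rule prod.swap)

lemma perm_group_stabiliser: "perm_group X {\<pi>. \<pi> permutes X \<and> (\<forall>c. f (\<pi> c) = f c)}"
  unfolding perm_group_def
proof (intro conjI ballI)
  fix \<pi> assume \<pi>: "\<pi> \<in> {\<pi>. \<pi> permutes X \<and> (\<forall>c. f (\<pi> c) = f c)}"
  then show "\<pi> permutes X" by simp
  have "f (pinv \<pi> c) = f c" for c
    using \<pi> by (metis (mono_tags, lifting) mem_Collect_eq permutes_inverses(1))
  then show "pinv \<pi> \<in> {\<pi>. \<pi> permutes X \<and> (\<forall>c. f (\<pi> c) = f c)}"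
    using \<pi> permutes_inv by auto
qed (auto simp: permutes_id intro: permutes_compose)

lemma perm_group_row: "perm_group (cells i m) (row_group i m)"
  and perm_group_col: "perm_group (cells i m) (col_group i m)"
  unfolding row_group_def col_group_def by (rule perm_group_stabiliser)+

lemma inj_fixing_permutes:
  assumes "finite A" "inj f" "\<And>x. x \<notin> A \<Longrightarrow> f x = x"
  shows "f permutes A"
proof (rule bij_imp_permutes[OF endo_bij_betw])
  show "f ` A \<subseteq> A"
    by (rule image_subsetI) (metis assms(2,3) injD)
qed (use assms in \<open>auto intro: inj_on_subset\<close>)

lemma column_permutes:
  assumes "\<pi> \<in> col_group i m"
  shows "(\<lambda>p. fst (\<pi> (p, q))) permutes {..<i}"
proof (rule inj_fixing_permutes)
  have \<pi>: "\<pi> permutes cells i m" "\<And>c. snd (\<pi> c) = snd c"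
    using assms by (auto simp: col_group_def)
  show "fst (\<pi> (p, q)) = p" if "p \<notin> {..<i}" for p
    using permutes_not_in[OF \<pi>(1), of "(p, q)"] that by (auto simp: cells_def)
  have "\<pi> (p, q) = (fst (\<pi> (p, q)), q)" for p
    using \<pi>(2)[of "(p, q)"] by (metis prod.collapse snd_conv)
  then show "inj (\<lambda>p. fst (\<pi> (p, q)))"
    by (intro injI) (metis injD permutes_inj[OF \<pi>(1)] prod.inject)
qed simp

lemma col_group_eq:
  assumes "\<pi> \<in> col_group i m"
  shows "\<pi> (p, q) = (fst (\<pi> (p, q)), q)"
  using assms by (metis (mono_tags, lifting) col_group_def mem_Collect_eq prod.collapse snd_conv)

lemma col_sign_comp:
  assumes "\<pi> \<in> col_group i m" "\<kappa> \<in> col_group i m"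
  shows "col_sign m (\<pi> \<circ> \<kappa>) = col_sign m \<pi> * col_sign m \<kappa>"
proof -
  have "sign (\<lambda>p. fst ((\<pi> \<circ> \<kappa>) (p, q))) = sign (\<lambda>p. fst (\<pi> (p, q))) * sign (\<lambda>p. fst (\<kappa> (p, q)))" for q
  proof -
    have "(\<lambda>p. fst ((\<pi> \<circ> \<kappa>) (p, q))) = (\<lambda>p. fst (\<pi> (p, q))) \<circ> (\<lambda>p. fst (\<kappa> (p, q)))"
      unfolding comp_def
      by (intro ext arg_cong[where f = "\<lambda>c. fst (\<pi> c)"] col_group_eq[OF assms(2)])
    then show ?thesis
      using column_permutes[OF assms(1), of q] column_permutes[OF assms(2), of q]
      by (simp add: sign_compose permutes_imp_permutation[OF finite_lessThan])
  qed
  then show ?thesis by (simp add: col_sign_def prod.distrib)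
qed

lemma col_sign_square: "col_sign m \<pi> * col_sign m \<pi> = 1"
  by (simp add: col_sign_def prod.distrib[symmetric])

lemma fillings_comp:
  assumes "\<pi> permutes cells i m" "A \<in> fillings i m"
  shows "A \<circ> \<pi> \<in> fillings i m"
  unfolding fillings_def
proof (rule PiE_I)
  fix c assume "c \<in> cells i m"
  then show "(A \<circ> \<pi>) c \<in> {..<m}"
    using assms(2) permutes_in_image[OF assms(1), of c] by (auto simp: fillings_def)
next
  fix c assume "c \<notin> cells i m"
  then show "(A \<circ> \<pi>) c = undefined"
    using assms(2) permutes_not_in[OF assms(1), of c] by (auto simp: fillings_def)
qed

lemma sum_fillings_comp:
  assumes "\<pi> permutes cells i m"
  shows "(\<Sum>A\<in>fillings i m. F (A \<circ> \<pi>)) = (\<Sum>A\<in>fillings i m. F A)"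
proof (rule sum.reindex_bij_witness[of _ "\<lambda>A. A \<circ> pinv \<pi>" "\<lambda>A. A \<circ> \<pi>"])
  show "A \<circ> \<pi> \<circ> pinv \<pi> = A" "A \<circ> pinv \<pi> \<circ> \<pi> = A" for A :: "nat \<times> nat \<Rightarrow> nat"
    using permutes_inv_o[OF assms] by (simp_all add: comp_assoc)
qed (simp_all add: fillings_comp permutes_inv assms)

lemma prod_cells_permute:
  assumes "\<pi> permutes cells i m"
  shows "(\<Prod>c\<in>cells i m. F (\<pi> c)) = (\<Prod>c\<in>cells i m. F c)"
  using prod.permute[OF assms, of F] by (simp add: comp_def)

lemma col_perm_in_col_group:
  assumes "\<And>q. q < m \<Longrightarrow> \<sigma> q permutes {..<i}"
  shows "(\<lambda>(p, q). if q < m then (\<sigma> q p, q) else (p, q)) \<in> col_group i m" (is "?r \<in> _")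
proof -
  have "?r permutes cells i m"
  proof (rule inj_fixing_permutes)
    show "inj ?r"
      by (auto simp: inj_def split: if_splits dest: permutes_inj[OF assms, THEN injD])
    fix c assume "c \<notin> cells i m"
    then show "?r c = c"
      using permutes_not_in[OF assms, of "snd c" "fst c"] by (cases c) (auto simp: cells_def)
  qed simp
  then show ?thesis by (auto simp: col_group_def)
qed

text \<open>The column group is a direct product of one symmetric group per column and the sign is
  multiplicative, so the signed sum factors. Each factor is a Leibniz expansion, hence a
  determinant.\<close>

lemma sum_col_group_prod:
  fixes F :: "nat \<Rightarrow> nat \<Rightarrow> nat \<Rightarrow> complex"
  shows "(\<Sum>\<pi>\<in>col_group i m. of_int (col_sign m \<pi>) * (\<Prod>c\<in>cells i m. F (fst c) (snd c) (fst (\<pi> c))))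
    = (\<Prod>q<m. \<Sum>\<tau> | \<tau> permutes {..<i}. of_int (sign \<tau>) * (\<Prod>p<i. F p q (\<tau> p)))"
proof -
  have "(\<Prod>q<m. \<Sum>\<tau> | \<tau> permutes {..<i}. of_int (sign \<tau>) * (\<Prod>p<i. F p q (\<tau> p)))
    = (\<Sum>t\<in>{..<m} \<rightarrow>\<^sub>E {\<tau>. \<tau> permutes {..<i}}. \<Prod>q<m. of_int (sign (t q)) * (\<Prod>p<i. F p q (t q p)))"
    by (rule prod_sum_PiE) (auto intro: finite_permutations)
  also have "\<dots> = (\<Sum>\<pi>\<in>col_group i m. of_int (col_sign m \<pi>) * (\<Prod>c\<in>cells i m. F (fst c) (snd c) (fst (\<pi> c))))"
  proof (rule sum.reindex_bij_witness[of _ "\<lambda>\<pi>. restrict (\<lambda>q p. fst (\<pi> (p, q))) {..<m}"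
        "\<lambda>t (p, q). if q < m then (t q p, q) else (p, q)"])
    fix t assume t: "t \<in> {..<m} \<rightarrow>\<^sub>E {\<tau>. \<tau> permutes {..<i}}"
    let ?c = "\<lambda>(p, q). if q < m then (t q p, q) else (p, q)"
    have tp: "t q permutes {..<i}" if "q < m" for q using t that by auto
    show "restrict (\<lambda>q p. fst (?c (p, q))) {..<m} = t"
      using t by (auto simp: fun_eq_iff PiE_def extensional_def)
    show "?c \<in> col_group i m" by (rule col_perm_in_col_group[OF tp])
    show "of_int (col_sign m ?c) * (\<Prod>c\<in>cells i m. F (fst c) (snd c) (fst (?c c)))
      = (\<Prod>q<m. of_int (sign (t q)) * (\<Prod>p<i. F p q (t q p)))"
    proof -
      have "col_sign m ?c = (\<Prod>q<m. sign (t q))"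
        unfolding col_sign_def by (rule prod.cong) auto
      moreover have "(\<Prod>c\<in>cells i m. F (fst c) (snd c) (fst (?c c))) = (\<Prod>q<m. \<Prod>p<i. F p q (t q p))"
        unfolding prod_cells' by (auto intro!: prod.cong)
      ultimately show ?thesis by (simp add: prod.distrib of_int_prod)
    qed
  next
    fix \<pi> assume \<pi>: "\<pi> \<in> col_group i m"
    show "restrict (\<lambda>q p. fst (\<pi> (p, q))) {..<m} \<in> {..<m} \<rightarrow>\<^sub>E {\<tau>. \<tau> permutes {..<i}}"
      using column_permutes[OF \<pi>] by auto
    have "\<pi> (p, q) = (p, q)" if "\<not> q < m" for p q
      using \<pi> that by (intro permutes_not_in[of \<pi> "cells i m"]) (auto simp: col_group_def cells_def)
    then show "(\<lambda>(p, q). if q < m then (restrict (\<lambda>q p. fst (\<pi> (p, q))) {..<m} q p, q) else (p, q)) = \<pi>"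
      using col_group_eq[OF \<pi>] by (auto simp: fun_eq_iff)
  qed
  finally show ?thesis by simp
qed

section \<open>The polynomial of a filling function\<close>

text \<open>The polynomial obtained by inserting the vector \<open>x p\<close> into every slot of
  row \<open>p\<close>. It is defined for arbitrary functions of fillings because it is also applied
  to the column antisymmetrised \<open>latin_sum\<close>, which need not be row invariant.\<close>

definition ev :: "nat \<Rightarrow> nat \<Rightarrow> ((nat \<times> nat \<Rightarrow> nat) \<Rightarrow> complex) \<Rightarrow> (nat \<Rightarrow> nat \<Rightarrow> complex) \<Rightarrow> complex" where
  "ev i m F x = (\<Sum>A\<in>fillings i m. F A * (\<Prod>c\<in>cells i m. x (fst c) (A c)))"

definition row_invariant :: "nat \<Rightarrow> nat \<Rightarrow> ((nat \<times> nat \<Rightarrow> nat) \<Rightarrow> complex) \<Rightarrow> bool" where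
  "row_invariant i m F \<longleftrightarrow> (\<forall>\<rho>\<in>row_group i m. \<forall>A\<in>fillings i m. F (A \<circ> \<rho>) = F A)"

section \<open>Recovering a row invariant function from its polynomial\<close>

lemma base_expansion_unique:
  fixes a b :: "nat \<Rightarrow> nat"
  assumes "\<And>k. k < n \<Longrightarrow> a k < M" "\<And>k. k < n \<Longrightarrow> b k < M"
    and "(\<Sum>k<n. a k * M ^ k) = (\<Sum>k<n. b k * M ^ k)" and "k < n"
  shows "a k = b k"
  using assms
proof (induction n arbitrary: k)
  case (Suc n)
  have lt: "(\<Sum>k<l. c k * M ^ k) < M ^ l" if "\<And>k. k < l \<Longrightarrow> c k < M" for c :: "nat \<Rightarrow> nat" and l
    using that
  proof (induction l)
    case (Suc l)
    have "(\<Sum>k<Suc l. c k * M ^ k) < M ^ l + c l * M ^ l" using Suc by auto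
    also have "\<dots> = (Suc (c l)) * M ^ l" by simp
    also have "\<dots> \<le> M * M ^ l" using Suc.prems[of l] by (intro mult_right_mono) auto
    finally show ?case by simp
  qed simp
  have a: "(\<Sum>k<n. a k * M ^ k) < M ^ n" and b: "(\<Sum>k<n. b k * M ^ k) < M ^ n"
    using Suc.prems by (auto intro!: lt)
  have eq: "(\<Sum>k<n. a k * M ^ k) + a n * M ^ n = (\<Sum>k<n. b k * M ^ k) + b n * M ^ n"
    using Suc.prems(3) by simp
  have "M ^ n \<noteq> 0" using a by linarith
  then have "a n = ((\<Sum>k<n. a k * M ^ k) + a n * M ^ n) div M ^ n" using a by simp
  also have "\<dots> = b n" unfolding eq using b \<open>M ^ n \<noteq> 0\<close> by simp
  finally have n: "a n = b n" .
  show ?case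
  proof (cases "k = n")
    case False
    show ?thesis using Suc.prems False eq n by (intro Suc.IH) auto
  qed (use n in simp)
qed simp

lemma row_perm_in_row_group:
  assumes "\<And>p. p < i \<Longrightarrow> \<sigma> p permutes {..<m}"
  shows "(\<lambda>(p, q). if p < i then (p, \<sigma> p q) else (p, q)) \<in> row_group i m" (is "?r \<in> _")
proof -
  have "?r permutes cells i m"
  proof (rule inj_fixing_permutes)
    show "inj ?r"
      by (auto simp: inj_def split: if_splits dest: permutes_inj[OF assms, THEN injD])
    fix c assume "c \<notin> cells i m"
    then show "?r c = c"
      using permutes_not_in[OF assms, of "fst c" "snd c"] by (cases c) (auto simp: cells_def)
  qed simp
  then show ?thesis by (auto simp: row_group_def)
qed

lemma row_permutes:
  assumes "\<rho> \<in> row_group i m"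
  shows "(\<lambda>q. snd (\<rho> (p, q))) permutes {..<m}"
proof (rule inj_fixing_permutes)
  have \<rho>: "\<rho> permutes cells i m" "\<And>c. fst (\<rho> c) = fst c"
    using assms by (auto simp: row_group_def)
  show "snd (\<rho> (p, q)) = q" if "q \<notin> {..<m}" for q
    using permutes_not_in[OF \<rho>(1), of "(p, q)"] that by (auto simp: cells_def)
  have "\<rho> (p, q) = (p, snd (\<rho> (p, q)))" for q
    using \<rho>(2)[of "(p, q)"] by (metis prod.collapse fst_conv)
  then show "inj (\<lambda>q. snd (\<rho> (p, q)))"
    by (intro injI) (metis injD permutes_inj[OF \<rho>(1)] prod.inject)
qed simp

lemma row_group_eq:
  assumes "\<rho> \<in> row_group i m"
  shows "\<rho> (p, q) = (p, snd (\<rho> (p, q)))"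
  using assms by (metis (mono_tags, lifting) row_group_def mem_Collect_eq prod.collapse fst_conv)

text \<open>Equal multiplicities mean equal multisets of entries in each row, and lists with the
  same multiset differ by a permutation. Outside the rectangle both fillings take the same default
  value, so the equality holds as one of functions.\<close>

lemma row_equivalent_fillings:
  assumes A: "A \<in> fillings i m" and B: "B \<in> fillings i m"
    and card: "\<And>p r. p < i \<Longrightarrow> r < m \<Longrightarrow> card {q. q < m \<and> A (p, q) = r} = card {q. q < m \<and> B (p, q) = r}"
  obtains \<rho> where "\<rho> \<in> row_group i m" "B = A \<circ> \<rho>"
proof -
  have "\<exists>\<sigma>. \<sigma> permutes {..<m} \<and> (\<forall>q<m. B (p, q) = A (p, \<sigma> q))" if p: "p < i" for p
  proof -
    have "mset (map (\<lambda>q. B (p, q)) [0..<m]) = mset (map (\<lambda>q. A (p, q)) [0..<m])"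
    proof (rule multiset_eqI)
      fix r
      have *: "count (mset (map f [0..<m])) r = card {q. q < m \<and> f q = r}" for f :: "nat \<Rightarrow> nat"
      proof -
        have "{q. q < m \<and> f q = r} = f -` {r} \<inter> {..<m}" by auto
        then show ?thesis by (simp add: count_image_mset atLeast0LessThan)
      qed
      have **: "{q. q < m \<and> C (p, q) = r} = {}" if "C \<in> fillings i m" "\<not> r < m" for C
      proof -
        have "C (p, q) < m" if "q < m" for q
          using \<open>C \<in> _\<close> p that by (auto simp: fillings_def cells_def)
        with \<open>\<not> r < m\<close> show ?thesis by auto
      qed
      show "count (mset (map (\<lambda>q. B (p, q)) [0..<m])) r = count (mset (map (\<lambda>q. A (p, q)) [0..<m])) r"
        unfolding *
      proof (cases "r < m")
        case False
        show "card {q. q < m \<and> B (p, q) = r} = card {q. q < m \<and> A (p, q) = r}"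
          by (simp only: **[OF A False] **[OF B False])
      qed (simp add: card[OF p])
    qed
    then obtain \<sigma> where \<sigma>: "\<sigma> permutes {..<m}"
      "permute_list \<sigma> (map (\<lambda>q. A (p, q)) [0..<m]) = map (\<lambda>q. B (p, q)) [0..<m]"
      by (elim mset_eq_permutation) auto
    have "B (p, q) = A (p, \<sigma> q)" if q: "q < m" for q
    proof -
      have "map (\<lambda>q. B (p, q)) [0..<m] ! q = map (\<lambda>q. A (p, q)) [0..<m] ! \<sigma> q"
        unfolding \<sigma>(2)[symmetric] using \<sigma>(1) q by (subst permute_list_nth) auto
      moreover have "\<sigma> q < m" using permutes_in_image[OF \<sigma>(1), of q] q by simp
      ultimately show ?thesis using q by simp
    qed
    with \<sigma>(1) show ?thesis by blast
  qed
  then obtain \<sigma> where \<sigma>: "\<And>p. p < i \<Longrightarrow> \<sigma> p permutes {..<m}"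
    "\<And>p q. p < i \<Longrightarrow> q < m \<Longrightarrow> B (p, q) = A (p, \<sigma> p q)"
    by metis
  let ?r = "\<lambda>(p, q). if p < i then (p, \<sigma> p q) else (p, q)"
  have r: "?r \<in> row_group i m" by (rule row_perm_in_row_group[OF \<sigma>(1)])
  have "B = A \<circ> ?r"
  proof
    fix c
    show "B c = (A \<circ> ?r) c"
    proof (cases "c \<in> cells i m")
      case True
      then show ?thesis using \<sigma>(2) by (auto simp: cells_def)
    next
      case False
      then have "A c = B c" using A B PiE_arb unfolding fillings_def by metis
      moreover have "?r c = c"
        using False r permutes_not_in by (fastforce simp: row_group_def)
      ultimately show ?thesis by simp
    qed
  qed
  with r show ?thesis by (rule that)
qed

lemma fillings_less: "A \<in> fillings i m \<Longrightarrow> c \<in> cells i m \<Longrightarrow> A c < m"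
  unfolding fillings_def by (drule (1) PiE_mem) simp

text \<open>Kronecker substitution: \<open>x\<^sub>p\<^sub>r = s^(M^(pm + r))\<close> turns distinct monomials into distinct
  powers of \<open>s\<close>.\<close>

lemma ev_eq_0_imp:
  assumes inv: "row_invariant i m F" and ev: "\<And>x. ev i m F x = 0" and A: "A \<in> fillings i m"
  shows "F A = 0"
proof -
  \<comment> \<open>A variable \<open>(p, r)\<close> can occur only in the \<open>m\<close> cells of
    row \<open>p\<close>, so its exponent is at most \<open>m\<close> and serves as a digit in base
    \<open>m + 1\<close>.\<close>
  define M where "M = Suc m"
  define h where "h = (\<lambda>C (c :: nat \<times> nat). fst c * m + (C c :: nat))"
  define e where "e = (\<lambda>C. \<Sum>c\<in>cells i m. M ^ h C c)"
  \<comment> \<open>The variable \<open>(p, r)\<close> has number \<open>p * m + r\<close>;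
    \<open>N C k\<close> is the exponent of variable number \<open>k\<close> in the monomial of
    \<open>C\<close>, and thus the \<open>k\<close>-th digit of \<open>e C\<close>.\<close>
  define N where "N = (\<lambda>C k. card {c \<in> cells i m. h C c = k})"
  have dm: "h C c div m = fst c" "h C c mod m = C c" if "C \<in> fillings i m" "c \<in> cells i m" for C c
  proof -
    have "C c < m" using that by (rule fillings_less)
    then show "h C c div m = fst c" "h C c mod m = C c" by (simp_all add: h_def)
  qed
  have h: "h C c < i * m" if "C \<in> fillings i m" "c \<in> cells i m" for C c
  proof -
    have "fst c < i" "C c < m" using that fillings_less by (auto simp: cells_def)
    then have "h C c < Suc (fst c) * m" by (simp add: h_def)
    also have "\<dots> \<le> i * m" using \<open>fst c < i\<close> by (intro mult_right_mono) auto
    finally show ?thesis .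
  qed
  have eN: "e C = (\<Sum>k<i*m. N C k * M ^ k)" if C: "C \<in> fillings i m" for C
  proof -
    have "e C = (\<Sum>k<i*m. \<Sum>c | c \<in> cells i m \<and> h C c = k. M ^ h C c)"
      unfolding e_def by (rule sum.group[symmetric]) (use h[OF C] in auto)
    also have "\<dots> = (\<Sum>k<i*m. N C k * M ^ k)"
      by (intro sum.cong refl) (simp add: N_def)
    finally show ?thesis .
  qed
  have N: "N C k < M" if C: "C \<in> fillings i m" for C k
  proof -
    have "{c \<in> cells i m. h C c = k} \<subseteq> {k div m} \<times> {..<m}"
      using dm(1)[OF C] by (auto simp: cells_def)
    from card_mono[OF _ this] show ?thesis by (simp add: N_def M_def card_cartesian_product)
  qed
  have NA: "N C (p * m + r) = card {q. q < m \<and> C (p, q) = r}"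
    if C: "C \<in> fillings i m" and p: "p < i" and r: "r < m" for C p r
  proof -
    have "{c \<in> cells i m. h C c = p * m + r} = Pair p ` {q. q < m \<and> C (p, q) = r}"
    proof (intro equalityI subsetI)
      fix c assume "c \<in> {c \<in> cells i m. h C c = p * m + r}"
      then show "c \<in> Pair p ` {q. q < m \<and> C (p, q) = r}"
        using dm[OF C, of c] r by (cases c) (auto simp: cells_def)
    qed (use p in \<open>auto simp: h_def cells_def\<close>)
    then show ?thesis by (simp add: N_def card_image inj_on_def)
  qed
  define P where "P = (\<Sum>C\<in>fillings i m. monom (F C) (e C))"
  have "poly P s = 0" for s
  proof -
    have "poly P s = ev i m F (\<lambda>p r. s ^ (M ^ (p * m + r)))"
      by (simp add: P_def poly_sum poly_monom ev_def e_def h_def power_sum)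
    then show ?thesis using ev by simp
  qed
  then have "P = 0" using poly_all_0_iff_0 by blast
  then have "0 = coeff P (e A)" by simp
  also have "\<dots> = (\<Sum>C\<in>fillings i m. if e C = e A then F C else 0)"
    by (simp add: P_def coeff_sum)
  \<comment> \<open>Equal exponents have equal digits, hence equal entry multiplicities in each row.
    Such fillings are row rearrangements of \<open>A\<close> and share its value, so the coefficient
    is a positive multiple of \<open>F A\<close>.\<close>
  also have "\<dots> = (\<Sum>C\<in>fillings i m. if e C = e A then F A else 0)"
  proof (intro sum.cong refl if_cong)
    fix C assume C: "C \<in> fillings i m" "e C = e A"
    have NN: "N A k = N C k" if "k < i * m" for k
      using base_expansion_unique[of "i * m" "N A" M "N C" k] N C A eN that by auto
    have "card {q. q < m \<and> A (p, q) = r} = card {q. q < m \<and> C (p, q) = r}" if "p < i" "r < m" for p r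
    proof -
      have "p * m + r < Suc p * m" using that by simp
      also have "\<dots> \<le> i * m" using that by (intro mult_right_mono) auto
      finally show ?thesis using NN NA[OF A that] NA[OF C(1) that] by simp
    qed
    then obtain \<rho> where "\<rho> \<in> row_group i m" "C = A \<circ> \<rho>"
      by (rule row_equivalent_fillings[OF A C(1)])
    then show "F C = F A" using inv A by (simp add: row_invariant_def)
  qed
  also have "\<dots> = of_nat (card {C \<in> fillings i m. e C = e A}) * F A"
    by (simp add: sum.If_cases Collect_conj_eq[symmetric] Int_def)
  finally show ?thesis using A by (auto simp: card_eq_0_iff)
qed

section \<open>Tensors as functions on fillings\<close>

definition rows_of :: "nat \<Rightarrow> nat \<Rightarrow> (nat \<times> nat \<Rightarrow> nat) \<Rightarrow> nat list list" where
  "rows_of i m A = map (\<lambda>p. map (\<lambda>q. A (p, q)) [0..<m]) [0..<i]"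

abbreviation arrays :: "nat \<Rightarrow> nat \<Rightarrow> nat list list set" where
  "arrays i m \<equiv> words i (words m {..<m})"

lemma rows_of_nth [simp]:
  "p < i \<Longrightarrow> rows_of i m A ! p = map (\<lambda>q. A (p, q)) [0..<m]"
  "length (rows_of i m A) = i"
  by (simp_all add: rows_of_def)

lemma words_nth: "bs \<in> words k B \<Longrightarrow> j < k \<Longrightarrow> bs ! j \<in> B"
  by (auto simp: words_def)

lemma words_length: "bs \<in> words k B \<Longrightarrow> length bs = k"
  by (simp add: words_def)

lemma bij_rows_of: "bij_betw (rows_of i m) (fillings i m) (arrays i m)"
proof (rule bij_betw_byWitness[where f' = "\<lambda>bs. restrict (\<lambda>c. bs ! fst c ! snd c) (cells i m)"])
  show "\<forall>A\<in>fillings i m. restrict (\<lambda>c. rows_of i m A ! fst c ! snd c) (cells i m) = A"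
  proof
    fix A assume A: "A \<in> fillings i m"
    show "restrict (\<lambda>c. rows_of i m A ! fst c ! snd c) (cells i m) = A"
    proof
      fix c show "restrict (\<lambda>c. rows_of i m A ! fst c ! snd c) (cells i m) c = A c"
        using A by (cases c) (auto simp: cells_def fillings_def PiE_def extensional_def)
    qed
  qed
  show "\<forall>bs\<in>arrays i m. rows_of i m (restrict (\<lambda>c. bs ! fst c ! snd c) (cells i m)) = bs"
  proof
    fix bs assume bs: "bs \<in> arrays i m"
    show "rows_of i m (restrict (\<lambda>c. bs ! fst c ! snd c) (cells i m)) = bs"
    proof (rule nth_equalityI)
      fix p assume "p < length (rows_of i m (restrict (\<lambda>c. bs ! fst c ! snd c) (cells i m)))"
      then have p: "p < i" by simp
      then have "length (bs ! p) = m" using words_length[OF words_nth[OF bs]] by simp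
      then show "rows_of i m (restrict (\<lambda>c. bs ! fst c ! snd c) (cells i m)) ! p = bs ! p"
        using p by (intro nth_equalityI) (auto simp: cells_def)
    qed (use bs in \<open>simp add: words_def\<close>)
  qed
  show "rows_of i m ` fillings i m \<subseteq> arrays i m"
  proof (rule image_subsetI)
    fix A assume "A \<in> fillings i m"
    then have "A (p, q) < m" if "p < i" "q < m" for p q
      using that by (intro fillings_less) (auto simp: cells_def)
    then show "rows_of i m A \<in> arrays i m"
      by (auto simp: words_def rows_of_def)
  qed
  show "(\<lambda>bs. restrict (\<lambda>c. bs ! fst c ! snd c) (cells i m)) ` arrays i m \<subseteq> fillings i m"
  proof (rule image_subsetI)
    fix bs assume bs: "bs \<in> arrays i m"
    have "bs ! p ! q < m" if "p < i" "q < m" for p q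
      using words_nth[OF words_nth[OF bs that(1)] that(2)] by simp
    then show "restrict (\<lambda>c. bs ! fst c ! snd c) (cells i m) \<in> fillings i m"
      by (auto simp: fillings_def cells_def)
  qed
qed

lemma sum_words_fillings:
  "(\<Sum>bs\<in>arrays i m. F bs) = (\<Sum>A\<in>fillings i m. F (rows_of i m A))"
  by (rule sum.reindex_bij_betw[OF bij_rows_of, symmetric])

lemma rows_of_in_words: "A \<in> fillings i m \<Longrightarrow> rows_of i m A \<in> arrays i m"
  using bij_rows_of[of i m] by (auto simp: bij_betw_def)

lemma finite_words [simp]: "finite B \<Longrightarrow> finite (words k B)"
  using finite_lists_length_eq[of B k] by (simp add: words_def conj_commute)

lemma sum_words_prod:
  fixes G :: "nat \<Rightarrow> 'b \<Rightarrow> complex"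
  assumes "finite B"
  shows "(\<Sum>bs\<in>words k B. \<Prod>p<k. G p (bs ! p)) = (\<Prod>p<k. \<Sum>b\<in>B. G p b)"
proof -
  have "(\<Prod>p<k. \<Sum>b\<in>B. G p b) = (\<Sum>t\<in>{..<k} \<rightarrow>\<^sub>E B. \<Prod>p<k. G p (t p))"
    using assms by (intro prod_sum_PiE) auto
  also have "\<dots> = (\<Sum>bs\<in>words k B. \<Prod>p<k. G p (bs ! p))"
  proof (rule sum.reindex_bij_witness[of _ "\<lambda>bs. restrict (nth bs) {..<k}" "\<lambda>t. map t [0..<k]"])
    fix t assume "t \<in> {..<k} \<rightarrow>\<^sub>E B"
    then show "restrict (nth (map t [0..<k])) {..<k} = t" "map t [0..<k] \<in> words k B"
      by (auto simp: fun_eq_iff words_def PiE_def extensional_def)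
  next
    fix bs assume "bs \<in> words k B"
    then show "map (restrict (nth bs) {..<k}) [0..<k] = bs" "restrict (nth bs) {..<k} \<in> {..<k} \<rightarrow>\<^sub>E B"
      by (auto simp: words_def intro!: nth_equalityI)
  qed simp
  finally show ?thesis by simp
qed

lemma ev_pure_tensor:
  assumes "length ws = i"
  shows "ev i m (\<lambda>A. pure_tensor ws (rows_of i m A)) x
    = (\<Prod>p<i. \<Sum>b\<in>words m {..<m}. (ws ! p) b * (\<Prod>q<m. x p (b ! q)))"
proof -
  have "ev i m (\<lambda>A. pure_tensor ws (rows_of i m A)) x
      = (\<Sum>A\<in>fillings i m. (\<Prod>p<i. (ws ! p) (rows_of i m A ! p) * (\<Prod>q<m. x p (rows_of i m A ! p ! q))))"
    unfolding ev_def
  proof (rule sum.cong[OF refl])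
    fix A
    have "pure_tensor ws (rows_of i m A) = (\<Prod>p<i. (ws ! p) (rows_of i m A ! p))"
      using assms by (simp add: pure_tensor_def)
    moreover have "(\<Prod>c\<in>cells i m. x (fst c) (A c)) = (\<Prod>p<i. \<Prod>q<m. x p (rows_of i m A ! p ! q))"
      unfolding prod_cells by (intro prod.cong) auto
    ultimately show "pure_tensor ws (rows_of i m A) * (\<Prod>c\<in>cells i m. x (fst c) (A c))
      = (\<Prod>p<i. (ws ! p) (rows_of i m A ! p) * (\<Prod>q<m. x p (rows_of i m A ! p ! q)))"
      by (simp add: prod.distrib)
  qed
  also have "\<dots> = (\<Sum>bs\<in>arrays i m. (\<Prod>p<i. (ws ! p) (bs ! p) * (\<Prod>q<m. x p (bs ! p ! q))))"
    by (rule sum_words_fillings[symmetric])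
  also have "\<dots> = (\<Prod>p<i. \<Sum>b\<in>words m {..<m}. (ws ! p) b * (\<Prod>q<m. x p (b ! q)))"
    by (rule sum_words_prod) simp
  finally show ?thesis .
qed

lemma tensor_power_support:
  assumes "T \<in> tensor_power k W" and "\<And>w b. w \<in> W \<Longrightarrow> b \<notin> B \<Longrightarrow> w b = 0" and "bs \<notin> words k B"
  shows "T bs = 0"
proof -
  have "cfun.subspace {T. \<forall>bs. bs \<notin> words k B \<longrightarrow> T bs = (0::complex)}"
    by (auto simp: cfun.subspace_def fscale_def)
  moreover have "{pure_tensor ws |ws. length ws = k \<and> set ws \<subseteq> W} \<subseteq> {T. \<forall>bs. bs \<notin> words k B \<longrightarrow> T bs = 0}"
  proof clarsimp
    fix ws bs assume k: "k = length ws" and W: "set ws \<subseteq> W" and bs: "bs \<notin> words (length ws) B"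
    show "pure_tensor ws bs = 0"
    proof (cases "length bs = length ws")
      case True
      then obtain j where "j < length ws" "bs ! j \<notin> B"
        using bs by (auto simp: words_def set_conv_nth)
      then have "(ws ! j) (bs ! j) = 0" using W assms(2) by (meson nth_mem subsetD)
      then show ?thesis using True \<open>j < length ws\<close>
        by (auto simp: pure_tensor_def intro!: bexI[of _ j])
    qed (auto simp: pure_tensor_def)
  qed
  ultimately have "tensor_power k W \<subseteq> {T. \<forall>bs. bs \<notin> words k B \<longrightarrow> T bs = 0}"
    unfolding tensor_power_def by (rule cfun.span_minimal[rotated])
  then show ?thesis using assms by auto
qed

lemma sym_tensors_support:
  assumes "w \<in> sym_tensors m (V_dual m)" "b \<notin> words m {..<m}"
  shows "w b = 0"
  using assms by (intro tensor_power_support[of w m "V_dual m" "{..<m}"]) (auto simp: sym_tensors_def V_dual_def)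

lemma rows_of_comp_row:
  assumes "\<rho> \<in> row_group i m" "p < i"
  shows "rows_of i m (A \<circ> \<rho>) ! p
    = permute_list (\<lambda>q. snd (\<rho> (p, q))) (rows_of i m A ! p)"
proof (rule nth_equalityI)
  fix q assume "q < length (rows_of i m (A \<circ> \<rho>) ! p)"
  then have q: "q < m" using assms by simp
  have r: "(\<lambda>q. snd (\<rho> (p, q))) permutes {..<m}" by (rule row_permutes[OF assms(1)])
  then have "snd (\<rho> (p, q)) < m" using permutes_in_image[OF r, of q] q by simp
  moreover have "A (\<rho> (p, q)) = A (p, snd (\<rho> (p, q)))" by (subst row_group_eq[OF assms(1)]) simp
  ultimately show "rows_of i m (A \<circ> \<rho>) ! p ! q
    = permute_list (\<lambda>q. snd (\<rho> (p, q))) (rows_of i m A ! p) ! q"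
    using q assms r by (subst permute_list_nth) auto
qed (use assms in auto)

lemma tensor_power_sym_support:
  assumes "T \<in> tensor_power i (sym_tensors m (V_dual m))" "bs \<notin> arrays i m"
  shows "T bs = 0"
  by (rule tensor_power_support[where W = "sym_tensors m (V_dual m)" and B = "words m {..<m}"])
    (use assms sym_tensors_support in auto)

lemma tensor_power_row_invariant:
  assumes "T \<in> tensor_power i (sym_tensors m (V_dual m))"
  shows "row_invariant i m (\<lambda>A. T (rows_of i m A))"
proof -
  let ?S = "{T. row_invariant i m (\<lambda>A. T (rows_of i m A))}"
  have "cfun.subspace ?S"
    by (auto simp: cfun.subspace_def fscale_def row_invariant_def)
  moreover have "{pure_tensor ws |ws. length ws = i \<and> set ws \<subseteq> sym_tensors m (V_dual m)} \<subseteq> ?S"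
  proof clarsimp
    fix ws assume i: "i = length ws" and W: "set ws \<subseteq> sym_tensors m (V_dual m)"
    show "row_invariant (length ws) m (\<lambda>A. pure_tensor ws (rows_of (length ws) m A))"
      unfolding row_invariant_def
    proof (intro ballI)
      fix \<rho> A assume \<rho>: "\<rho> \<in> row_group (length ws) m"
      have "(ws ! p) (rows_of (length ws) m (A \<circ> \<rho>) ! p) = (ws ! p) (rows_of (length ws) m A ! p)"
        if p: "p < length ws" for p
      proof -
        have "ws ! p \<in> sym_tensors m (V_dual m)" using W p by auto
        then show ?thesis unfolding rows_of_comp_row[OF \<rho> p]
          using row_permutes[OF \<rho>, of p] p by (simp add: sym_tensors_def)
      qed
      then show "pure_tensor ws (rows_of (length ws) m (A \<circ> \<rho>)) = pure_tensor ws (rows_of (length ws) m A)"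
        by (simp add: pure_tensor_def)
    qed
  qed
  ultimately have "tensor_power i (sym_tensors m (V_dual m)) \<subseteq> ?S"
    unfolding tensor_power_def by (rule cfun.span_minimal[rotated])
  then show ?thesis using assms by auto
qed

section \<open>Symmetrised monomials and the symmetry description of the tensor space\<close>

text \<open>The symmetrised monomial in \<open>S^m\<close>. Words with the same letters give the
  same tensor, so these form a spanning family with repetitions; \<open>v_o\<close> is the case
  \<open>b = [0..<m]\<close>.\<close>

definition sym_basis :: "nat \<Rightarrow> nat list \<Rightarrow> nat list \<Rightarrow> complex" where
  "sym_basis m b = fscale (1 / fact m)
     (\<Sum>\<sigma> | \<sigma> permutes {..<m}. pure_tensor (map (\<lambda>j. v_star (b ! \<sigma> j)) [0..<m]))"

lemma sym_basis_apply: "sym_basis m b c =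
    (\<Sum>\<sigma> | \<sigma> permutes {..<m}. pure_tensor (map (\<lambda>j. v_star (b ! \<sigma> j)) [0..<m]) c) / fact m"
proof -
  have "(\<Sum>x\<in>S. f x) c = (\<Sum>x\<in>S. f x c)" for S and f :: "(nat \<Rightarrow> nat) \<Rightarrow> nat list \<Rightarrow> complex"
    by (induction S rule: infinite_finite_induct) auto
  then show ?thesis by (simp add: sym_basis_def fscale_def)
qed

lemma pure_tensor_v_star:
  assumes "length c = m"
  shows "pure_tensor (map (\<lambda>j. v_star (f j)) [0..<m]) c = (if c = map f [0..<m] then 1 else 0)"
proof (cases "c = map f [0..<m]")
  case False
  then obtain j where "j < m" "c ! j \<noteq> f j" using assms by (auto simp: list_eq_iff_nth_eq)
  then show ?thesis using assms False by (auto simp: pure_tensor_def v_star_def intro!: bexI[of _ j])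
qed (auto simp: pure_tensor_def v_star_def)

lemma sym_basis_in_sym_tensors:
  assumes b: "b \<in> words m {..<m}"
  shows "sym_basis m b \<in> sym_tensors m (V_dual m)"
proof -
  have in_V: "v_star (b ! \<sigma> j) \<in> V_dual m" if "\<sigma> permutes {..<m}" "j < m" for \<sigma> j
  proof -
    have "\<sigma> j < m" using permutes_in_image[OF that(1), of j] that(2) by simp
    then have "b ! \<sigma> j < m" using words_nth[OF b] by simp
    then show ?thesis by (auto simp: V_dual_def v_star_def)
  qed
  have "sym_basis m b \<in> tensor_power m (V_dual m)"
    unfolding sym_basis_def tensor_power_def
  proof (intro cfun.span_scale cfun.span_sum cfun.span_base)
    fix \<sigma> assume "\<sigma> \<in> {\<sigma>. \<sigma> permutes {..<m}}"
    then show "pure_tensor (map (\<lambda>j. v_star (b ! \<sigma> j)) [0..<m]) \<in> {pure_tensor ws |ws. length ws = m \<and> set ws \<subseteq> V_dual m}"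
      using in_V by (intro CollectI exI[of _ "map (\<lambda>j. v_star (b ! \<sigma> j)) [0..<m]"]) auto
  qed
  moreover have "sym_basis m b (permute_list \<tau> c) = sym_basis m b c" if \<tau>: "\<tau> permutes {..<m}" "length c = m" for \<tau> c
  proof -
    let ?h = "\<lambda>\<sigma> c. pure_tensor (map (\<lambda>j. v_star (b ! \<sigma> j)) [0..<m]) c"
    have "?h (\<sigma> \<circ> \<tau>) (permute_list \<tau> c) = ?h \<sigma> c" for \<sigma>
    proof -
      have "?h (\<sigma> \<circ> \<tau>) (permute_list \<tau> c) = (\<Prod>j<m. v_star (b ! \<sigma> (\<tau> j)) (c ! \<tau> j))"
        using \<tau> by (auto simp: pure_tensor_def permute_list_nth intro!: prod.cong)
      also have "\<dots> = (\<Prod>j<m. v_star (b ! \<sigma> j) (c ! j))"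
        using prod.permute[OF \<tau>(1), of "\<lambda>j. v_star (b ! \<sigma> j) (c ! j)"] by (simp add: comp_def)
      finally show ?thesis using \<tau>(2) by (simp add: pure_tensor_def)
    qed
    then have "(\<Sum>\<sigma> | \<sigma> permutes {..<m}. ?h \<sigma> c) = (\<Sum>\<sigma> | \<sigma> permutes {..<m}. ?h (\<sigma> \<circ> \<tau>) (permute_list \<tau> c))"
      by simp
    also have "\<dots> = (\<Sum>\<sigma> | \<sigma> permutes {..<m}. ?h \<sigma> (permute_list \<tau> c))"
      by (rule sum_permutations_compose_right[OF \<tau>(1), symmetric])
    finally show ?thesis by (simp add: sym_basis_apply)
  qed
  ultimately show ?thesis by (simp add: sym_tensors_def)
qed

text \<open>Inserting one vector into all slots undoes symmetrisation: all \<open>m!\<close>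
  summands yield the same monomial, which cancels the factor \<open>1 / fact m\<close>.\<close>

lemma sym_basis_eval:
  assumes b: "b \<in> words m {..<m}"
  shows "(\<Sum>c\<in>words m {..<m}. sym_basis m b c * (\<Prod>q<m. x (c ! q))) = (\<Prod>q<m. x (b ! q))"
proof -
  have fin: "finite (words m {..<m})" by simp
  let ?b = "\<lambda>\<sigma>. map (\<lambda>j. b ! \<sigma> j) [0..<m]"
  have in_w: "?b \<sigma> \<in> words m {..<m}" if "\<sigma> permutes {..<m}" for \<sigma>
    using words_nth[OF b] permutes_in_image[OF that] by (auto simp: words_def)
  have "(\<Sum>c\<in>words m {..<m}. sym_basis m b c * (\<Prod>q<m. x (c ! q)))
      = (\<Sum>c\<in>words m {..<m}. \<Sum>\<sigma> | \<sigma> permutes {..<m}. (if c = ?b \<sigma> then 1 else 0) * (\<Prod>q<m. x (c ! q))) / fact m"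
    unfolding sum_divide_distrib
    by (intro sum.cong refl)
      (auto simp: sym_basis_apply sum_distrib_right sum_divide_distrib words_def pure_tensor_v_star intro!: sum.cong)
  also have "\<dots> = (\<Sum>\<sigma> | \<sigma> permutes {..<m}. \<Sum>c\<in>words m {..<m}. (if c = ?b \<sigma> then 1 else 0) * (\<Prod>q<m. x (c ! q))) / fact m"
    by (subst sum.swap) simp
  also have "\<dots> = (\<Sum>\<sigma> | \<sigma> permutes {..<m}. \<Prod>q<m. x (b ! q)) / fact m"
  proof (rule arg_cong[where f = "\<lambda>x. x / fact m"], rule sum.cong[OF refl], clarsimp)
    fix \<sigma> assume \<sigma>: "\<sigma> permutes {..<m}"
    have "(\<Sum>c\<in>words m {..<m}. (if c = ?b \<sigma> then 1 else 0) * (\<Prod>q<m. x (c ! q)))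
      = (\<Sum>c\<in>words m {..<m}. if c = ?b \<sigma> then (\<Prod>q<m. x (c ! q)) else 0)"
      by (intro sum.cong refl) auto
    also have "\<dots> = (\<Prod>q<m. x (?b \<sigma> ! q))" using in_w[OF \<sigma>] fin by simp
    also have "\<dots> = (\<Prod>q<m. x (b ! \<sigma> q))" by (intro prod.cong) auto
    also have "\<dots> = (\<Prod>q<m. x (b ! q))"
      using prod.permute[OF \<sigma>, of "\<lambda>q. x (b ! q)"] by (simp add: comp_def)
    finally show "(\<Sum>c\<in>words m {..<m}. (if c = ?b \<sigma> then 1 else 0) * (\<Prod>q<m. x (c ! q))) = (\<Prod>q<m. x (b ! q))" .
  qed
  also have "\<dots> = (\<Prod>q<m. x (b ! q))"
    by (simp add: card_permutations[OF refl])
  finally show ?thesis .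
qed

lemma row_invariant_eqI:
  assumes "row_invariant i m F" "row_invariant i m G" "\<And>x. ev i m F x = ev i m G x" "A \<in> fillings i m"
  shows "F A = G A"
proof -
  have "row_invariant i m (\<lambda>A. F A - G A)"
    using assms(1,2) unfolding row_invariant_def by simp
  moreover have "ev i m (\<lambda>A. F A - G A) x = 0" for x
  proof -
    have "ev i m (\<lambda>A. F A - G A) x = ev i m F x - ev i m G x"
      unfolding ev_def by (simp add: sum_subtractf left_diff_distrib)
    then show ?thesis using assms(3) by simp
  qed
  ultimately have "F A - G A = 0" using assms(4) by (rule ev_eq_0_imp)
  then show ?thesis by simp
qed

text \<open>Exchanging whole rows is encoded as a column permutation, the same one in each column.
  Alternation under the column group then controls symmetry among the \<open>i\<close>
  factors.\<close>

definition row_swap :: "nat \<Rightarrow> (nat \<Rightarrow> nat) \<Rightarrow> nat \<times> nat \<Rightarrow> nat \<times> nat" where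
  "row_swap m \<sigma> = (\<lambda>(p, q). if q < m then (\<sigma> p, q) else (p, q))"

lemma row_swap_in: "\<sigma> permutes {..<i} \<Longrightarrow> row_swap m \<sigma> \<in> col_group i m"
  unfolding row_swap_def by (rule col_perm_in_col_group)

lemma rows_of_row_swap:
  assumes "\<sigma> permutes {..<i}"
  shows "rows_of i m (A \<circ> row_swap m \<sigma>) = permute_list \<sigma> (rows_of i m A)"
  using assms permutes_in_image[OF assms]
  by (intro nth_equalityI) (auto simp: permute_list_nth row_swap_def)

text \<open>Replaces membership in nested spans by support and invariance conditions. For the
  converse, the combination \<open>g\<close> of tensors of symmetrised monomials with coefficients
  taken from \<open>f\<close> lies in the tensor power and has the same polynomial as
  \<open>f\<close>. Both are row invariant, hence equal.\<close>

lemma S_S_space_iff: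
  "f \<in> S_S_space i m \<longleftrightarrow>
     (\<forall>bs. bs \<notin> arrays i m \<longrightarrow> f bs = 0) \<and>
     row_invariant i m (\<lambda>A. f (rows_of i m A)) \<and>
     (\<forall>\<sigma>. \<sigma> permutes {..<i} \<longrightarrow>
        (\<forall>A\<in>fillings i m. f (rows_of i m (A \<circ> row_swap m \<sigma>)) = f (rows_of i m A)))"
    (is "_ \<longleftrightarrow> ?S f \<and> ?R f \<and> ?O f")
proof
  assume f: "f \<in> S_S_space i m"
  then have t: "f \<in> tensor_power i (sym_tensors m (V_dual m))" by (simp add: S_S_space_def sym_tensors_def)
  have "?S f" using tensor_power_sym_support[OF t] by blast
  moreover have "?R f" by (rule tensor_power_row_invariant[OF t])
  moreover have "?O f"
  proof (intro allI impI ballI)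
    fix \<sigma> A assume "\<sigma> permutes {..<i}"
    then show "f (rows_of i m (A \<circ> row_swap m \<sigma>)) = f (rows_of i m A)"
      using f unfolding S_S_space_def sym_tensors_def by (simp add: rows_of_row_swap)
  qed
  ultimately show "?S f \<and> ?R f \<and> ?O f" by blast
next
  assume H: "?S f \<and> ?R f \<and> ?O f"
  define T where "T = (\<lambda>A. pure_tensor (map (sym_basis m) (rows_of i m A)))"
  define g where "g = (\<Sum>A\<in>fillings i m. fscale (f (rows_of i m A)) (T A))"
  have g_apply: "g bs = (\<Sum>A\<in>fillings i m. f (rows_of i m A) * T A bs)" for bs
  proof -
    have "(\<Sum>x\<in>S. h x) bs = (\<Sum>x\<in>S. h x bs)" for S and h :: "(nat \<times> nat \<Rightarrow> nat) \<Rightarrow> nat list list \<Rightarrow> complex"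
      by (induction S rule: infinite_finite_induct) auto
    then show ?thesis by (simp add: g_def fscale_def)
  qed
  have row: "rows_of i m A ! p \<in> words m {..<m}" if "A \<in> fillings i m" "p < i" for A p
    by (rule words_nth[OF rows_of_in_words[OF that(1)] that(2)])
  have gt: "g \<in> tensor_power i (sym_tensors m (V_dual m))"
    unfolding g_def tensor_power_def T_def
  proof (intro cfun.span_scale cfun.span_sum cfun.span_base)
    fix A assume A: "A \<in> fillings i m"
    have "set (map (sym_basis m) (rows_of i m A)) \<subseteq> sym_tensors m (V_dual m)"
      using rows_of_in_words[OF A] sym_basis_in_sym_tensors by (auto simp: words_def)
    then show "pure_tensor (map (sym_basis m) (rows_of i m A))
      \<in> {pure_tensor ws |ws. length ws = i \<and> set ws \<subseteq> sym_tensors m (V_dual m)}"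
      by (intro CollectI exI[of _ "map (sym_basis m) (rows_of i m A)"]) auto
  qed
  have "f (rows_of i m A) = g (rows_of i m A)" if A: "A \<in> fillings i m" for A
  proof (rule row_invariant_eqI[of i m "\<lambda>A. f (rows_of i m A)" "\<lambda>A. g (rows_of i m A)"])
    fix x
    have T: "ev i m (\<lambda>A. T C (rows_of i m A)) x = (\<Prod>c\<in>cells i m. x (fst c) (C c))" if C: "C \<in> fillings i m" for C
    proof -
      have "ev i m (\<lambda>A. T C (rows_of i m A)) x = (\<Prod>p<i. \<Prod>q<m. x p (rows_of i m C ! p ! q))"
        unfolding T_def using row[OF C] by (subst ev_pure_tensor) (auto simp: sym_basis_eval simp del: rows_of_nth(1))
      also have "\<dots> = (\<Prod>c\<in>cells i m. x (fst c) (C c))"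
        unfolding prod_cells by (intro prod.cong) auto
      finally show ?thesis .
    qed
    have "ev i m (\<lambda>A. g (rows_of i m A)) x
      = (\<Sum>A\<in>fillings i m. \<Sum>C\<in>fillings i m. f (rows_of i m C) * (T C (rows_of i m A) * (\<Prod>c\<in>cells i m. x (fst c) (A c))))"
      by (simp add: ev_def g_apply sum_distrib_right mult.assoc)
    also have "\<dots> = (\<Sum>C\<in>fillings i m. f (rows_of i m C) * ev i m (\<lambda>A. T C (rows_of i m A)) x)"
      by (subst sum.swap) (simp add: ev_def sum_distrib_left)
    also have "\<dots> = ev i m (\<lambda>A. f (rows_of i m A)) x"
      using T by (simp add: ev_def)
    finally show "ev i m (\<lambda>A. f (rows_of i m A)) x = ev i m (\<lambda>A. g (rows_of i m A)) x" by simp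
  qed (use H gt tensor_power_row_invariant A in auto)
  moreover have "bs \<in> rows_of i m ` fillings i m" if "bs \<in> arrays i m" for bs
    using bij_rows_of[of i m] that by (auto simp: bij_betw_def)
  moreover have "g bs = 0" if "bs \<notin> arrays i m" for bs
    using tensor_power_sym_support[OF gt that] .
  ultimately have "f bs = g bs" for bs
    using H by (cases "bs \<in> arrays i m") (blast, simp)
  then have "f = g" by (rule ext)
  have "f (permute_list \<sigma> bs) = f bs" if \<sigma>: "\<sigma> permutes {..<i}" and bs: "length bs = i" for \<sigma> bs
  proof (cases "bs \<in> arrays i m")
    case True
    then obtain A where "A \<in> fillings i m" "bs = rows_of i m A"
      using bij_rows_of[of i m] by (auto simp: bij_betw_def)
    then show ?thesis using H \<sigma> by (metis rows_of_row_swap)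
  next
    case False
    have "set (permute_list \<sigma> bs) = set bs" using \<sigma> bs by simp
    then have "permute_list \<sigma> bs \<notin> arrays i m" using False bs by (auto simp: words_def)
    then show ?thesis using H False by simp
  qed
  then show "f \<in> S_S_space i m"
    using gt \<open>f = g\<close> by (simp add: S_S_space_def sym_tensors_def)
qed

section \<open>The general linear group and its coordinate ring\<close>

lemma GL_iff: "g \<in> carrier (GL m) \<longleftrightarrow> g \<in> carrier_mat m m \<and> det g \<noteq> 0"
proof
  assume "g \<in> carrier (GL m)"
  then have U: "g \<in> Units (ring_mat TYPE(complex) m ())" by (simp add: GL_def units_of_carrier)
  then show "g \<in> carrier_mat m m \<and> det g \<noteq> 0"
    using unit_imp_det_non_zero[OF U] by (auto simp: Units_def ring_mat_def)
next
  assume "g \<in> carrier_mat m m \<and> det g \<noteq> 0"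
  then show "g \<in> carrier (GL m)"
    using det_non_zero_imp_unit[of g m "()"] by (simp add: GL_def units_of_carrier)
qed

lemma GL_mult [simp]: "g \<otimes>\<^bsub>GL m\<^esub> h = g * h"
  by (simp add: GL_def units_of_mult ring_mat_def)

lemma GL_one [simp]: "\<one>\<^bsub>GL m\<^esub> = 1\<^sub>m m"
  by (simp add: GL_def units_of_one ring_mat_def)

lemma group_GL: "group (GL m)"
  unfolding GL_def by (rule monoid.units_group) (rule ring.is_monoid, rule ring_mat)

lemma GL_inv:
  assumes "g \<in> carrier (GL m)"
  shows "inv\<^bsub>GL m\<^esub> g \<in> carrier (GL m)" "inv\<^bsub>GL m\<^esub> g \<in> carrier_mat m m"
    "g * inv\<^bsub>GL m\<^esub> g = 1\<^sub>m m" "inv\<^bsub>GL m\<^esub> g * g = 1\<^sub>m m" "inv\<^bsub>GL m\<^esub> (inv\<^bsub>GL m\<^esub> g) = g"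
  using group.inv_closed[OF group_GL assms] group.r_inv[OF group_GL assms]
    group.l_inv[OF group_GL assms] group.inv_inv[OF group_GL assms] by (auto simp: GL_iff)

lemma GL_mult_closed: "g \<in> carrier (GL m) \<Longrightarrow> h \<in> carrier (GL m) \<Longrightarrow> g * h \<in> carrier (GL m)"
  by (auto simp: GL_iff det_mult)

lemma det_GL_inv:
  assumes "g \<in> carrier (GL m)"
  shows "det (inv\<^bsub>GL m\<^esub> g) = 1 / det g"
proof -
  have g: "g \<in> carrier_mat m m" "det g \<noteq> 0" using assms by (auto simp: GL_iff)
  have "det g * det (inv\<^bsub>GL m\<^esub> g) = 1"
    using det_mult[OF g(1) GL_inv(2)[OF assms]] GL_inv(3)[OF assms] by simp
  then show ?thesis using g(2) by (simp add: field_simps)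
qed

lemma GL_one_closed: "1\<^sub>m m \<in> carrier (GL m)"
  by (simp add: GL_iff)

section \<open>Continuity of regular functions and density of the big cell\<close>

lemma det_tendsto:
  fixes G :: "'s \<Rightarrow> complex mat"
  assumes "\<And>s. G s \<in> carrier_mat m m" "L \<in> carrier_mat m m"
    and "\<And>p q. p < m \<Longrightarrow> q < m \<Longrightarrow> ((\<lambda>s. G s $$ (p, q)) \<longlongrightarrow> L $$ (p, q)) F"
  shows "((\<lambda>s. det (G s)) \<longlongrightarrow> det L) F"
proof -
  have "((\<lambda>s. \<Sum>\<sigma> | \<sigma> permutes {0..<m}. signof \<sigma> * (\<Prod>i = 0..<m. G s $$ (i, \<sigma> i)))
    \<longlongrightarrow> (\<Sum>\<sigma> | \<sigma> permutes {0..<m}. signof \<sigma> * (\<Prod>i = 0..<m. L $$ (i, \<sigma> i)))) F"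
  proof (intro tendsto_intros assms(3))
    fix \<sigma> i assume "\<sigma> \<in> {\<sigma>. \<sigma> permutes {0..<m}}" "i \<in> {0..<m}"
    then show "i < m" "\<sigma> i < m" using permutes_in_image[of \<sigma> "{0..<m}" i] by auto
  qed
  then show ?thesis unfolding det_def'[OF assms(1)] det_def'[OF assms(2)] .
qed

text \<open>Rationality of a module enters through this continuity of its matrix coefficients,
  expressed entrywise along a filter. The limit must be invertible because of the generator
  \<open>1 / det\<close>.\<close>

lemma regular_function_tendsto:
  fixes G :: "'s \<Rightarrow> complex mat"
  assumes "f \<in> regular_functions m"
    and "\<And>s. G s \<in> carrier_mat m m" "L \<in> carrier_mat m m" "det L \<noteq> 0"
    and "\<And>p q. p < m \<Longrightarrow> q < m \<Longrightarrow> ((\<lambda>s. G s $$ (p, q)) \<longlongrightarrow> L $$ (p, q)) F"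
  shows "((\<lambda>s. f (G s)) \<longlongrightarrow> f L) F"
  using assms(1)
proof induction
  case inverse_det
  then show ?case using det_tendsto[OF assms(2,3,5)] assms(4) by (auto intro: tendsto_divide)
qed (use assms(5) in \<open>auto intro: tendsto_add tendsto_mult\<close>)

definition leading :: "nat \<Rightarrow> complex mat \<Rightarrow> complex mat" where
  "leading k g = mat k k (\<lambda>(p, q). g $$ (p, q))"

lemma leading_carrier [simp]: "leading k g \<in> carrier_mat k k" "dim_row (leading k g) = k" "dim_col (leading k g) = k"
  by (simp_all add: leading_def)

lemma leading_index [simp]: "p < k \<Longrightarrow> q < k \<Longrightarrow> leading k g $$ (p, q) = g $$ (p, q)"
  by (simp add: leading_def)

lemma leading_self: "g \<in> carrier_mat m m \<Longrightarrow> leading m g = g"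
  by (auto simp: leading_def)

text \<open>As a function of \<open>s\<close>, the determinant is the characteristic polynomial of
  \<open>- A\<close>. This is monic, so it has only finitely many roots.\<close>

lemma eventually_det_shift_nonzero:
  assumes A: "(A :: complex mat) \<in> carrier_mat n n"
  shows "eventually (\<lambda>s. det (A + s \<cdot>\<^sub>m 1\<^sub>m n) \<noteq> 0) (at 0)"
proof -
  have mA: "- A \<in> carrier_mat n n" using A by simp
  have "poly (char_poly (- A)) s = det (A + s \<cdot>\<^sub>m 1\<^sub>m n)" for s
  proof -
    have "- char_matrix (- A) s = A + s \<cdot>\<^sub>m 1\<^sub>m n"
      using A by (auto simp: char_matrix_def intro!: eq_matI)
    then show ?thesis using char_poly_matrix[OF mA, of s] by simp
  qed
  moreover have "char_poly (- A) \<noteq> 0"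
    using degree_monic_char_poly[OF mA] by auto
  then have "finite {s. poly (char_poly (- A)) s = 0}" by (rule poly_roots_finite)
  then have "open (- ({s. poly (char_poly (- A)) s = 0} - {0}))"
    by (intro open_Compl finite_imp_closed) auto
  then have "eventually (\<lambda>s. s \<in> - ({s. poly (char_poly (- A)) s = 0} - {0})) (at 0)"
    by (intro eventually_at_topological[THEN iffD2] exI[of _ "- ({s. poly (char_poly (- A)) s = 0} - {0})"]) auto
  moreover have "eventually (\<lambda>s. s \<noteq> 0) (at (0::complex))"
    by (auto simp: eventually_at_topological intro: exI[of _ UNIV])
  ultimately show ?thesis by (auto elim: eventually_elim2)
qed

lemma shift_tendsto:
  assumes "(g :: complex mat) \<in> carrier_mat m m" "p < m" "q < m"
  shows "((\<lambda>s. (g + s \<cdot>\<^sub>m 1\<^sub>m m) $$ (p, q)) \<longlongrightarrow> g $$ (p, q)) (at 0)"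
proof -
  have "((\<lambda>s. g $$ (p, q) + s * 1\<^sub>m m $$ (p, q)) \<longlongrightarrow> g $$ (p, q) + 0 * 1\<^sub>m m $$ (p, q)) (at 0)"
    by (intro tendsto_intros)
  then show ?thesis using assms by simp
qed

text \<open>Described by leading minors rather than as a product of triangular groups, so that
  density reduces to finitely many determinants. The case \<open>k = m\<close> contains
  invertibility.\<close>

definition big_cell :: "nat \<Rightarrow> complex mat set" where
  "big_cell m = {g \<in> carrier_mat m m. \<forall>k\<le>m. det (leading k g) \<noteq> 0}"

lemma big_cell_GL: "g \<in> big_cell m \<Longrightarrow> g \<in> carrier (GL m)"
  by (auto simp: big_cell_def GL_iff leading_self)

text \<open>Shifting by a scalar matrix commutes with taking leading blocks, so each leading minor
  of the shifted matrix is itself a shifted determinant.\<close>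

lemma eventually_big_cell:
  assumes g: "g \<in> carrier_mat m m"
  shows "eventually (\<lambda>s. g + s \<cdot>\<^sub>m 1\<^sub>m m \<in> big_cell m) (at 0)"
proof -
  have "leading k (g + s \<cdot>\<^sub>m 1\<^sub>m m) = leading k g + s \<cdot>\<^sub>m 1\<^sub>m k" if "k \<le> m" for k s
    using that g by (intro eq_matI) auto
  moreover have "eventually (\<lambda>s. \<forall>k\<in>{..m}. det (leading k g + s \<cdot>\<^sub>m 1\<^sub>m k) \<noteq> 0) (at 0)"
    by (intro eventually_ball_finite) (auto intro: eventually_det_shift_nonzero)
  ultimately show ?thesis
    using g by (auto simp: big_cell_def elim!: eventually_mono)
qed

text \<open>The line \<open>g + s 1\<close> stays in the big cell for small nonzero
  \<open>s\<close>, so continuity along this one line is enough to extend an identity.\<close>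

lemma big_cell_dense:
  assumes F: "\<And>g. g \<in> carrier (GL m) \<Longrightarrow> ((\<lambda>s. F (g + s \<cdot>\<^sub>m 1\<^sub>m m)) \<longlongrightarrow> F g) (at 0)"
    and H: "\<And>g. g \<in> carrier (GL m) \<Longrightarrow> ((\<lambda>s. H (g + s \<cdot>\<^sub>m 1\<^sub>m m)) \<longlongrightarrow> H g) (at 0)"
    and eq: "\<And>g. g \<in> big_cell m \<Longrightarrow> F g = (H g :: complex)"
    and g: "g \<in> carrier (GL m)"
  shows "F g = H g"
proof -
  have "eventually (\<lambda>s. F (g + s \<cdot>\<^sub>m 1\<^sub>m m) = H (g + s \<cdot>\<^sub>m 1\<^sub>m m)) (at 0)"
    using eventually_big_cell[of g m] g eq by (auto simp: GL_iff elim: eventually_mono)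
  then have "((\<lambda>s. F (g + s \<cdot>\<^sub>m 1\<^sub>m m)) \<longlongrightarrow> H g) (at 0)"
    using H[OF g] by (simp add: tendsto_cong)
  with F[OF g] show ?thesis by (intro tendsto_unique[of "at (0::complex)"]) auto
qed

section \<open>Triangular factorisation and leading minors\<close>

definition unit_lower :: "complex mat \<Rightarrow> bool" where
  "unit_lower u \<longleftrightarrow> (\<forall>p<dim_row u. u $$ (p, p) = 1 \<and> (\<forall>q<dim_col u. p < q \<longrightarrow> u $$ (p, q) = 0))"

lemma unit_lower_det: "u \<in> carrier_mat n n \<Longrightarrow> unit_lower u \<Longrightarrow> det u = 1"
  by (subst det_lower_triangular[of n]) (auto simp: unit_lower_def prod_list_diag_prod)

lemma LU_decomposition:
  assumes "g \<in> carrier_mat n n" "\<And>k. k \<le> n \<Longrightarrow> det (leading k g) \<noteq> 0"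
  obtains u b where "u \<in> carrier_mat n n" "unit_lower u" "b \<in> carrier_mat n n" "upper_triangular b" "g = u * b"
proof -
  have "\<exists>u b. u \<in> carrier_mat n n \<and> unit_lower u \<and> b \<in> carrier_mat n n \<and> upper_triangular b \<and> g = u * b"
    using assms
  proof (induction n arbitrary: g)
    case 0
    then show ?case by (intro exI[of _ "1\<^sub>m 0"] exI[of _ "1\<^sub>m 0"]) (auto simp: unit_lower_def)
  next
    case (Suc n)
    define A where "A = leading n g"
    have A: "A \<in> carrier_mat n n" by (simp add: A_def)
    have lead: "leading k A = leading k g" if "k \<le> n" for k
      using that by (auto simp: A_def leading_def)
    obtain u b where u: "u \<in> carrier_mat n n" "unit_lower u" and b: "b \<in> carrier_mat n n" "upper_triangular b"
      and Aub: "A = u * b"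
      using Suc.IH[OF A] Suc.prems(2) lead by (metis le_SucI)
    have "det A \<noteq> 0" using Suc.prems(2)[of n] by (simp add: A_def)
    then have "det u \<noteq> 0" "det b \<noteq> 0" using u b by (auto simp: Aub det_mult)
    then have uG: "u \<in> carrier (GL n)" and bG: "b \<in> carrier (GL n)" using u b by (auto simp: GL_iff)
    let ?ui = "inv\<^bsub>GL n\<^esub> u" and ?bi = "inv\<^bsub>GL n\<^esub> b"
    define c where "c = mat n 1 (\<lambda>(p, q). g $$ (p, n))"
    define r where "r = mat 1 n (\<lambda>(p, q). g $$ (n, q))"
    define d where "d = mat 1 1 (\<lambda>(p, q). g $$ (n, n))"
    have cr: "c \<in> carrier_mat n 1" "r \<in> carrier_mat 1 n" "d \<in> carrier_mat 1 1"
      by (simp_all add: c_def r_def d_def)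
    have g: "g = four_block_mat A c r d"
      using Suc.prems(1) by (intro eq_matI) (auto simp: A_def c_def r_def d_def less_Suc_eq)
    \<comment> \<open>Bordering step: with \<open>A = u * b\<close>, the new row of the lower factor
      has to be \<open>r b^-1\<close>, the new column of the upper factor \<open>u^-1 c\<close>, and
      the remaining corner is the Schur complement \<open>d - rb * uc\<close>.\<close>
    define rb where "rb = r * ?bi"
    define uc where "uc = ?ui * c"
    have rb: "rb \<in> carrier_mat 1 n" and uc: "uc \<in> carrier_mat n 1"
      using GL_inv(2)[OF uG] GL_inv(2)[OF bG] cr by (auto simp: rb_def uc_def)
    define U where "U = four_block_mat u (0\<^sub>m n 1) rb (1\<^sub>m 1)"
    define B where "B = four_block_mat b uc (0\<^sub>m 1 n) (d - rb * uc)"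
    have dd: "d - rb * uc \<in> carrier_mat 1 1" using rb uc cr by auto
    have "U * B = four_block_mat (u * b + 0\<^sub>m n 1 * 0\<^sub>m 1 n) (u * uc + 0\<^sub>m n 1 * (d - rb * uc))
        (rb * b + 1\<^sub>m 1 * 0\<^sub>m 1 n) (rb * uc + 1\<^sub>m 1 * (d - rb * uc))"
      unfolding U_def B_def using u b rb uc dd by (intro mult_four_block_mat) auto
    moreover have "u * b + 0\<^sub>m n 1 * 0\<^sub>m 1 n = A" using A u b by (simp add: Aub)
    moreover have "u * uc + 0\<^sub>m n 1 * (d - rb * uc) = c"
    proof -
      have "u * uc = (u * ?ui) * c" unfolding uc_def using u GL_inv(2)[OF uG] cr by (simp add: assoc_mult_mat)
      then have "u * uc = c" using GL_inv(3)[OF uG] cr by simp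
      then show ?thesis using left_mult_zero_mat[OF dd, of n] cr(1) by simp
    qed
    moreover have "rb * b + 1\<^sub>m 1 * 0\<^sub>m 1 n = r"
    proof -
      have "rb * b = r * (?bi * b)" unfolding rb_def using b GL_inv(2)[OF bG] cr by (simp add: assoc_mult_mat)
      then have "rb * b = r" using GL_inv(4)[OF bG] cr by simp
      then show ?thesis using cr by simp
    qed
    moreover have "rb * uc + 1\<^sub>m 1 * (d - rb * uc) = d"
      using dd cr rb uc by (intro eq_matI) auto
    ultimately have "g = U * B" by (simp add: g)
    moreover have "U \<in> carrier_mat (Suc n) (Suc n)" "B \<in> carrier_mat (Suc n) (Suc n)"
      using u b rb uc dd by (auto simp: U_def B_def)
    moreover have "unit_lower U"
      using u rb by (auto simp: unit_lower_def U_def less_Suc_eq)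
    moreover have "upper_triangular B"
      using b uc dd rb by (auto simp: upper_triangular_def B_def less_Suc_eq)
    ultimately show ?case by blast
  qed
  with that show ?thesis by blast
qed

text \<open>The first \<open>i\<close> columns of \<open>b\<close> vanish from row \<open>i\<close>
  on, so the leading block of the product is the product of the leading blocks.\<close>

lemma det_leading_mult:
  assumes u: "u \<in> carrier_mat n n" "unit_lower u" and b: "b \<in> carrier_mat n n" "upper_triangular b"
    and i: "i \<le> n"
  shows "det (leading i (u * b)) = (\<Prod>j<i. b $$ (j, j))"
proof -
  have "leading i (u * b) = leading i u * leading i b"
  proof (rule eq_matI)
    fix p q assume "p < dim_row (leading i u * leading i b)" "q < dim_col (leading i u * leading i b)"
    then have pq: "p < i" "q < i" by auto
    have "(u * b) $$ (p, q) = (\<Sum>k\<in>{0..<n}. u $$ (p, k) * b $$ (k, q))"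
      using u b i pq by (simp add: scalar_prod_def)
    also have "\<dots> = (\<Sum>k\<in>{0..<i}. u $$ (p, k) * b $$ (k, q))"
      using b i pq by (intro sum.mono_neutral_right) (auto simp: upper_triangular_def)
    also have "\<dots> = (leading i u * leading i b) $$ (p, q)"
      using pq by (simp add: scalar_prod_def)
    finally show "leading i (u * b) $$ (p, q) = (leading i u * leading i b) $$ (p, q)"
      using pq by simp
  qed auto
  moreover have "det (leading i u) = 1"
    using u i by (intro unit_lower_det) (auto simp: unit_lower_def)
  moreover have "det (leading i b) = (\<Prod>j<i. b $$ (j, j))"
    using b i by (subst det_upper_triangular[of _ i]) (auto simp: upper_triangular_def prod_list_diag_prod atLeast0LessThan)
  ultimately show ?thesis by (simp add: det_mult[of _ i])
qed

section \<open>Orthogonal projections\<close>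

text \<open>Linear in the first and conjugate linear in the second argument. It is definite only on
  functions supported in \<open>X\<close>, which is why support conditions accompany its
  use.\<close>

definition cip :: "'a set \<Rightarrow> ('a \<Rightarrow> complex) \<Rightarrow> ('a \<Rightarrow> complex) \<Rightarrow> complex" where
  "cip X f h = (\<Sum>x\<in>X. f x * cnj (h x))"

lemma cip_simps:
  "cip X (f + h) k = cip X f k + cip X h k" "cip X (f - h) k = cip X f k - cip X h k"
  "cip X k (f + h) = cip X k f + cip X k h" "cip X k (f - h) = cip X k f - cip X k h"
  "cip X (fscale c f) k = c * cip X f k" "cip X k (fscale c f) = cnj c * cip X k f"
  "cip X 0 k = 0" "cip X k 0 = 0"
  by (simp_all add: cip_def fscale_def algebra_simps sum.distrib sum_subtractf sum_distrib_left)

lemma cip_commute: "cip X f h = cnj (cip X h f)"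
  by (simp add: cip_def mult.commute)

lemma cip_self_eq_0: "finite X \<Longrightarrow> cip X f f = 0 \<Longrightarrow> x \<in> X \<Longrightarrow> f x = 0"
proof -
  assume X: "finite X" "cip X f f = 0" "x \<in> X"
  have "cip X f f = of_real (\<Sum>x\<in>X. (cmod (f x))\<^sup>2)"
    by (simp only: cip_def of_real_sum complex_norm_square)
  then have "(\<Sum>x\<in>X. (cmod (f x))\<^sup>2) = 0" using X by (metis of_real_eq_0_iff)
  then show "f x = 0" using X by (subst (asm) sum_nonneg_eq_0_iff) auto
qed

text \<open>Gram-Schmidt by induction on the spanning set: \<open>b'\<close> is the part of the new
  vector orthogonal to the old span, and the projection is corrected by its component along
  \<open>b'\<close>.\<close>

lemma cip_projection_span:
  assumes X: "finite X" and "finite B" and "\<And>b x. b \<in> B \<Longrightarrow> x \<notin> X \<Longrightarrow> b x = (0::complex)"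
  shows "\<exists>u\<in>cfun.span B. \<forall>v\<in>cfun.span B. cip X (f - u) v = 0"
  using assms(2,3)
proof (induction B arbitrary: f rule: finite_induct)
  case empty
  then show ?case by (auto simp: cip_def)
next
  case (insert b B)
  obtain ub where ub: "ub \<in> cfun.span B" "\<And>v. v \<in> cfun.span B \<Longrightarrow> cip X (b - ub) v = 0"
    using insert by (metis insertCI)
  obtain u0 where u0: "u0 \<in> cfun.span B" "\<And>v. v \<in> cfun.span B \<Longrightarrow> cip X (f - u0) v = 0"
    using insert by (metis insertCI)
  define b' where "b' = b - ub"
  show ?case
  \<comment> \<open>A vector of length 0 supported in \<open>X\<close> is the zero function; then
    \<open>b\<close> already lies in the old span.\<close>
  proof (cases "cip X b' b' = 0")
    case True
    have "cfun.span B \<subseteq> {h. \<forall>x. x \<notin> X \<longrightarrow> h x = 0}"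
      using insert.prems by (intro cfun.span_minimal) (auto simp: cfun.subspace_def fscale_def)
    then have "b' x = 0" for x
      using cip_self_eq_0[OF X True] ub(1) insert.prems(1)[of b x] by (cases "x \<in> X") (auto simp: b'_def)
    then have "b = ub" by (simp add: b'_def fun_eq_iff)
    then have "cfun.span (insert b B) = cfun.span B" using ub(1) cfun.span_redundant by blast
    then show ?thesis using u0 by (simp only:) blast
  next
    case False
    define u where "u = u0 + fscale (cip X f b' / cip X b' b') b'"
    have mono: "cfun.span B \<subseteq> cfun.span (insert b B)" by (rule cfun.span_mono) auto
    have b': "b' \<in> cfun.span (insert b B)"
      unfolding b'_def by (rule cfun.span_diff[OF cfun.span_base subsetD[OF mono ub(1)]]) simp
    have "u \<in> cfun.span (insert b B)"
      unfolding u_def by (rule cfun.span_add[OF subsetD[OF mono u0(1)] cfun.span_scale[OF b']])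
    moreover have "cip X (f - u) v = 0" if v: "v \<in> cfun.span (insert b B)" for v
    proof -
      obtain k where k: "v - fscale k b \<in> cfun.span B" using v by (auto simp: cfun.span_breakdown_eq)
      define s where "s = v - fscale k b + fscale k ub"
      have s: "s \<in> cfun.span B" unfolding s_def using k ub(1) by (intro cfun.span_add cfun.span_scale)
      have v: "v = s + fscale k b'" by (auto simp: s_def b'_def fscale_def fun_eq_iff algebra_simps)
      have "cip X (f - u0) s = 0" "cip X b' s = 0" "cip X b' u0 = 0"
        using u0 ub(2) s by (auto simp: b'_def)
      moreover have "cip X u0 b' = 0" using cip_commute[of X u0 b'] \<open>cip X b' u0 = 0\<close> by simp
      ultimately show ?thesis using False by (simp add: v u_def cip_simps field_simps)
    qed
    ultimately show ?thesis by blast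
  qed
qed

lemma cip_projection:
  assumes X: "finite X" and S: "cfun.subspace S" and supp: "\<And>s x. s \<in> S \<Longrightarrow> x \<notin> X \<Longrightarrow> s x = (0::complex)"
  shows "\<exists>u\<in>S. \<forall>v\<in>S. cip X (f - u) v = 0"
proof -
  \<comment> \<open>The point functions at the elements of \<open>X\<close> span everything
    supported in \<open>X\<close>, which bounds the dimension of \<open>S\<close>.\<close>
  define D where "D = (\<lambda>x y. if y = x then 1 else (0::complex)) ` X"
  obtain B where B: "B \<subseteq> S" "cfun.independent B" "S \<subseteq> cfun.span B"
    using cfun.maximal_independent_subset by blast
  have "s \<in> cfun.span D" if "s \<in> S" for s
  proof -
    have *: "(\<Sum>x\<in>A. fscale (s x) (\<lambda>y. if y = x then 1 else 0)) y = (if y \<in> A then s y else 0)" if "finite A" for A y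
      using that by (induction A rule: finite_induct) (auto simp: fscale_def)
    have "s = (\<Sum>x\<in>X. fscale (s x) (\<lambda>y. if y = x then 1 else 0))"
      using supp[OF that] by (auto simp: fun_eq_iff *[OF X])
    also have "\<dots> \<in> cfun.span D"
      by (intro cfun.span_sum cfun.span_scale cfun.span_base) (auto simp: D_def)
    finally show ?thesis .
  qed
  then have "finite B"
    using cfun.independent_span_bound[of D B] B X by (auto simp: D_def)
  moreover have "cfun.span B = S" using B S cfun.span_minimal by blast
  ultimately show ?thesis
    using cip_projection_span[OF X, of B f] B(1) supp by blast
qed

section \<open>Highest weight modules\<close>

lemma dual_space_separates:
  assumes S: "cfun.subspace S" "S \<subseteq> E" and E: "cfun.subspace E" and x: "x \<in> E" "x \<notin> S"
  obtains \<phi> where "\<phi> \<in> dual_space E" "\<phi> x = 1" "\<And>y. y \<in> S \<Longrightarrow> \<phi> y = 0"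
proof -
  interpret pr: vector_space_pair fscale "(*) :: complex \<Rightarrow> complex \<Rightarrow> complex"
    by unfold_locales (auto simp: algebra_simps)
  obtain B where B: "B \<subseteq> S" "cfun.independent B" "S \<subseteq> cfun.span B"
    using cfun.maximal_independent_subset by blast
  have "cfun.span B = S" using B S(1) cfun.span_minimal by blast
  then have "cfun.independent (insert x B)" using B(2) x(2) cfun.independent_insertI by blast
  then obtain g where g: "Vector_Spaces.linear fscale (*) g" "\<And>y. y \<in> insert x B \<Longrightarrow> g y = (if y = x then 1 else 0)"
    using pr.linear_independent_extend[of "insert x B" "\<lambda>y. if y = x then 1 else 0"] by blast
  have "x \<notin> B" using B(1) x(2) by auto
  then have gB: "g b = 0" if "b \<in> B" for b
    using g(2)[of b] that \<open>x \<notin> B\<close> by auto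
  have S0: "g y = 0" if "y \<in> S" for y
    using pr.linear_eq_0_on_span[OF g(1) gB, of B y] B(3) that by blast
  have "(\<lambda>y. if y \<in> E then g y else 0) \<in> dual_space E"
    using pr.linear_add[OF g(1)] pr.linear_scale[OF g(1)] cfun.subspace_add[OF E] cfun.subspace_scale[OF E]
    by (auto simp: dual_space_def)
  then show ?thesis
    by (rule that) (use x S(2) g(2) S0 in auto)
qed

locale highest_weight_module =
  fixes m :: nat and E :: "('x \<Rightarrow> complex) set"
    and \<rho> :: "complex mat \<Rightarrow> ('x \<Rightarrow> complex) \<Rightarrow> 'x \<Rightarrow> complex" and \<mu> :: "nat list" and w :: "'x \<Rightarrow> complex"
  assumes irr: "irreducible_GL_module m E \<rho>" and w: "w \<in> E" and hw: "highest_weight_vector m \<rho> \<mu> w"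
begin

lemma GL_module_E: "GL_module m E \<rho>"
  using irr by (simp add: irreducible_GL_module_def)

lemma subspace_E: "cfun.subspace E"
  using GL_module_E by (simp add: GL_module_def)

lemma action_closed: "g \<in> carrier (GL m) \<Longrightarrow> x \<in> E \<Longrightarrow> \<rho> g x \<in> E"
  using GL_module_E by (auto simp: GL_module_def)

lemma action_add: "g \<in> carrier (GL m) \<Longrightarrow> x \<in> E \<Longrightarrow> y \<in> E \<Longrightarrow> \<rho> g (x + y) = \<rho> g x + \<rho> g y"
  using GL_module_E by (auto simp: GL_module_def linear_map_on_def)

lemma action_scale: "g \<in> carrier (GL m) \<Longrightarrow> x \<in> E \<Longrightarrow> \<rho> g (fscale c x) = fscale c (\<rho> g x)"
  using GL_module_E by (auto simp: GL_module_def linear_map_on_def)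

lemma action_one: "x \<in> E \<Longrightarrow> \<rho> (1\<^sub>m m) x = x"
  using GL_module_E by (auto simp: GL_module_def)

lemma action_mult: "g \<in> carrier (GL m) \<Longrightarrow> h \<in> carrier (GL m) \<Longrightarrow> x \<in> E \<Longrightarrow> \<rho> (g * h) x = \<rho> g (\<rho> h x)"
  using GL_module_E by (auto simp: GL_module_def)

lemma action_zero: "g \<in> carrier (GL m) \<Longrightarrow> \<rho> g 0 = 0"
  using action_scale[of g 0 0] cfun.subspace_0[OF subspace_E] by (simp add: fscale_def zero_fun_def)

lemma matrix_coefficient_regular:
  assumes "x \<in> E" "\<phi> \<in> dual_space E"
  obtains f where "f \<in> regular_functions m" "\<And>g. g \<in> carrier (GL m) \<Longrightarrow> \<phi> (\<rho> g x) = f g"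
proof -
  have "\<forall>x\<in>E. \<forall>\<phi>\<in>dual_space E. \<exists>f\<in>regular_functions m. \<forall>g\<in>carrier (GL m). \<phi> (\<rho> g x) = f g"
    using GL_module_E by (simp add: GL_module_def)
  then obtain f where "f \<in> regular_functions m" "\<forall>g\<in>carrier (GL m). \<phi> (\<rho> g x) = f g"
    using assms by blast
  with that show ?thesis by blast
qed

lemma dual_add: "\<phi> \<in> dual_space E \<Longrightarrow> x \<in> E \<Longrightarrow> y \<in> E \<Longrightarrow> \<phi> (x + y) = \<phi> x + \<phi> y"
  and dual_scale: "\<phi> \<in> dual_space E \<Longrightarrow> x \<in> E \<Longrightarrow> \<phi> (fscale c x) = c * \<phi> x"
  and dual_off: "\<phi> \<in> dual_space E \<Longrightarrow> x \<notin> E \<Longrightarrow> \<phi> x = 0"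
  by (auto simp: dual_space_def)

lemma dual_zero: "\<phi> \<in> dual_space E \<Longrightarrow> \<phi> 0 = 0"
  using dual_scale[of \<phi> 0 0] cfun.subspace_0[OF subspace_E] by (simp add: fscale_def zero_fun_def)

lemma w_nonzero: "w \<noteq> 0"
  using hw by (simp add: highest_weight_vector_def)

text \<open>The span of the orbit is a nonzero submodule of an irreducible module. Consequently a
  functional is determined by its matrix coefficient
  \<open>g \<mapsto> \<phi> (\<rho> g w)\<close>.\<close>

lemma orbit_span: "cfun.span {\<rho> g w |g. g \<in> carrier (GL m)} = E" (is "?N = E")
proof -
  have sub: "?N \<subseteq> E"
    using action_closed w by (intro cfun.span_minimal subspace_E) auto
  have "\<rho> h x \<in> ?N" if h: "h \<in> carrier (GL m)" and x: "x \<in> ?N" for h x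
  proof -
    have "?N \<subseteq> {x \<in> E. \<rho> h x \<in> ?N}"
    proof (rule cfun.span_minimal)
      show "cfun.subspace {x \<in> E. \<rho> h x \<in> ?N}"
        using subspace_E h
        by (auto simp: cfun.subspace_def action_zero action_add action_scale cfun.span_zero
            intro: cfun.span_add cfun.span_scale)
      show "{\<rho> g w |g. g \<in> carrier (GL m)} \<subseteq> {x \<in> E. \<rho> h x \<in> ?N}"
        using action_closed w action_mult[OF h _ w] GL_mult_closed[OF h]
        by (auto intro!: cfun.span_base) metis
    qed
    with x show ?thesis by auto
  qed
  then have "GL_submodule m \<rho> ?N E"
    using sub by (auto simp: GL_submodule_def)
  moreover have "w \<in> ?N"
    using action_one[OF w] GL_one_closed by (intro cfun.span_base) force
  ultimately show ?thesis
    using irr w_nonzero unfolding irreducible_GL_module_def by blast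
qed

lemma dual_eqI:
  assumes "\<phi> \<in> dual_space E" "\<psi> \<in> dual_space E"
    and "\<And>g. g \<in> carrier (GL m) \<Longrightarrow> \<phi> (\<rho> g w) = \<psi> (\<rho> g w)"
  shows "\<phi> = \<psi>"
proof
  fix x
  have "cfun.span {\<rho> g w |g. g \<in> carrier (GL m)} \<subseteq> {x \<in> E. \<phi> x = \<psi> x}"
  proof (rule cfun.span_minimal)
    show "cfun.subspace {x \<in> E. \<phi> x = \<psi> x}"
      using subspace_E assms(1,2) by (auto simp: cfun.subspace_def dual_add dual_scale dual_zero)
  qed (use assms(3) action_closed w in auto)
  then show "\<phi> x = \<psi> x"
    using dual_off[OF assms(1), of x] dual_off[OF assms(2), of x] unfolding orbit_span by (cases "x \<in> E") auto
qed

lemma matrix_coefficient_shift: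
  assumes \<phi>: "\<phi> \<in> dual_space E" and g: "g \<in> carrier (GL m)"
  shows "((\<lambda>s. \<phi> (\<rho> (g + s \<cdot>\<^sub>m 1\<^sub>m m) w)) \<longlongrightarrow> \<phi> (\<rho> g w)) (at 0)"
proof -
  obtain f where f: "f \<in> regular_functions m" "\<And>g. g \<in> carrier (GL m) \<Longrightarrow> \<phi> (\<rho> g w) = f g"
    using matrix_coefficient_regular[OF w \<phi>] by blast
  have gm: "g \<in> carrier_mat m m" "det g \<noteq> 0" using g by (auto simp: GL_iff)
  have "((\<lambda>s. f (g + s \<cdot>\<^sub>m 1\<^sub>m m)) \<longlongrightarrow> f g) (at 0)"
    using gm by (intro regular_function_tendsto[OF f(1)] shift_tendsto) auto
  moreover have "eventually (\<lambda>s. f (g + s \<cdot>\<^sub>m 1\<^sub>m m) = \<phi> (\<rho> (g + s \<cdot>\<^sub>m 1\<^sub>m m) w)) (at 0)"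
    using eventually_det_shift_nonzero[OF gm(1)] gm by (auto elim!: eventually_mono simp: f(2) GL_iff)
  ultimately show ?thesis
    using f(2)[OF g] by (simp add: tendsto_cong)
qed

lemma dual_eqI_big_cell:
  assumes "\<phi> \<in> dual_space E" "\<psi> \<in> dual_space E"
    and "\<And>g. g \<in> big_cell m \<Longrightarrow> \<phi> (\<rho> g w) = \<psi> (\<rho> g w)"
  shows "\<phi> = \<psi>"
proof (rule dual_eqI[OF assms(1,2)])
  fix g assume "g \<in> carrier (GL m)"
  with matrix_coefficient_shift[OF assms(1)] matrix_coefficient_shift[OF assms(2)] assms(3)
  show "\<phi> (\<rho> g w) = \<psi> (\<rho> g w)"
    by (rule big_cell_dense)
qed

definition weight :: "complex mat \<Rightarrow> complex" where
  "weight b = (\<Prod>j<m. (b $$ (j, j)) ^ nth_default 0 \<mu> j)"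

lemma borel_action: "b \<in> carrier (GL m) \<Longrightarrow> upper_triangular b \<Longrightarrow> \<rho> b w = fscale (weight b) w"
  using hw by (simp add: highest_weight_vector_def weight_def)

definition torus :: "complex \<Rightarrow> complex mat" where
  "torus s = mat m m (\<lambda>(p, q). if p = q then s ^ p else 0)"

lemma torus_GL: "s \<noteq> 0 \<Longrightarrow> torus s \<in> carrier (GL m)"
  and torus_upper: "upper_triangular (torus s)"
  and torus_weight: "s \<noteq> 0 \<Longrightarrow> weight (torus s) \<noteq> 0"
proof -
  show u: "upper_triangular (torus s)" by (auto simp: upper_triangular_def torus_def)
  show "s \<noteq> 0 \<Longrightarrow> torus s \<in> carrier (GL m)"
    using det_upper_triangular[OF u, of m] by (auto simp: GL_iff torus_def prod_list_diag_prod)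
  show "s \<noteq> 0 \<Longrightarrow> weight (torus s) \<noteq> 0" by (auto simp: weight_def torus_def)
qed

text \<open>Conjugation by \<open>diag(1, s, s\<^sup>2, \<dots>)\<close> contracts the lower unitriangular matrices to \<open>1\<close> as
  \<open>s \<rightarrow> 0\<close>, so the weight component of the functional \<open>\<phi>\<close> for the highest weight is a limit.\<close>

lemma torus_limit:
  assumes \<phi>: "\<phi> \<in> dual_space E"
    and u: "u \<in> carrier_mat m m" "unit_lower u" and b: "b \<in> carrier (GL m)" "upper_triangular b"
  shows "((\<lambda>s. \<phi> (\<rho> (torus s) (\<rho> (u * b) w)) / weight (torus s)) \<longlongrightarrow> weight b * \<phi> w) (at 0)"
proof -
  \<comment> \<open>For nonzero \<open>s\<close> this is the conjugate of \<open>u\<close> by the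
    torus element. The formula with powers \<open>p - q\<close> also makes sense at
    \<open>s = 0\<close>, where it gives the identity matrix.\<close>
  define G where "G = (\<lambda>s. mat m m (\<lambda>(p, q). if q \<le> p then u $$ (p, q) * s ^ (p - q) else 0))"
  have Gm: "G s \<in> carrier_mat m m" for s by (simp add: G_def)
  have "unit_lower (G s)" for s using u by (auto simp: unit_lower_def G_def)
  then have GG: "G s \<in> carrier (GL m)" for s using Gm unit_lower_det[of "G s" m] by (simp add: GL_iff)
  have uG: "u \<in> carrier (GL m)" using u unit_lower_det[of u m] by (simp add: GL_iff)
  have conj: "torus s * u = G s * torus s" for s
  proof (rule eq_matI)
    fix p q assume "p < dim_row (G s * torus s)" "q < dim_col (G s * torus s)"
    then have pq: "p < m" "q < m" by (auto simp: G_def torus_def)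
    have "(torus s * u) $$ (p, q) = (\<Sum>k\<in>{0..<m}. (if k = p then s ^ p * u $$ (k, q) else 0))"
    proof -
      have "(torus s * u) $$ (p, q) = (\<Sum>k\<in>{0..<m}. torus s $$ (p, k) * u $$ (k, q))"
        using pq u by (simp add: scalar_prod_def torus_def)
      also have "\<dots> = (\<Sum>k\<in>{0..<m}. (if k = p then s ^ p * u $$ (k, q) else 0))"
        using pq by (intro sum.cong) (auto simp: torus_def)
      finally show ?thesis .
    qed
    also have "\<dots> = s ^ p * u $$ (p, q)" using pq by simp
    also have "\<dots> = (if q \<le> p then u $$ (p, q) * s ^ (p - q) else 0) * s ^ q"
      using pq u by (auto simp: unit_lower_def power_add[symmetric])
    also have "\<dots> = (\<Sum>k\<in>{0..<m}. (if k = q then (if k \<le> p then u $$ (p, k) * s ^ (p - k) else 0) * s ^ q else 0))"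
      using pq by simp
    also have "\<dots> = (G s * torus s) $$ (p, q)"
    proof -
      have "(\<Sum>k\<in>{0..<m}. (if k = q then (if k \<le> p then u $$ (p, k) * s ^ (p - k) else 0) * s ^ q else 0))
        = (\<Sum>k\<in>{0..<m}. G s $$ (p, k) * torus s $$ (k, q))"
        using pq by (intro sum.cong) (auto simp: torus_def G_def)
      also have "\<dots> = (G s * torus s) $$ (p, q)"
        using pq by (simp add: scalar_prod_def torus_def G_def)
      finally show ?thesis .
    qed
    finally show "(torus s * u) $$ (p, q) = (G s * torus s) $$ (p, q)" .
  qed (use u in \<open>auto simp: G_def torus_def\<close>)
  obtain f where f: "f \<in> regular_functions m" "\<And>g. g \<in> carrier (GL m) \<Longrightarrow> \<phi> (\<rho> g w) = f g"
    using matrix_coefficient_regular[OF w \<phi>] by blast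
  have "((\<lambda>s. f (G s)) \<longlongrightarrow> f (1\<^sub>m m)) (at 0)"
  proof (rule regular_function_tendsto[OF f(1) Gm])
    fix p q assume pq: "p < m" "q < m"
    have "((\<lambda>s. u $$ (p, q) * s ^ (p - q)) \<longlongrightarrow> u $$ (p, q) * 0 ^ (p - q)) (at 0)"
      by (intro tendsto_intros)
    then show "((\<lambda>s. G s $$ (p, q)) \<longlongrightarrow> 1\<^sub>m m $$ (p, q)) (at 0)"
      using pq u by (cases p q rule: linorder_cases) (auto simp: G_def unit_lower_def power_0_left)
  qed auto
  then have lim: "((\<lambda>s. weight b * f (G s)) \<longlongrightarrow> weight b * \<phi> w) (at 0)"
    using f(2)[OF GL_one_closed] action_one[OF w] by (intro tendsto_mult tendsto_const) simp
  have "\<phi> (\<rho> (torus s) (\<rho> (u * b) w)) / weight (torus s) = weight b * f (G s)" if s: "s \<noteq> 0" for s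
  proof -
    have "\<rho> (torus s) (\<rho> (u * b) w) = \<rho> (torus s) (fscale (weight b) (\<rho> u w))"
      using action_mult[OF uG b(1) w] borel_action[OF b] action_scale[OF uG w] by simp
    also have "\<dots> = fscale (weight b) (\<rho> (torus s) (\<rho> u w))"
      using action_scale torus_GL[OF s] action_closed[OF uG w] by simp
    also have "\<rho> (torus s) (\<rho> u w) = \<rho> (G s) (\<rho> (torus s) w)"
      using action_mult[OF torus_GL[OF s] uG w] action_mult[OF GG torus_GL[OF s] w] conj by metis
    also have "\<dots> = fscale (weight (torus s)) (\<rho> (G s) w)"
      using borel_action[OF torus_GL[OF s] torus_upper] action_scale[OF GG w] by simp
    finally show ?thesis
      using torus_weight[OF s] dual_scale[OF \<phi>] action_closed[OF GG w] f(2)[OF GG]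
        cfun.subspace_scale[OF subspace_E] by simp
  qed
  then have "eventually (\<lambda>s. weight b * f (G s) = \<phi> (\<rho> (torus s) (\<rho> (u * b) w)) / weight (torus s)) (at 0)"
    by (auto simp: eventually_at_topological intro: exI[of _ UNIV])
  with lim show ?thesis by (simp add: tendsto_cong)
qed

lemma big_cell_LU:
  assumes "g \<in> big_cell m"
  obtains u b where "u \<in> carrier_mat m m" "unit_lower u" "b \<in> carrier (GL m)" "upper_triangular b" "g = u * b"
proof -
  have g: "g \<in> carrier_mat m m" "\<And>k. k \<le> m \<Longrightarrow> det (leading k g) \<noteq> 0"
    using assms by (auto simp: big_cell_def)
  obtain u b where ub: "u \<in> carrier_mat m m" "unit_lower u" "b \<in> carrier_mat m m" "upper_triangular b" "g = u * b"
    using LU_decomposition[OF g] by blast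
  have "det g \<noteq> 0" using g(2)[of m] leading_self[OF g(1)] by simp
  then have "b \<in> carrier (GL m)" using ub by (auto simp: GL_iff det_mult)
  with ub that show ?thesis by blast
qed

text \<open>Convergence of the rescaled torus action is known directly only on the orbit of the big
  cell. The vectors for which the limit exists form a subspace; a functional separating it from
  \<open>E\<close> would vanish on that orbit and hence be zero. So the limit exists everywhere and
  is itself a functional.\<close>

lemma lowest_weight_functional:
  obtains \<phi> where "\<phi> \<in> dual_space E"
    "\<And>u b. u \<in> carrier_mat m m \<Longrightarrow> unit_lower u \<Longrightarrow> b \<in> carrier (GL m) \<Longrightarrow> upper_triangular b \<Longrightarrow>
      \<phi> (\<rho> (u * b) w) = weight b"
proof -
  have "cfun.subspace {0 :: 'x \<Rightarrow> complex}" by (auto simp: cfun.subspace_def fscale_def)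
  \<comment> \<open>The normalisation \<open>\<phi> w = 1\<close> makes the limit on the big cell
    exactly \<open>weight b\<close>.\<close>
  then obtain \<phi> where \<phi>: "\<phi> \<in> dual_space E" "\<phi> w = 1"
    using dual_space_separates[of "{0}" E w] subspace_E w w_nonzero cfun.subspace_0[OF subspace_E] by auto
  define Q where "Q = (\<lambda>x s. \<phi> (\<rho> (torus s) x) / weight (torus s))"
  define S where "S = {x \<in> E. \<exists>l. (Q x \<longlongrightarrow> l) (at 0)}"
  have ev0: "eventually (\<lambda>s. s \<noteq> (0::complex)) (at 0)"
    by (auto simp: eventually_at_topological intro: exI[of _ UNIV])
  have add: "(Q (x + y) \<longlongrightarrow> l + k) (at 0)" if "x \<in> E" "y \<in> E" "(Q x \<longlongrightarrow> l) (at 0)" "(Q y \<longlongrightarrow> k) (at 0)" for x y l k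
  proof (rule Lim_transform_eventually[OF tendsto_add[OF that(3,4)]])
    show "eventually (\<lambda>s. Q x s + Q y s = Q (x + y) s) (at 0)"
      using ev0 by eventually_elim
        (use that torus_GL action_add action_closed dual_add[OF \<phi>(1)] in \<open>auto simp: Q_def add_divide_distrib\<close>)
  qed
  have scale: "(Q (fscale c x) \<longlongrightarrow> c * l) (at 0)" if "x \<in> E" "(Q x \<longlongrightarrow> l) (at 0)" for x c l
  proof (rule Lim_transform_eventually[OF tendsto_mult[OF tendsto_const that(2)]])
    show "eventually (\<lambda>s. c * Q x s = Q (fscale c x) s) (at 0)"
      using ev0 by eventually_elim
        (use that torus_GL action_scale action_closed dual_scale[OF \<phi>(1)] in \<open>auto simp: Q_def\<close>)
  qed
  have "S = E"
  proof (rule ccontr)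
    assume "S \<noteq> E"
    have "(Q 0 \<longlongrightarrow> 0) (at 0)"
      using scale[of w "weight (1\<^sub>m m) * \<phi> w" 0] torus_limit[OF \<phi>(1), of "1\<^sub>m m" "1\<^sub>m m"] GL_one_closed
        action_one[OF w] w
      by (auto simp: Q_def unit_lower_def upper_triangular_def fscale_def zero_fun_def)
    then have "cfun.subspace S"
      using add scale cfun.subspace_0[OF subspace_E] cfun.subspace_add[OF subspace_E] cfun.subspace_scale[OF subspace_E]
      unfolding S_def cfun.subspace_def by blast
    moreover obtain x where "x \<in> E" "x \<notin> S" using \<open>S \<noteq> E\<close> by (auto simp: S_def)
    ultimately obtain \<psi> where \<psi>: "\<psi> \<in> dual_space E" "\<psi> x = 1" "\<And>y. y \<in> S \<Longrightarrow> \<psi> y = 0"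
      using dual_space_separates[of S E x] subspace_E by (auto simp: S_def)
    have "\<psi> = (\<lambda>x. 0)"
    proof (rule dual_eqI_big_cell[OF \<psi>(1)])
      fix g assume g: "g \<in> big_cell m"
      then obtain u b where "u \<in> carrier_mat m m" "unit_lower u" "b \<in> carrier (GL m)" "upper_triangular b" "g = u * b"
        by (rule big_cell_LU)
      then have "\<rho> g w \<in> S"
        using torus_limit[OF \<phi>(1), of u b] action_closed[OF big_cell_GL[OF g] w] by (auto simp: S_def Q_def)
      then show "\<psi> (\<rho> g w) = 0" by (rule \<psi>(3))
    qed (simp add: dual_space_def)
    with \<psi>(2) show False by simp
  qed
  define \<phi>' where "\<phi>' = (\<lambda>x. if x \<in> E then Lim (at 0) (Q x) else 0)"
  have \<phi>': "\<phi>' x = l" if "x \<in> E" "(Q x \<longlongrightarrow> l) (at 0)" for x l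
    using that by (simp add: \<phi>'_def tendsto_Lim)
  have "\<phi>' \<in> dual_space E"
    unfolding dual_space_def
  proof (intro CollectI conjI ballI allI impI)
    fix x y assume xy: "x \<in> E" "y \<in> E"
    then obtain l k where "(Q x \<longlongrightarrow> l) (at 0)" "(Q y \<longlongrightarrow> k) (at 0)"
      using \<open>S = E\<close> unfolding S_def by blast
    then show "\<phi>' (x + y) = \<phi>' x + \<phi>' y"
      using xy add \<phi>' cfun.subspace_add[OF subspace_E] by metis
  next
    fix c x assume x: "x \<in> E"
    then obtain l where "(Q x \<longlongrightarrow> l) (at 0)" using \<open>S = E\<close> unfolding S_def by blast
    then show "\<phi>' (fscale c x) = c * \<phi>' x"
      using x scale \<phi>' cfun.subspace_scale[OF subspace_E] by metis
  qed (simp add: \<phi>'_def)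
  then show ?thesis
  proof (rule that)
    fix u b assume ub: "u \<in> carrier_mat m m" "unit_lower u" "b \<in> carrier (GL m)" "upper_triangular b"
    have "u * b \<in> carrier (GL m)"
      using ub unit_lower_det[of u m] by (intro GL_mult_closed) (auto simp: GL_iff)
    then show "\<phi>' (\<rho> (u * b) w) = weight b"
      using torus_limit[OF \<phi>(1) ub] \<phi>(2) by (intro \<phi>' action_closed w) (auto simp: Q_def)
  qed
qed

lemma dual_sum:
  assumes "\<phi> \<in> dual_space E" "finite B" "B \<subseteq> E"
  shows "(\<Sum>b\<in>B. fscale (c b) b) \<in> E" "\<phi> (\<Sum>b\<in>B. fscale (c b) b) = (\<Sum>b\<in>B. c b * \<phi> b)"
proof -
  have in_E: "(\<Sum>b\<in>B. fscale (c b) b) \<in> E" if "B \<subseteq> E" for B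
    using that by (intro cfun.subspace_sum subspace_E cfun.subspace_scale) auto
  show "(\<Sum>b\<in>B. fscale (c b) b) \<in> E" by (rule in_E[OF assms(3)])
  show "\<phi> (\<Sum>b\<in>B. fscale (c b) b) = (\<Sum>b\<in>B. c b * \<phi> b)"
    using assms(2,3)
  proof (induction B rule: finite_induct)
    case (insert b B)
    have "(\<Sum>b\<in>insert b B. fscale (c b) b) = fscale (c b) b + (\<Sum>b\<in>B. fscale (c b) b)"
      using insert by (intro sum.insert)
    moreover have "\<phi> (fscale (c b) b + (\<Sum>b\<in>B. fscale (c b) b)) = \<phi> (fscale (c b) b) + \<phi> (\<Sum>b\<in>B. fscale (c b) b)"
      using insert.prems by (intro dual_add[OF assms(1)] in_E cfun.subspace_scale[OF subspace_E]) auto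
    ultimately have sum: "\<phi> (\<Sum>b\<in>insert b B. fscale (c b) b) = \<phi> (fscale (c b) b) + \<phi> (\<Sum>b\<in>B. fscale (c b) b)"
      by (simp only:)
    show ?case
      unfolding sum using insert dual_scale[OF assms(1), of b] by simp
  qed (simp add: dual_zero[OF assms(1)])
qed

lemma dual_action_closed:
  assumes "g \<in> carrier (GL m)" "\<phi> \<in> dual_space E"
  shows "dual_action m E \<rho> g \<phi> \<in> dual_space E"
  unfolding dual_space_def
proof (intro CollectI conjI ballI allI impI)
  have gi: "inv\<^bsub>GL m\<^esub> g \<in> carrier (GL m)" using GL_inv(1)[OF assms(1)] .
  fix x y assume xy: "x \<in> E" "y \<in> E"
  then show "dual_action m E \<rho> g \<phi> (x + y) = dual_action m E \<rho> g \<phi> x + dual_action m E \<rho> g \<phi> y"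
    using cfun.subspace_add[OF subspace_E] action_add[OF gi] action_closed[OF gi] dual_add[OF assms(2)]
    by (simp add: dual_action_def)
next
  have gi: "inv\<^bsub>GL m\<^esub> g \<in> carrier (GL m)" using GL_inv(1)[OF assms(1)] .
  fix c x assume "x \<in> E"
  then show "dual_action m E \<rho> g \<phi> (fscale c x) = c * dual_action m E \<rho> g \<phi> x"
    using cfun.subspace_scale[OF subspace_E] action_scale[OF gi] action_closed[OF gi] dual_scale[OF assms(2)]
    by (simp add: dual_action_def)
qed (simp add: dual_action_def)

text \<open>The common zeros \<open>N\<close> of \<open>Q\<close> form a submodule of
  \<open>E\<close>, proper because \<open>Q\<close> is nonzero, hence \<open>{0}\<close>. Finite
  dimension then forces \<open>Q\<close> to be the whole dual, which is shown by an orthogonal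
  projection in coordinates.\<close>

lemma dual_irreducible:
  assumes Q: "Q \<subseteq> dual_space E" "cfun.subspace Q" "Q \<noteq> {0}"
    and act: "\<And>g \<phi>. g \<in> carrier (GL m) \<Longrightarrow> \<phi> \<in> Q \<Longrightarrow> dual_action m E \<rho> g \<phi> \<in> Q"
  shows "Q = dual_space E"
proof
  define N where "N = {x \<in> E. \<forall>\<phi>\<in>Q. \<phi> x = 0}"
  have "GL_submodule m \<rho> N E"
    unfolding GL_submodule_def
  proof (intro conjI ballI)
    show "cfun.subspace N"
      using Q(1) subspace_E
      by (auto simp: N_def cfun.subspace_def dual_zero dual_add dual_scale subset_iff)
    show "N \<subseteq> E" by (auto simp: N_def)
    fix g assume g: "g \<in> carrier (GL m)"
    show "\<rho> g ` N \<subseteq> N"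
    proof (rule image_subsetI)
      fix x assume x: "x \<in> N"
      have "\<phi> (\<rho> g x) = 0" if "\<phi> \<in> Q" for \<phi>
      proof -
        have "dual_action m E \<rho> (inv\<^bsub>GL m\<^esub> g) \<phi> x = 0"
          using act[OF GL_inv(1)[OF g] that] x by (simp add: N_def)
        then show ?thesis using x GL_inv(5)[OF g] by (simp add: dual_action_def N_def)
      qed
      then show "\<rho> g x \<in> N" using x action_closed[OF g] by (simp add: N_def)
    qed
  qed
  then have "N = {0} \<or> N = E" using irr by (simp add: irreducible_GL_module_def)
  moreover have "N \<noteq> E"
  proof
    assume "N = E"
    have "\<phi> = 0" if "\<phi> \<in> Q" for \<phi>
    proof
      fix x show "\<phi> x = 0 x"
        using that Q(1) \<open>N = E\<close> dual_off[of \<phi> x] by (cases "x \<in> E") (auto simp: N_def)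
    qed
    with Q(2,3) show False using cfun.subspace_0 by blast
  qed
  ultimately have N: "N = {0}" by simp
  obtain B where B: "finite B" "cfun.span B = E" using GL_module_E by (auto simp: GL_module_def)
  have BE: "B \<subseteq> E" using B(2) cfun.span_superset by blast
  \<comment> \<open>A functional is recorded by its values on the finite spanning set
    \<open>B\<close>, where orthogonal projections are available.\<close>
  define r where "r = (\<lambda>\<psi> b. if b \<in> B then \<psi> b else (0::complex))"
  have rS: "cfun.subspace (r ` Q)"
    unfolding cfun.subspace_def
  proof (intro conjI ballI allI)
    show "0 \<in> r ` Q" 
      by (rule image_eqI[of _ _ 0]) (auto simp: r_def fun_eq_iff intro: cfun.subspace_0[OF Q(2)])
  next
    fix x y assume "x \<in> r ` Q" "y \<in> r ` Q"
    then obtain a b where "a \<in> Q" "b \<in> Q" "x = r a" "y = r b" by blast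
    moreover have "r a + r b = r (a + b)" by (auto simp: r_def fun_eq_iff)
    ultimately show "x + y \<in> r ` Q" using cfun.subspace_add[OF Q(2)] by auto
  next
    fix c x assume "x \<in> r ` Q"
    then obtain a where "a \<in> Q" "x = r a" by blast
    moreover have "fscale c (r a) = r (fscale c a)" by (auto simp: r_def fun_eq_iff fscale_def)
    ultimately show "fscale c x \<in> r ` Q" using cfun.subspace_scale[OF Q(2)] by auto
  qed
  show "dual_space E \<subseteq> Q"
  proof
    fix \<phi> assume \<phi>: "\<phi> \<in> dual_space E"
    obtain \<psi> where \<psi>: "\<psi> \<in> Q" "\<And>\<theta>. \<theta> \<in> Q \<Longrightarrow> cip B (r \<phi> - r \<psi>) (r \<theta>) = 0"
    proof -
      have "s x = 0" if "s \<in> r ` Q" "x \<notin> B" for s x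
        using that by (auto simp: r_def)
      then show ?thesis
        using cip_projection[OF B(1) rS, of "r \<phi>"] that by blast
    qed
    have \<psi>E: "\<psi> \<in> dual_space E" using \<psi>(1) Q(1) by auto
    define d where "d = (\<lambda>b. \<phi> b - \<psi> b)"
    \<comment> \<open>With conjugated residuals as coefficients, orthogonality of \<open>d\<close>
      to \<open>Q\<close> says that every functional in \<open>Q\<close> kills \<open>x\<close>, so
      \<open>x = 0\<close>. Evaluating \<open>\<phi>\<close> and \<open>\<psi>\<close> at
      \<open>x\<close> and subtracting returns the squared norm of \<open>d\<close>.\<close>
    define x where "x = (\<Sum>b\<in>B. fscale (cnj (d b)) b)"
    have xE: "x \<in> E" unfolding x_def by (rule dual_sum[OF \<phi> B(1) BE])
    have "\<theta> x = 0" if \<theta>: "\<theta> \<in> Q" for \<theta>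
    proof -
      have "\<theta> x = (\<Sum>b\<in>B. cnj (d b) * \<theta> b)"
        unfolding x_def using \<theta> Q(1) by (intro dual_sum B BE) auto
      also have "\<dots> = cnj (cip B (r \<phi> - r \<psi>) (r \<theta>))"
        by (simp add: cip_def r_def d_def)
      finally show ?thesis using \<psi>(2)[OF \<theta>] by simp
    qed
    then have "x = 0" using N xE by (auto simp: N_def)
    have "cip B d d = (\<Sum>b\<in>B. cnj (d b) * \<phi> b) - (\<Sum>b\<in>B. cnj (d b) * \<psi> b)"
      by (simp add: cip_def d_def algebra_simps sum_subtractf[symmetric])
    also have "\<dots> = \<phi> x - \<psi> x"
      unfolding x_def using dual_sum(2)[OF \<phi> B(1) BE] dual_sum(2)[OF \<psi>E B(1) BE] by simp
    also have "\<dots> = 0" using \<open>x = 0\<close> dual_zero[OF \<phi>] dual_zero[OF \<psi>E] by simp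
    finally have eq: "\<phi> b = \<psi> b" if "b \<in> B" for b
      using cip_self_eq_0[OF B(1), of d b] that by (simp add: d_def)
    have "cfun.span B \<subseteq> {x \<in> E. \<phi> x = \<psi> x}"
    proof (rule cfun.span_minimal)
      show "cfun.subspace {x \<in> E. \<phi> x = \<psi> x}"
        using subspace_E \<phi> \<psi>E by (auto simp: cfun.subspace_def dual_add dual_scale dual_zero)
    qed (use eq BE in auto)
    then have "\<phi> x = \<psi> x" for x
      using B(2) dual_off[OF \<phi>, of x] dual_off[OF \<psi>E, of x] by (cases "x \<in> E") auto
    then show "\<phi> \<in> Q" using \<psi>(1) by (metis ext)
  qed
qed (rule Q(1))

end

lemma (in highest_weight_module) minor_functional:
  assumes \<mu>: "\<mu> = m_delta m i" and i: "i \<le> m"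
  obtains \<phi> where "\<phi> \<in> dual_space E" "\<And>g. g \<in> carrier (GL m) \<Longrightarrow> \<phi> (\<rho> g w) = det (leading i g) ^ m"
proof -
  obtain \<phi> where \<phi>: "\<phi> \<in> dual_space E"
    "\<And>u b. u \<in> carrier_mat m m \<Longrightarrow> unit_lower u \<Longrightarrow> b \<in> carrier (GL m) \<Longrightarrow> upper_triangular b \<Longrightarrow>
      \<phi> (\<rho> (u * b) w) = weight b"
    using lowest_weight_functional by blast
  have "\<phi> (\<rho> g w) = det (leading i g) ^ m" if g: "g \<in> carrier (GL m)" for g
  proof (rule big_cell_dense[OF _ _ _ g, of "\<lambda>g. \<phi> (\<rho> g w)" "\<lambda>g. det (leading i g) ^ m"])
    fix g assume "g \<in> carrier (GL m)"
    then show "((\<lambda>s. \<phi> (\<rho> (g + s \<cdot>\<^sub>m 1\<^sub>m m) w)) \<longlongrightarrow> \<phi> (\<rho> g w)) (at 0)"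
      by (rule matrix_coefficient_shift[OF \<phi>(1)])
  next
    fix g assume g: "g \<in> carrier (GL m)"
    then have gm: "g \<in> carrier_mat m m" by (simp add: GL_iff)
    show "((\<lambda>s. det (leading i (g + s \<cdot>\<^sub>m 1\<^sub>m m)) ^ m) \<longlongrightarrow> det (leading i g) ^ m) (at 0)"
    proof (intro tendsto_power det_tendsto[of _ i])
      fix p q assume "p < i" "q < i"
      then show "((\<lambda>s. leading i (g + s \<cdot>\<^sub>m 1\<^sub>m m) $$ (p, q)) \<longlongrightarrow> leading i g $$ (p, q)) (at 0)"
        using shift_tendsto[OF gm, of p q] i by simp
    qed auto
  next
    fix g assume "g \<in> big_cell m"
    then obtain u b where ub: "u \<in> carrier_mat m m" "unit_lower u" "b \<in> carrier (GL m)" "upper_triangular b" "g = u * b"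
      by (rule big_cell_LU)
    \<comment> \<open>Missing parts of the weight are 0, so only the first \<open>i\<close> diagonal
      entries contribute, each with exponent \<open>m\<close>.\<close>
    have "weight b = (\<Prod>j<m. if j < i then (b $$ (j, j)) ^ m else 1)"
      unfolding weight_def by (intro prod.cong) (auto simp: \<mu> m_delta_def nth_default_def)
    also have "\<dots> = (\<Prod>j\<in>{..<m} \<inter> {..<i}. (b $$ (j, j)) ^ m)"
      by (subst prod.inter_restrict) (auto intro: prod.cong)
    also have "{..<m} \<inter> {..<i} = {..<i}" using i by auto
    finally have "weight b = (\<Prod>j<i. b $$ (j, j)) ^ m" by (simp add: prod_power_distrib)
    moreover have "b \<in> carrier_mat m m" using ub(3) by (simp add: GL_iff)
    ultimately show "\<phi> (\<rho> g w) = det (leading i g) ^ m"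
      using \<phi>(2)[OF ub(1-4)] det_leading_mult[OF ub(1,2) _ ub(4) i] by (simp add: ub(5))
  qed
  with \<phi>(1) that show ?thesis by blast
qed

section \<open>The action on \<open>S\<^sup>i(S\<^sup>m(V\<^sup>*))\<close>\<close>

lemma S_S_action_filling:
  assumes "A \<in> fillings i m"
  shows "S_S_action i m g f (rows_of i m A)
    = (\<Sum>C\<in>fillings i m. (\<Prod>c\<in>cells i m. (inv\<^bsub>GL m\<^esub> g) $$ (C c, A c)) * f (rows_of i m C))"
proof -
  have "kernel_power i (kernel_power m (V_dual_kernel m g)) (rows_of i m A) (rows_of i m C)
      = (\<Prod>c\<in>cells i m. (inv\<^bsub>GL m\<^esub> g) $$ (C c, A c))" for C
    unfolding kernel_power_def V_dual_kernel_def prod_cells by (intro prod.cong refl) simp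
  then show ?thesis
    using rows_of_in_words[OF assms] by (simp add: S_S_action_def kernel_map_def sum_words_fillings)
qed

lemma S_S_action_off: "bs \<notin> arrays i m \<Longrightarrow> S_S_action i m g f bs = 0"
  by (simp add: S_S_action_def kernel_map_def)

lemma S_S_action_linear:
  "S_S_action i m g (f + h) = S_S_action i m g f + S_S_action i m g h"
  "S_S_action i m g (fscale c f) = fscale c (S_S_action i m g f)"
  by (auto simp: S_S_action_def kernel_map_def fscale_def fun_eq_iff algebra_simps sum.distrib sum_distrib_left)

text \<open>The kernel of the action is a product over cells, so it is unchanged when both index
  arrays are rearranged in the same way. Every symmetry of \<open>f\<close> under cell permutations
  therefore passes to its translates.\<close>

lemma S_S_action_permute:
  assumes \<pi>: "\<pi> permutes cells i m" and A: "A \<in> fillings i m"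
    and f: "\<And>C. C \<in> fillings i m \<Longrightarrow> f (rows_of i m (C \<circ> \<pi>)) = f (rows_of i m C)"
  shows "S_S_action i m g f (rows_of i m (A \<circ> \<pi>)) = S_S_action i m g f (rows_of i m A)"
proof -
  let ?g = "inv\<^bsub>GL m\<^esub> g"
  have "S_S_action i m g f (rows_of i m (A \<circ> \<pi>))
    = (\<Sum>C\<in>fillings i m. (\<Prod>c\<in>cells i m. ?g $$ (C c, (A \<circ> \<pi>) c)) * f (rows_of i m C))"
    by (rule S_S_action_filling[OF fillings_comp[OF \<pi> A]])
  also have "\<dots> = (\<Sum>C\<in>fillings i m. (\<Prod>c\<in>cells i m. ?g $$ ((C \<circ> \<pi>) c, (A \<circ> \<pi>) c)) * f (rows_of i m (C \<circ> \<pi>)))"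
    by (rule sum_fillings_comp[OF \<pi>, symmetric])
  also have "\<dots> = (\<Sum>C\<in>fillings i m. (\<Prod>c\<in>cells i m. ?g $$ (C c, A c)) * f (rows_of i m C))"
  proof (intro sum.cong refl arg_cong2[where f = "(*)"] f)
    fix C
    show "(\<Prod>c\<in>cells i m. ?g $$ ((C \<circ> \<pi>) c, (A \<circ> \<pi>) c)) = (\<Prod>c\<in>cells i m. ?g $$ (C c, A c))"
      using prod_cells_permute[OF \<pi>, of "\<lambda>c. ?g $$ (C c, A c)"] by simp
  qed
  also have "\<dots> = S_S_action i m g f (rows_of i m A)"
    by (rule S_S_action_filling[OF A, symmetric])
  finally show ?thesis .
qed

lemma row_group_permutes: "\<rho> \<in> row_group i m \<Longrightarrow> \<rho> permutes cells i m"
  and col_group_permutes: "\<pi> \<in> col_group i m \<Longrightarrow> \<pi> permutes cells i m"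
  by (auto simp: row_group_def col_group_def)

lemma row_group_fst: "\<rho> \<in> row_group i m \<Longrightarrow> fst (\<rho> c) = fst c"
  unfolding row_group_def by blast

lemma S_S_action_closed:
  assumes f: "f \<in> S_S_space i m"
  shows "S_S_action i m g f \<in> S_S_space i m"
proof -
  have inv: "f (rows_of i m (C \<circ> \<rho>)) = f (rows_of i m C)" if "\<rho> \<in> row_group i m" "C \<in> fillings i m" for \<rho> C
    using f that unfolding S_S_space_iff row_invariant_def by blast
  have swap: "f (rows_of i m (C \<circ> row_swap m \<sigma>)) = f (rows_of i m C)"
    if "\<sigma> permutes {..<i}" "C \<in> fillings i m" for \<sigma> C
    using f that unfolding S_S_space_iff by blast
  show ?thesis
    unfolding S_S_space_iff row_invariant_def
  proof (intro conjI allI impI ballI)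
    fix \<rho> A assume "\<rho> \<in> row_group i m" "A \<in> fillings i m"
    then show "S_S_action i m g f (rows_of i m (A \<circ> \<rho>)) = S_S_action i m g f (rows_of i m A)"
      by (intro S_S_action_permute row_group_permutes inv)
  next
    fix \<sigma> A assume "\<sigma> permutes {..<i}" "A \<in> fillings i m"
    then show "S_S_action i m g f (rows_of i m (A \<circ> row_swap m \<sigma>)) = S_S_action i m g f (rows_of i m A)"
      by (intro S_S_action_permute col_group_permutes row_swap_in swap)
  qed (rule S_S_action_off)
qed

lemma subspace_S_S_space: "cfun.subspace (S_S_space i m)"
  unfolding cfun.subspace_def Ball_def unfolding S_S_space_iff row_invariant_def
  by (simp add: fscale_def)

lemma GL_submodule_S_S_space: "GL_submodule m (S_S_action i m) (S_S_space i m) (S_S_space i m)"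
  using subspace_S_S_space S_S_action_closed by (auto simp: GL_submodule_def)

section \<open>Tensors as polynomials in the columns of an invertible matrix\<close>

text \<open>The vectors \<open>g v_p\<close> as arguments of \<open>ev\<close>: the first index
  selects the column, the second the coordinate.\<close>

definition columns :: "complex mat \<Rightarrow> nat \<Rightarrow> nat \<Rightarrow> complex" where
  "columns g p r = g $$ (r, p)"

lemma ev_cong:
  assumes "\<And>p r. p < i \<Longrightarrow> r < m \<Longrightarrow> x p r = y p r" "\<And>A. A \<in> fillings i m \<Longrightarrow> F A = H A"
  shows "ev i m F x = ev i m H y"
proof -
  have "x (fst c) (A c) = y (fst c) (A c)" if "A \<in> fillings i m" "c \<in> cells i m" for A c
    using assms(1)[of "fst c" "A c"] fillings_less[OF that] that(2) by (auto simp: cells_def)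
  then show ?thesis
    unfolding ev_def using assms(2) by (intro sum.cong refl arg_cong2[where f = "(*)"] prod.cong)
qed

lemma ev_action:
  "ev i m (\<lambda>A. S_S_action i m g f (rows_of i m A)) x
    = ev i m (\<lambda>A. f (rows_of i m A)) (\<lambda>p r. \<Sum>k<m. (inv\<^bsub>GL m\<^esub> g) $$ (r, k) * x p k)"
proof -
  let ?g = "inv\<^bsub>GL m\<^esub> g"
  have "ev i m (\<lambda>A. S_S_action i m g f (rows_of i m A)) x
    = (\<Sum>A\<in>fillings i m. \<Sum>C\<in>fillings i m. f (rows_of i m C) * (\<Prod>c\<in>cells i m. ?g $$ (C c, A c) * x (fst c) (A c)))"
    unfolding ev_def
    by (intro sum.cong refl) (simp add: S_S_action_filling sum_distrib_right sum_distrib_left prod.distrib mult.assoc mult.left_commute)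
  also have "\<dots> = (\<Sum>C\<in>fillings i m. f (rows_of i m C) * (\<Sum>A\<in>fillings i m. \<Prod>c\<in>cells i m. ?g $$ (C c, A c) * x (fst c) (A c)))"
    by (subst sum.swap) (simp add: sum_distrib_left)
  also have "\<dots> = (\<Sum>C\<in>fillings i m. f (rows_of i m C) * (\<Prod>c\<in>cells i m. \<Sum>k<m. ?g $$ (C c, k) * x (fst c) k))"
    unfolding fillings_def by (subst prod_sum_PiE) auto
  finally show ?thesis by (simp add: ev_def)
qed

lemma ev_action_columns:
  assumes g: "g \<in> carrier (GL m)" and h: "h \<in> carrier (GL m)" and i: "i \<le> m"
  shows "ev i m (\<lambda>A. S_S_action i m g f (rows_of i m A)) (columns h)
    = ev i m (\<lambda>A. f (rows_of i m A)) (columns (inv\<^bsub>GL m\<^esub> g * h))"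
  unfolding ev_action
proof (rule ev_cong)
  fix p r assume pr: "p < i" "r < m"
  have "inv\<^bsub>GL m\<^esub> g \<in> carrier_mat m m" "h \<in> carrier_mat m m"
    using GL_inv(2)[OF g] h by (auto simp: GL_iff)
  then show "(\<Sum>k<m. (inv\<^bsub>GL m\<^esub> g) $$ (r, k) * columns h p k) = columns (inv\<^bsub>GL m\<^esub> g * h) p r"
    using pr i by (simp add: columns_def scalar_prod_def atLeast0LessThan)
qed simp

text \<open>Since \<open>i \<le> m\<close>, any \<open>i\<close> vectors are the first columns of a
  square matrix \<open>X\<close>. The matrices \<open>X + s 1\<close> are invertible for small
  nonzero \<open>s\<close>, and the polynomial is continuous.\<close>

lemma ev_GL_zero:
  assumes "\<And>g. g \<in> carrier (GL m) \<Longrightarrow> ev i m F (columns g) = 0" and i: "i \<le> m"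
  shows "ev i m F x = 0"
proof -
  define X where "X = mat m m (\<lambda>(r, p). x p r)"
  have X: "X \<in> carrier_mat m m" by (simp add: X_def)
  have "((\<lambda>s. ev i m F (columns (X + s \<cdot>\<^sub>m 1\<^sub>m m))) \<longlongrightarrow> ev i m F (columns X)) (at 0)"
    unfolding ev_def
  proof (intro tendsto_sum tendsto_mult tendsto_const tendsto_prod)
    fix A c assume "A \<in> fillings i m" "c \<in> cells i m"
    then have "fst c < m" "A c < m" using i fillings_less by (auto simp: cells_def)
    then show "((\<lambda>s. columns (X + s \<cdot>\<^sub>m 1\<^sub>m m) (fst c) (A c)) \<longlongrightarrow> columns X (fst c) (A c)) (at 0)"
      unfolding columns_def using shift_tendsto[OF X] by blast
  qed
  moreover have "eventually (\<lambda>s. ev i m F (columns (X + s \<cdot>\<^sub>m 1\<^sub>m m)) = 0) (at 0)"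
    by (rule eventually_mono[OF eventually_det_shift_nonzero[OF X]]) (rule assms(1), use X in \<open>simp add: GL_iff\<close>)
  ultimately have "((\<lambda>s. 0) \<longlongrightarrow> ev i m F (columns X)) (at (0::complex))"
    by (rule Lim_transform_eventually)
  then have "ev i m F (columns X) = 0" by (simp add: tendsto_const_iff)
  moreover have "ev i m F (columns X) = ev i m F x"
    using i by (intro ev_cong) (auto simp: columns_def X_def)
  ultimately show ?thesis by simp
qed

lemma S_S_space_eqI:
  assumes f: "f \<in> S_S_space i m" and h: "h \<in> S_S_space i m" and i: "i \<le> m"
    and eq: "\<And>g. g \<in> carrier (GL m) \<Longrightarrow> ev i m (\<lambda>A. f (rows_of i m A)) (columns g) = ev i m (\<lambda>A. h (rows_of i m A)) (columns g)"
  shows "f = h"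
proof
  fix bs
  have diff: "ev i m (\<lambda>A. f (rows_of i m A) - h (rows_of i m A)) x
    = ev i m (\<lambda>A. f (rows_of i m A)) x - ev i m (\<lambda>A. h (rows_of i m A)) x" for x
    unfolding ev_def by (simp add: sum_subtractf left_diff_distrib)
  have "ev i m (\<lambda>A. f (rows_of i m A) - h (rows_of i m A)) x = 0" for x
    by (rule ev_GL_zero[OF _ i]) (simp add: diff eq)
  then have eq': "ev i m (\<lambda>A. f (rows_of i m A)) x = ev i m (\<lambda>A. h (rows_of i m A)) x" for x
    using diff[of x] by simp
  show "f bs = h bs"
  proof (cases "bs \<in> arrays i m")
    case True
    then obtain A where A: "A \<in> fillings i m" "bs = rows_of i m A"
      using bij_rows_of[of i m] by (auto simp: bij_betw_def)
    have "row_invariant i m (\<lambda>A. f (rows_of i m A))" "row_invariant i m (\<lambda>A. h (rows_of i m A))"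
      using f h unfolding S_S_space_iff by blast+
    then have "(\<lambda>A. f (rows_of i m A)) A = (\<lambda>A. h (rows_of i m A)) A"
      by (rule row_invariant_eqI[OF _ _ eq' A(1)])
    then show ?thesis by (simp add: A(2))
  next
    case False
    then show ?thesis using f h unfolding S_S_space_iff by simp
  qed
qed

section \<open>The Hermitian form on tensors and adjoints of group elements\<close>

abbreviation ip :: "nat \<Rightarrow> nat \<Rightarrow> (nat list list \<Rightarrow> complex) \<Rightarrow> (nat list list \<Rightarrow> complex) \<Rightarrow> complex" where
  "ip i m \<equiv> cip (arrays i m)"

lemma ip_fillings:
  "ip i m f h = (\<Sum>A\<in>fillings i m. f (rows_of i m A) * cnj (h (rows_of i m A)))"
  by (simp add: cip_def sum_words_fillings)

definition dagger :: "complex mat \<Rightarrow> complex mat" where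
  "dagger a = mat (dim_col a) (dim_row a) (\<lambda>(p, q). cnj (a $$ (q, p)))"

lemma dagger_mult:
  assumes "a \<in> carrier_mat m m" "b \<in> carrier_mat m m"
  shows "dagger a * dagger b = dagger (b * a)"
  using assms by (intro eq_matI) (auto simp: dagger_def scalar_prod_def mult.commute)

text \<open>Adjoints of group elements are again group elements. This makes orthogonal complements
  of submodules stable and the orthogonal projection onto a submodule equivariant.\<close>

lemma S_S_action_adjoint:
  assumes g: "g \<in> carrier (GL m)"
  obtains g' where "g' \<in> carrier (GL m)"
    "\<And>f h. ip i m (S_S_action i m g f) h = ip i m f (S_S_action i m g' h)"
proof -
  let ?g = "inv\<^bsub>GL m\<^esub> g"
  \<comment> \<open>The action of an element uses its inverse as kernel. The adjoint kernel is the
    conjugate transpose of the inverse of \<open>g\<close>, so the element sought is the inverse of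
    \<open>K\<close>.\<close>
  define K where "K = dagger ?g"
  have gm: "g \<in> carrier_mat m m" using g by (simp add: GL_iff)
  have Km: "K \<in> carrier_mat m m" using GL_inv(2)[OF g] by (simp add: K_def dagger_def)
  have "K * dagger g = dagger (1\<^sub>m m)"
    unfolding K_def using dagger_mult[OF GL_inv(2)[OF g] gm] GL_inv(3)[OF g] by simp
  also have "\<dots> = 1\<^sub>m m" by (intro eq_matI) (auto simp: dagger_def)
  finally have "det K * det (dagger g) = 1"
    using Km gm det_mult[of K m "dagger g"] by (simp add: dagger_def)
  then have KG: "K \<in> carrier (GL m)" using Km by (auto simp: GL_iff)
  have "ip i m (S_S_action i m g f) h
    = ip i m f (S_S_action i m (inv\<^bsub>GL m\<^esub> K) h)" for f h
  proof -
    have cn: "(\<Prod>c\<in>cells i m. cnj (K $$ (A c, C c))) = (\<Prod>c\<in>cells i m. ?g $$ (C c, A c))"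
      if "A \<in> fillings i m" "C \<in> fillings i m" for A C
      using fillings_less[OF that(1)] fillings_less[OF that(2)] GL_inv(2)[OF g]
      by (intro prod.cong) (auto simp: K_def dagger_def)
    have "ip i m (S_S_action i m g f) h
      = (\<Sum>A\<in>fillings i m. \<Sum>C\<in>fillings i m. (\<Prod>c\<in>cells i m. ?g $$ (C c, A c)) * f (rows_of i m C) * cnj (h (rows_of i m A)))"
      unfolding ip_fillings by (intro sum.cong refl) (simp add: S_S_action_filling sum_distrib_right)
    also have "\<dots> = (\<Sum>C\<in>fillings i m. \<Sum>A\<in>fillings i m. (\<Prod>c\<in>cells i m. ?g $$ (C c, A c)) * f (rows_of i m C) * cnj (h (rows_of i m A)))"
      by (rule sum.swap)
    also have "\<dots> = (\<Sum>C\<in>fillings i m. \<Sum>A\<in>fillings i m. f (rows_of i m C) * ((\<Prod>c\<in>cells i m. cnj (K $$ (A c, C c))) * cnj (h (rows_of i m A))))"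
      by (intro sum.cong refl) (simp add: cn)
    also have "\<dots> = ip i m f (S_S_action i m (inv\<^bsub>GL m\<^esub> K) h)"
      unfolding ip_fillings
      by (intro sum.cong refl) (simp add: S_S_action_filling sum_distrib_left GL_inv(5)[OF KG])
    finally show ?thesis .
  qed
  with GL_inv(1)[OF KG] that show ?thesis by blast
qed

lemma S_S_action_adjoint':
  assumes g: "g \<in> carrier (GL m)"
  obtains g' where "g' \<in> carrier (GL m)"
    "\<And>f h. ip i m f (S_S_action i m g h) = ip i m (S_S_action i m g' f) h"
proof -
  obtain g' where g': "g' \<in> carrier (GL m)"
    "\<And>f h. ip i m (S_S_action i m g f) h = ip i m f (S_S_action i m g' h)"
    using S_S_action_adjoint[OF g] by blast
  have "ip i m f (S_S_action i m g h) = ip i m (S_S_action i m g' f) h" for f h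
    using g'(2)[of h f] cip_commute by metis
  with g'(1) that show ?thesis by blast
qed

section \<open>The lowest weight tensor\<close>

text \<open>The tensor product over the columns of unnormalised wedges of the first \<open>i\<close>
  dual basis vectors. At most one \<open>\<pi>\<close> contributes to a given filling, so the value
  is a sign if every column is a permutation of \<open>{..<i}\<close>, and 0 otherwise.\<close>

definition wedge :: "nat \<Rightarrow> nat \<Rightarrow> (nat \<times> nat \<Rightarrow> nat) \<Rightarrow> complex" where
  "wedge i m A = (\<Sum>\<pi>\<in>col_group i m. if \<forall>c\<in>cells i m. A c = fst (\<pi> c) then of_int (col_sign m \<pi>) else 0)"

text \<open>The tensor f_0 of the overview: the average of \<open>wedge\<close> over the row group.
  Averaging, rather than summing, makes its polynomial exactly the \<open>m\<close>-th power of the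
  leading minor.\<close>

definition lowest_tensor :: "nat \<Rightarrow> nat \<Rightarrow> nat list list \<Rightarrow> complex" where
  "lowest_tensor i m bs = (if bs \<in> arrays i m
     then (\<Sum>\<rho>\<in>row_group i m. wedge i m ((\<lambda>c. bs ! fst c ! snd c) \<circ> \<rho>)) / of_nat (card (row_group i m)) else 0)"

lemma wedge_cong: "(\<And>c. c \<in> cells i m \<Longrightarrow> A c = B c) \<Longrightarrow> wedge i m A = wedge i m B"
  by (simp add: wedge_def cong: ball_cong)

lemma lowest_tensor_filling:
  assumes "A \<in> fillings i m"
  shows "lowest_tensor i m (rows_of i m A) = (\<Sum>\<rho>\<in>row_group i m. wedge i m (A \<circ> \<rho>)) / of_nat (card (row_group i m))"
proof -
  have "wedge i m ((\<lambda>c. rows_of i m A ! fst c ! snd c) \<circ> \<rho>) = wedge i m (A \<circ> \<rho>)" if "\<rho> \<in> row_group i m" for \<rho>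
  proof (rule wedge_cong)
    fix c assume "c \<in> cells i m"
    then have "\<rho> c \<in> cells i m" using permutes_in_image[OF row_group_permutes[OF that]] by simp
    then show "((\<lambda>c. rows_of i m A ! fst c ! snd c) \<circ> \<rho>) c = (A \<circ> \<rho>) c"
      by (cases "\<rho> c") (auto simp: cells_def)
  qed
  then show ?thesis using rows_of_in_words[OF assms] by (simp add: lowest_tensor_def)
qed

lemma wedge_col:
  assumes \<kappa>: "\<kappa> \<in> col_group i m"
  shows "wedge i m (A \<circ> \<kappa>) = of_int (col_sign m \<kappa>) * wedge i m A"
proof -
  note G = perm_groupD[OF perm_group_col \<kappa>]
  have eqv: "(\<forall>c\<in>cells i m. (A \<circ> \<kappa>) c = fst ((\<pi> \<circ> \<kappa>) c)) \<longleftrightarrow> (\<forall>c\<in>cells i m. A c = fst (\<pi> c))" for \<pi>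
  proof -
    have "\<kappa> ` cells i m = cells i m" by (rule permutes_image[OF G(1)])
    then have "(\<forall>c\<in>cells i m. A c = fst (\<pi> c)) \<longleftrightarrow> (\<forall>c\<in>\<kappa> ` cells i m. A c = fst (\<pi> c))" by simp
    then show ?thesis by simp
  qed
  have "(\<Sum>\<pi>\<in>col_group i m. if \<forall>c\<in>cells i m. (A \<circ> \<kappa>) c = fst ((\<pi> \<circ> \<kappa>) c) then of_int (col_sign m (\<pi> \<circ> \<kappa>)) else 0)
    = (\<Sum>\<pi>\<in>col_group i m. of_int (col_sign m \<kappa>) * (if \<forall>c\<in>cells i m. A c = fst (\<pi> c) then of_int (col_sign m \<pi>) else (0::complex)))"
    by (intro sum.cong refl) (simp only: eqv col_sign_comp[OF _ \<kappa>], simp)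
  moreover have "wedge i m (A \<circ> \<kappa>)
    = (\<Sum>\<pi>\<in>col_group i m. if \<forall>c\<in>cells i m. (A \<circ> \<kappa>) c = fst ((\<pi> \<circ> \<kappa>) c) then of_int (col_sign m (\<pi> \<circ> \<kappa>)) else 0)"
    unfolding wedge_def by (rule sum_perm_group_right[OF perm_group_col \<kappa>, symmetric])
  ultimately show ?thesis unfolding wedge_def sum_distrib_left by simp
qed

text \<open>Evenness enters here: all \<open>m\<close> columns contribute the same sign. This is
  what makes f_0 symmetric, and not alternating, in its \<open>i\<close> factors.\<close>

lemma col_sign_row_swap:
  assumes "even m" shows "col_sign m (row_swap m \<sigma>) = 1"
proof -
  have "col_sign m (row_swap m \<sigma>) = sign \<sigma> ^ m"
    by (simp add: col_sign_def row_swap_def)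
  also have "\<dots> = 1" using assms by (elim evenE) (simp add: power_mult power2_eq_square)
  finally show ?thesis .
qed

text \<open>Exchanging rows carries rows to rows as blocks, so it normalises the row group.\<close>

lemma row_swap_conjugate:
  assumes \<sigma>: "\<sigma> permutes {..<i}" and \<rho>: "\<rho> \<in> row_group i m"
  shows "row_swap m \<sigma> \<circ> \<rho> \<circ> pinv (row_swap m \<sigma>) \<in> row_group i m"
proof -
  let ?s = "row_swap m \<sigma>"
  have s: "?s permutes cells i m" using col_group_permutes[OF row_swap_in[OF \<sigma>]] .
  have r: "\<rho> permutes cells i m" using row_group_permutes[OF \<rho>] .
  have "fst ((?s \<circ> \<rho> \<circ> pinv ?s) c) = fst c" for c
  proof (cases "c \<in> cells i m")
    case True
    define d where "d = pinv ?s c"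
    have c: "c = ?s d" unfolding d_def using permutes_inverses(1)[OF s] by simp
    have d: "d \<in> cells i m" using True permutes_in_image[OF s, of d] by (simp add: c)
    then have "\<rho> d \<in> cells i m" using permutes_in_image[OF r] by simp
    moreover have "fst (\<rho> d) = fst d" by (rule row_group_fst[OF \<rho>])
    ultimately have "fst (?s (\<rho> d)) = fst (?s d)"
      using d by (cases d; cases "\<rho> d") (auto simp: row_swap_def cells_def)
    then show ?thesis by (simp add: d_def[symmetric] c[symmetric])
  next
    case False
    then have "pinv ?s c = c" "\<rho> c = c" "?s c = c"
      using permutes_not_in[OF s] permutes_not_in[OF r] permutes_not_in[OF permutes_inv[OF s]] by auto
    then show ?thesis by simp
  qed
  then show ?thesis
    using permutes_compose[OF permutes_compose[OF permutes_inv[OF s] r] s]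
    by (simp add: row_group_def comp_assoc)
qed

lemma lowest_tensor_in:
  assumes m: "even m"
  shows "lowest_tensor i m \<in> S_S_space i m"
  unfolding S_S_space_iff row_invariant_def
proof (intro conjI allI impI ballI)
  fix \<rho> A assume \<rho>: "\<rho> \<in> row_group i m" and A: "A \<in> fillings i m"
  have "(\<Sum>\<rho>'\<in>row_group i m. wedge i m (A \<circ> \<rho> \<circ> \<rho>')) = (\<Sum>\<rho>'\<in>row_group i m. wedge i m (A \<circ> \<rho>'))"
    using sum_perm_group_left[OF perm_group_row \<rho>, of "\<lambda>\<rho>. wedge i m (A \<circ> \<rho>)"] by (simp add: comp_assoc)
  then show "lowest_tensor i m (rows_of i m (A \<circ> \<rho>)) = lowest_tensor i m (rows_of i m A)"
    using A fillings_comp[OF row_group_permutes[OF \<rho>] A] by (simp add: lowest_tensor_filling)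
next
  fix \<sigma> A assume \<sigma>: "\<sigma> permutes {..<i}" and A: "A \<in> fillings i m"
  let ?s = "row_swap m \<sigma>"
  have s: "?s \<in> col_group i m" by (rule row_swap_in[OF \<sigma>])
  note G = perm_groupD[OF perm_group_col s]
  have si: "row_swap m (pinv \<sigma>) \<in> col_group i m" by (rule row_swap_in[OF permutes_inv[OF \<sigma>]])
  have inv: "pinv ?s = row_swap m (pinv \<sigma>)"
  proof (rule inv_unique_comp)
    show "?s \<circ> row_swap m (pinv \<sigma>) = id" "row_swap m (pinv \<sigma>) \<circ> ?s = id"
      using permutes_inverses[OF \<sigma>] by (auto simp: row_swap_def fun_eq_iff)
  qed
  have "(\<Sum>\<rho>\<in>row_group i m. wedge i m (A \<circ> ?s \<circ> \<rho>)) = (\<Sum>\<rho>\<in>row_group i m. wedge i m (A \<circ> \<rho>))"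
  proof (rule sum.reindex_bij_witness[of _ "\<lambda>\<rho>. pinv ?s \<circ> \<rho> \<circ> ?s" "\<lambda>\<rho>. ?s \<circ> \<rho> \<circ> pinv ?s"])
    fix \<rho> assume \<rho>: "\<rho> \<in> row_group i m"
    have "pinv ?s \<circ> (?s \<circ> \<rho> \<circ> pinv ?s) \<circ> ?s = (pinv ?s \<circ> ?s) \<circ> \<rho> \<circ> (pinv ?s \<circ> ?s)" by (simp only: comp_assoc)
    then show "pinv ?s \<circ> (?s \<circ> \<rho> \<circ> pinv ?s) \<circ> ?s = \<rho>" by (simp only: G id_comp comp_id)
    have "?s \<circ> (pinv ?s \<circ> \<rho> \<circ> ?s) \<circ> pinv ?s = (?s \<circ> pinv ?s) \<circ> \<rho> \<circ> (?s \<circ> pinv ?s)" by (simp only: comp_assoc)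
    then show "?s \<circ> (pinv ?s \<circ> \<rho> \<circ> ?s) \<circ> pinv ?s = \<rho>" by (simp only: G id_comp comp_id)
    show "?s \<circ> \<rho> \<circ> pinv ?s \<in> row_group i m" by (rule row_swap_conjugate[OF \<sigma> \<rho>])
    show "pinv ?s \<circ> \<rho> \<circ> ?s \<in> row_group i m"
      using row_swap_conjugate[OF permutes_inv[OF \<sigma>] \<rho>] unfolding inv[symmetric] G(6) .
    \<comment> \<open>Conjugation moves the row exchange past the row permutation to the outside,
      where it acts on \<open>wedge\<close> by its column sign, which is 1.\<close>
    have "A \<circ> ?s \<circ> \<rho> = A \<circ> (?s \<circ> \<rho> \<circ> pinv ?s) \<circ> ?s"
    proof -
      have "A \<circ> (?s \<circ> \<rho> \<circ> pinv ?s) \<circ> ?s = A \<circ> ?s \<circ> \<rho> \<circ> (pinv ?s \<circ> ?s)" by (simp only: comp_assoc)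
      then show ?thesis by (simp only: G comp_id)
    qed
    then show "wedge i m (A \<circ> (?s \<circ> \<rho> \<circ> pinv ?s)) = wedge i m (A \<circ> ?s \<circ> \<rho>)"
      using wedge_col[OF s, of "A \<circ> (?s \<circ> \<rho> \<circ> pinv ?s)"] col_sign_row_swap[OF m] by simp
  qed
  then show "lowest_tensor i m (rows_of i m (A \<circ> ?s)) = lowest_tensor i m (rows_of i m A)"
    using A fillings_comp[OF G(1) A] by (simp add: lowest_tensor_filling)
qed (simp add: lowest_tensor_def)

lemma sum_wedge:
  assumes i: "i \<le> m"
  shows "(\<Sum>A\<in>fillings i m. wedge i m A * H A)
    = (\<Sum>\<pi>\<in>col_group i m. of_int (col_sign m \<pi>) * H (restrict (\<lambda>c. fst (\<pi> c)) (cells i m)))"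
proof -
  let ?r = "\<lambda>\<pi>. restrict (\<lambda>c. fst (\<pi> c)) (cells i m)"
  have r: "?r \<pi> \<in> fillings i m" if "\<pi> \<in> col_group i m" for \<pi>
  proof -
    have "fst (\<pi> c) < m" if "c \<in> cells i m" for c
      using permutes_in_image[OF col_group_permutes[OF \<open>\<pi> \<in> _\<close>], of c] that i by (auto simp: cells_def)
    then show ?thesis by (auto simp: fillings_def)
  qed
  have eq: "(\<forall>c\<in>cells i m. A c = fst (\<pi> c)) \<longleftrightarrow> A = ?r \<pi>" if "A \<in> fillings i m" for A \<pi>
    using that by (auto simp: fillings_def PiE_def extensional_def fun_eq_iff)
  have "(\<Sum>A\<in>fillings i m. wedge i m A * H A)
    = (\<Sum>A\<in>fillings i m. \<Sum>\<pi>\<in>col_group i m. if A = ?r \<pi> then of_int (col_sign m \<pi>) * H A else 0)"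
    unfolding wedge_def sum_distrib_right
  proof (intro sum.cong refl)
    fix A \<pi> assume "A \<in> fillings i m"
    then show "(if \<forall>c\<in>cells i m. A c = fst (\<pi> c) then of_int (col_sign m \<pi>) else 0) * H A
      = (if A = ?r \<pi> then of_int (col_sign m \<pi>) * H A else 0)"
      by (subst eq) simp_all
  qed
  also have "\<dots> = (\<Sum>\<pi>\<in>col_group i m. \<Sum>A\<in>fillings i m. if A = ?r \<pi> then of_int (col_sign m \<pi>) * H A else 0)"
    by (rule sum.swap)
  also have "\<dots> = (\<Sum>\<pi>\<in>col_group i m. of_int (col_sign m \<pi>) * H (?r \<pi>))"
    using r by (intro sum.cong refl) simp
  finally show ?thesis .
qed

text \<open>A row invariant \<open>H\<close> does not see the averaging over rows, so f_0 can be
  replaced by \<open>wedge\<close>, whose sum collapses to the column group.\<close>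

lemma sum_lowest_tensor:
  assumes i: "i \<le> m" and H: "row_invariant i m H"
  shows "(\<Sum>A\<in>fillings i m. lowest_tensor i m (rows_of i m A) * H A)
    = (\<Sum>\<pi>\<in>col_group i m. of_int (col_sign m \<pi>) * H (restrict (\<lambda>c. fst (\<pi> c)) (cells i m)))"
proof -
  let ?R = "row_group i m"
  have "(\<Sum>A\<in>fillings i m. lowest_tensor i m (rows_of i m A) * H A)
    = (\<Sum>A\<in>fillings i m. \<Sum>\<rho>\<in>?R. wedge i m (A \<circ> \<rho>) * H (A \<circ> \<rho>)) / of_nat (card ?R)"
    unfolding sum_divide_distrib
    using H by (intro sum.cong refl) (simp add: lowest_tensor_filling row_invariant_def sum_distrib_right sum_divide_distrib)
  also have "(\<Sum>A\<in>fillings i m. \<Sum>\<rho>\<in>?R. wedge i m (A \<circ> \<rho>) * H (A \<circ> \<rho>))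
    = (\<Sum>\<rho>\<in>?R. \<Sum>A\<in>fillings i m. wedge i m (A \<circ> \<rho>) * H (A \<circ> \<rho>))"
    by (rule sum.swap)
  also have "\<dots> = (\<Sum>\<rho>\<in>?R. \<Sum>A\<in>fillings i m. wedge i m A * H A)"
    by (rule sum.cong[OF refl], rule sum_fillings_comp[OF row_group_permutes])
  also have "\<dots> = of_nat (card ?R) * (\<Sum>A\<in>fillings i m. wedge i m A * H A)" by simp
  finally show ?thesis
    using perm_group_card_pos[OF perm_group_row[of i m]] by (simp add: sum_wedge[OF i])
qed

lemma row_invariant_monomial: "row_invariant i m (\<lambda>A. \<Prod>c\<in>cells i m. x (fst c) (A c))"
  unfolding row_invariant_def
proof (intro ballI)
  fix \<rho> A assume \<rho>: "\<rho> \<in> row_group i m"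
  then have "(\<Prod>c\<in>cells i m. x (fst c) ((A \<circ> \<rho>) c)) = (\<Prod>c\<in>cells i m. x (fst (\<rho> c)) (A (\<rho> c)))"
    by (simp add: row_group_fst)
  also have "\<dots> = (\<Prod>c\<in>cells i m. x (fst c) (A c))"
    by (rule prod_cells_permute[OF row_group_permutes[OF \<rho>]])
  finally show "(\<Prod>c\<in>cells i m. x (fst c) ((A \<circ> \<rho>) c)) = (\<Prod>c\<in>cells i m. x (fst c) (A c))" .
qed

lemma ev_lowest_tensor:
  assumes i: "i \<le> m"
  shows "ev i m (\<lambda>A. lowest_tensor i m (rows_of i m A)) (columns h) = det (leading i h) ^ m"
proof -
  have "ev i m (\<lambda>A. lowest_tensor i m (rows_of i m A)) (columns h)
    = (\<Sum>\<pi>\<in>col_group i m. of_int (col_sign m \<pi>) * (\<Prod>c\<in>cells i m. columns h (fst c) (fst (\<pi> c))))"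
    unfolding ev_def sum_lowest_tensor[OF i row_invariant_monomial]
    by (intro sum.cong refl arg_cong2[where f = "(*)"] prod.cong) simp
  also have "\<dots> = (\<Prod>q<m. \<Sum>\<tau> | \<tau> permutes {..<i}. of_int (sign \<tau>) * (\<Prod>p<i. columns h p (\<tau> p)))"
    by (rule sum_col_group_prod)
  also have "\<dots> = det (leading i h) ^ m"
  proof -
    \<comment> \<open>The factor \<open>columns h p (\<tau> p)\<close> is the entry
      \<open>(\<tau> p, p)\<close> of \<open>h\<close>, so the Leibniz expansion is that of the
      transposed block.\<close>
    have "det (leading i h) = det (transpose_mat (leading i h))" by (simp add: det_transpose[of _ i])
    also have "\<dots> = (\<Sum>\<tau> | \<tau> permutes {..<i}. of_int (sign \<tau>) * (\<Prod>p<i. columns h p (\<tau> p)))"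
    proof -
      have "det (transpose_mat (leading i h))
        = (\<Sum>\<tau> | \<tau> permutes {..<i}. signof \<tau> * (\<Prod>p<i. transpose_mat (leading i h) $$ (p, \<tau> p)))"
        unfolding atLeast0LessThan[symmetric] by (rule det_def') simp
      also have "\<dots> = (\<Sum>\<tau> | \<tau> permutes {..<i}. of_int (sign \<tau>) * (\<Prod>p<i. columns h p (\<tau> p)))"
      proof (rule sum.cong[OF refl])
        fix \<tau> assume "\<tau> \<in> {\<tau>. \<tau> permutes {..<i}}"
        then have "(\<Prod>p<i. transpose_mat (leading i h) $$ (p, \<tau> p)) = (\<Prod>p<i. columns h p (\<tau> p))"
          using permutes_in_image[of \<tau> "{..<i}"] by (intro prod.cong) (auto simp: columns_def)
        then show "signof \<tau> * (\<Prod>p<i. transpose_mat (leading i h) $$ (p, \<tau> p))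
          = of_int (sign \<tau>) * (\<Prod>p<i. columns h p (\<tau> p))" by simp
      qed
      finally show ?thesis .
    qed
    finally show ?thesis by simp
  qed
  finally show ?thesis .
qed

section \<open>Signed sums over Latin rectangles\<close>

text \<open>Up to the constant \<open>(1 / fact m) ^ i\<close>, the coefficients of the generator;
  see \<open>generator_filling\<close>.\<close>

definition latin_rows :: "nat \<Rightarrow> nat \<Rightarrow> (nat \<times> nat \<Rightarrow> nat) \<Rightarrow> complex" where
  "latin_rows i m A = (if \<forall>p<i. bij_betw (\<lambda>q. A (p, q)) {..<m} {..<m} then 1 else 0)"

text \<open>The unnormalised column antisymmetrisation of \<open>latin_rows\<close>. Antisymmetry
  makes it vanish on fillings with a repeated entry in a column; on the others it is, up to sign, a
  signed count of Latin rectangles.\<close>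

definition latin_sum :: "nat \<Rightarrow> nat \<Rightarrow> (nat \<times> nat \<Rightarrow> nat) \<Rightarrow> complex" where
  "latin_sum i m A = (\<Sum>\<pi>\<in>col_group i m. of_int (col_sign m \<pi>) * latin_rows i m (A \<circ> \<pi>))"

lemma latin_rows_cong:
  assumes "\<And>c. c \<in> cells i m \<Longrightarrow> A c = B c"
  shows "latin_rows i m A = latin_rows i m B"
proof -
  have "bij_betw (\<lambda>q. A (p, q)) {..<m} {..<m} \<longleftrightarrow> bij_betw (\<lambda>q. B (p, q)) {..<m} {..<m}" if "p < i" for p
    using assms that by (intro bij_betw_cong) (auto simp: cells_def)
  then show ?thesis by (simp add: latin_rows_def)
qed

lemma latin_sum_cong:
  assumes "\<And>c. c \<in> cells i m \<Longrightarrow> A c = B c"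
  shows "latin_sum i m A = latin_sum i m B"
  unfolding latin_sum_def
proof (intro sum.cong refl arg_cong2[where f = "(*)"] latin_rows_cong)
  fix \<pi> c assume "\<pi> \<in> col_group i m" "c \<in> cells i m"
  then have "\<pi> c \<in> cells i m" using permutes_in_image[OF col_group_permutes] by blast
  then show "(A \<circ> \<pi>) c = (B \<circ> \<pi>) c" using assms by simp
qed

lemma latin_sum_col:
  assumes \<kappa>: "\<kappa> \<in> col_group i m"
  shows "latin_sum i m (A \<circ> \<kappa>) = of_int (col_sign m \<kappa>) * latin_sum i m A"
proof -
  have "latin_sum i m A = (\<Sum>\<pi>\<in>col_group i m. of_int (col_sign m (\<kappa> \<circ> \<pi>)) * latin_rows i m (A \<circ> (\<kappa> \<circ> \<pi>)))"
    unfolding latin_sum_def by (rule sum_perm_group_left[OF perm_group_col \<kappa>, symmetric])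
  also have "\<dots> = of_int (col_sign m \<kappa>) * latin_sum i m (A \<circ> \<kappa>)"
    unfolding latin_sum_def sum_distrib_left
    by (intro sum.cong refl) (simp add: col_sign_comp[OF \<kappa>] comp_assoc)
  finally have "of_int (col_sign m \<kappa>) * latin_sum i m A
    = of_int (col_sign m \<kappa> * col_sign m \<kappa>) * latin_sum i m (A \<circ> \<kappa>)" by simp
  then show ?thesis by (simp only: col_sign_square of_int_1 mult_1_left)
qed

text \<open>A column permutation of the first \<open>i\<close> rows is one of all \<open>j\<close> rows, so the sum over
  the larger group splits into sums over cosets of the smaller one.\<close>

lemma latin_sum_zero_mono:
  assumes zero: "\<And>A. A \<in> fillings i m \<Longrightarrow> latin_sum i m A = 0" and ij: "i \<le> j" and A: "A \<in> fillings j m"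
  shows "latin_sum j m A = 0"
proof -
  have sub: "col_group i m \<subseteq> col_group j m"
    using ij by (auto simp: col_group_def cells_def intro: permutes_subset)
  \<comment> \<open>Records the condition on the rows from \<open>i\<close> to \<open>j - 1\<close>.
    Column permutations of the first \<open>i\<close> rows leave these rows alone, so
    \<open>r\<close> can be pulled out of the inner sum.\<close>
  define r :: "(nat \<times> nat \<Rightarrow> nat) \<Rightarrow> complex" where
    "r = (\<lambda>B. if \<forall>p. i \<le> p \<and> p < j \<longrightarrow> bij_betw (\<lambda>q. B (p, q)) {..<m} {..<m} then 1 else 0)"
  have split: "latin_rows j m (B \<circ> \<kappa>) = r B * latin_rows i m (B \<circ> \<kappa>)" if \<kappa>: "\<kappa> \<in> col_group i m" for B \<kappa>
  proof -
    have "(B \<circ> \<kappa>) (p, q) = B (p, q)" if "i \<le> p" for p q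
      using permutes_not_in[OF col_group_permutes[OF \<kappa>], of "(p, q)"] that by (simp add: cells_def)
    then have "r (B \<circ> \<kappa>) = r B" by (simp add: r_def)
    moreover have "latin_rows j m (B \<circ> \<kappa>) = r (B \<circ> \<kappa>) * latin_rows i m (B \<circ> \<kappa>)"
    proof -
      have "(\<forall>p<j. P p) \<longleftrightarrow> (\<forall>p. i \<le> p \<and> p < j \<longrightarrow> P p) \<and> (\<forall>p<i. P p)" for P
        using ij by (meson linorder_not_le order_less_le_trans)
      then show ?thesis by (simp add: r_def latin_rows_def)
    qed
    ultimately show ?thesis by simp
  qed
  have "latin_sum i m B = 0" if "B \<in> fillings j m" for B
  proof -
    have "restrict B (cells i m) \<in> fillings i m"
      using fillings_less[OF that] ij by (auto simp: fillings_def cells_def)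
    then have "latin_sum i m (restrict B (cells i m)) = 0" by (rule zero)
    then show ?thesis using latin_sum_cong[of i m "restrict B (cells i m)" B] by simp
  qed
  then have inner: "(\<Sum>\<kappa>\<in>col_group i m. of_int (col_sign m \<kappa>) * latin_rows j m (B \<circ> \<kappa>)) = 0" if "B \<in> fillings j m" for B
    using that unfolding latin_sum_def
    by (simp add: split mult.left_commute sum_distrib_left[symmetric])
  \<comment> \<open>In place of coset representatives, the sum over the large group is averaged over
    its right translates by the small group; the positive order of the latter can be
    cancelled.\<close>
  have "of_nat (card (col_group i m)) * latin_sum j m A = (\<Sum>\<kappa>\<in>col_group i m. latin_sum j m A)"
    by simp
  also have "\<dots> = (\<Sum>\<kappa>\<in>col_group i m. \<Sum>\<tau>\<in>col_group j m. of_int (col_sign m (\<tau> \<circ> \<kappa>)) * latin_rows j m (A \<circ> (\<tau> \<circ> \<kappa>)))"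
    unfolding latin_sum_def using sub
    by (intro sum.cong refl sum_perm_group_right[OF perm_group_col, symmetric]) auto
  also have "\<dots> = (\<Sum>\<tau>\<in>col_group j m. \<Sum>\<kappa>\<in>col_group i m. of_int (col_sign m (\<tau> \<circ> \<kappa>)) * latin_rows j m (A \<circ> (\<tau> \<circ> \<kappa>)))"
    by (rule sum.swap)
  also have "\<dots> = (\<Sum>\<tau>\<in>col_group j m. of_int (col_sign m \<tau>) *
      (\<Sum>\<kappa>\<in>col_group i m. of_int (col_sign m \<kappa>) * latin_rows j m ((A \<circ> \<tau>) \<circ> \<kappa>)))"
    unfolding sum_distrib_left
    by (intro sum.cong refl) (simp add: col_sign_comp[of _ j] subsetD[OF sub] comp_assoc)
  also have "\<dots> = 0"
    using inner[OF fillings_comp[OF col_group_permutes A]] by simp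
  finally show ?thesis
    using perm_group_card_pos[OF perm_group_col[of i m]] by simp
qed

text \<open>The polynomial of the column antisymmetrisation \<open>C x\<close> of a row symmetric tensor \<open>x\<close>
  only sees \<open>R C x\<close>. But \<open>R\<close> and \<open>C\<close> are proportional to orthogonal projections, and
  \<open>x\<close> is fixed by \<open>R\<close>, so \<open>R C x = 0\<close> forces \<open>\<parallel>C x\<parallel>\<^sup>2 \<sim> \<langle>C x, x\<rangle> = 0\<close>.\<close>

lemma latin_sum_zero:
  assumes inv: "row_invariant i m (latin_rows i m)" and ev: "\<And>x. ev i m (latin_sum i m) x = 0"
    and A: "A \<in> fillings i m"
  shows "latin_sum i m A = 0"
proof -
  let ?T = "latin_sum i m" and ?l = "latin_rows i m" and ?R = "row_group i m" and ?C = "col_group i m"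
  let ?F = "fillings i m"
  define S where "S = (\<lambda>A. \<Sum>\<rho>\<in>?R. ?T (A \<circ> \<rho>))"
  have "row_invariant i m S"
    unfolding row_invariant_def
  proof (intro ballI)
    fix \<rho> A assume "\<rho> \<in> ?R"
    then show "S (A \<circ> \<rho>) = S A"
      using sum_perm_group_left[OF perm_group_row, of \<rho> i m "\<lambda>\<rho>. ?T (A \<circ> \<rho>)"] by (simp add: S_def comp_assoc)
  qed
  moreover have "ev i m S x = 0" for x
  proof -
    let ?M = "\<lambda>A. \<Prod>c\<in>cells i m. x (fst c) (A c)"
    have "ev i m S x = (\<Sum>A\<in>?F. \<Sum>\<rho>\<in>?R. ?T (A \<circ> \<rho>) * ?M (A \<circ> \<rho>))"
      unfolding ev_def S_def sum_distrib_right
      using row_invariant_monomial[of i m x] unfolding row_invariant_def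
      by (intro sum.cong refl) simp
    also have "\<dots> = (\<Sum>\<rho>\<in>?R. \<Sum>A\<in>?F. ?T (A \<circ> \<rho>) * ?M (A \<circ> \<rho>))" by (rule sum.swap)
    also have "\<dots> = (\<Sum>\<rho>\<in>?R. ev i m ?T x)"
      unfolding ev_def by (rule sum.cong[OF refl], rule sum_fillings_comp[OF row_group_permutes])
    finally show ?thesis by (simp add: ev)
  qed
  ultimately have S0: "S A = 0" if "A \<in> ?F" for A using that by (rule ev_eq_0_imp)
  have "of_nat (card ?R) * (\<Sum>A\<in>?F. ?T A * ?l A) = (\<Sum>\<rho>\<in>?R. \<Sum>A\<in>?F. ?T A * ?l A)" by simp
  also have "\<dots> = (\<Sum>\<rho>\<in>?R. \<Sum>A\<in>?F. ?T (A \<circ> \<rho>) * ?l (A \<circ> \<rho>))"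
    by (rule sum.cong[OF refl], rule sum_fillings_comp[OF row_group_permutes, symmetric])
  also have "\<dots> = (\<Sum>A\<in>?F. \<Sum>\<rho>\<in>?R. ?T (A \<circ> \<rho>) * ?l (A \<circ> \<rho>))" by (rule sum.swap)
  also have "\<dots> = (\<Sum>A\<in>?F. S A * ?l A)"
    unfolding S_def sum_distrib_right using inv unfolding row_invariant_def by (intro sum.cong refl) simp
  also have "\<dots> = 0" using S0 by simp
  finally have Tl: "(\<Sum>A\<in>?F. ?T A * ?l A) = 0"
    using perm_group_card_pos[OF perm_group_row[of i m]] by simp
  have real: "cnj (?T A) = ?T A" for A
    unfolding latin_sum_def by (auto simp: latin_rows_def intro!: sum.cong)
  have "cip ?F ?T ?T = (\<Sum>A\<in>?F. \<Sum>\<pi>\<in>?C. ?T (A \<circ> \<pi>) * ?l (A \<circ> \<pi>))"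
    unfolding cip_def
  proof (rule sum.cong[OF refl])
    fix A
    \<comment> \<open>Only one of the two factors is expanded. The sign is absorbed into the other
      by its own antisymmetry, and all coefficients are real.\<close>
    have "?T A * cnj (?T A) = (\<Sum>\<pi>\<in>?C. ?T A * (of_int (col_sign m \<pi>) * ?l (A \<circ> \<pi>)))"
      unfolding real by (subst (2) latin_sum_def) (rule sum_distrib_left)
    also have "\<dots> = (\<Sum>\<pi>\<in>?C. ?T (A \<circ> \<pi>) * ?l (A \<circ> \<pi>))"
      by (intro sum.cong refl) (simp add: latin_sum_col)
    finally show "?T A * cnj (?T A) = (\<Sum>\<pi>\<in>?C. ?T (A \<circ> \<pi>) * ?l (A \<circ> \<pi>))" .
  qed
  also have "\<dots> = (\<Sum>\<pi>\<in>?C. \<Sum>A\<in>?F. ?T (A \<circ> \<pi>) * ?l (A \<circ> \<pi>))" by (rule sum.swap)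
  also have "\<dots> = (\<Sum>\<pi>\<in>?C. \<Sum>A\<in>?F. ?T A * ?l A)"
    by (rule sum.cong[OF refl], rule sum_fillings_comp[OF col_group_permutes])
  also have "\<dots> = 0" using Tl by simp
  finally show ?thesis by (rule cip_self_eq_0[OF finite_fillings _ A])
qed

section \<open>Signed counts of Latin rectangles with a given pattern\<close>

lemma column_sign_permuted:
  fixes e :: "nat \<Rightarrow> nat"
  assumes \<tau>: "\<tau> permutes {..<i}" and e: "strict_mono_on {..<i} e"
  shows "sgn (\<Prod>p'<i. \<Prod>p<p'. int (e (\<tau> p')) - int (e (\<tau> p))) = sign \<tau>"
proof -
  have "(\<Prod>p'<i. \<Prod>p<p'. int (e (\<tau> p')) - int (e (\<tau> p))) = sign \<tau> * (\<Prod>p'<i. \<Prod>p<p'. int (e p') - int (e p))"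
    using prod_pairs_permute[OF \<tau>, of "\<lambda>p. int (e p)"] sign_inversions[OF \<tau>] by simp
  moreover have "(\<Prod>p'<i. \<Prod>p<p'. int (e p') - int (e p)) > 0"
    using strict_mono_onD[OF e] by (intro prod_pos) auto
  ultimately show ?thesis by (simp add: sgn_mult sign_def)
qed

text \<open>As \<open>e q\<close> lists \<open>P ! q\<close> increasingly, each rectangle with this
  pattern arises from exactly one column permutation of the sorted filling, and its column signs are
  those of that permutation. The factor \<open>latin_rows\<close> keeps the permutations that
  produce legal rows.\<close>

lemma card_latin_rectangles:
  assumes P: "length P = m" and e: "\<And>q. q < m \<Longrightarrow> bij_betw (e q) {..<i} (P ! q)"
    and mono: "\<And>q. q < m \<Longrightarrow> strict_mono_on {..<i} (e q)"
  shows "of_nat (card (L_plus i m P)) - of_nat (card (L_minus i m P)) = latin_sum i m (\<lambda>(p, q). e q p)"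
proof -
  \<comment> \<open>Only the rows need a condition: permuting the sorted columns keeps their entries
    distinct and their entry sets as prescribed.\<close>
  define good where "good = {\<pi> \<in> col_group i m. \<forall>p<i. bij_betw (\<lambda>q. e q (fst (\<pi> (p, q)))) {..<m} {..<m}}"
  define \<Phi> where "\<Phi> = (\<lambda>\<pi> :: nat \<times> nat \<Rightarrow> nat \<times> nat. mat i m (\<lambda>(p, q). e q (fst (\<pi> (p, q)))))"
  have einj: "inj_on (e q) {..<i}" and eimg: "e q ` {..<i} = P ! q" if "q < m" for q
    using e[OF that] by (auto simp: bij_betw_def)
  have tau: "(\<lambda>p. fst (\<pi> (p, q))) permutes {..<i}" if "\<pi> \<in> good" for \<pi> q
    by (rule column_permutes[where m = m]) (use that in \<open>simp add: good_def\<close>)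
  have inj: "inj_on \<Phi> good"
  proof (rule inj_onI)
    fix \<pi> \<kappa> assume \<pi>: "\<pi> \<in> good" and \<kappa>: "\<kappa> \<in> good" and eq: "\<Phi> \<pi> = \<Phi> \<kappa>"
    have C: "\<pi> \<in> col_group i m" "\<kappa> \<in> col_group i m" using \<pi> \<kappa> by (simp_all add: good_def)
    show "\<pi> = \<kappa>"
    proof
      fix c show "\<pi> c = \<kappa> c"
      proof (cases "c \<in> cells i m")
        case True
        then obtain p q where c: "c = (p, q)" "p < i" "q < m" by (auto simp: cells_def)
        have "\<Phi> \<pi> $$ (p, q) = \<Phi> \<kappa> $$ (p, q)" using eq by simp
        then have "e q (fst (\<pi> (p, q))) = e q (fst (\<kappa> (p, q)))" using c by (simp add: \<Phi>_def)
        moreover have "fst (\<pi> (p, q)) \<in> {..<i}" "fst (\<kappa> (p, q)) \<in> {..<i}"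
          using permutes_in_image[OF tau[OF \<pi>], of p q] permutes_in_image[OF tau[OF \<kappa>], of p q] c(2) by auto
        ultimately have "fst (\<pi> (p, q)) = fst (\<kappa> (p, q))" using einj[OF c(3)] by (auto dest: inj_onD)
        then show ?thesis using col_group_eq[OF C(1), of p q] col_group_eq[OF C(2), of p q] c(1) by simp
      next
        case False
        then show ?thesis
          using permutes_not_in[OF col_group_permutes[OF C(1)]] permutes_not_in[OF col_group_permutes[OF C(2)]] by simp
      qed
    qed
  qed
  have img: "\<Phi> ` good = {A. latin_rectangle i m A \<and> has_pattern A P}"
  proof (intro equalityI subsetI)
    fix A assume "A \<in> \<Phi> ` good"
    then obtain \<pi> where \<pi>: "\<pi> \<in> good" and A: "A = \<Phi> \<pi>" by blast
    have idx: "A $$ (p, q) = e q (fst (\<pi> (p, q)))" if "p < i" "q < m" for p q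
      using that by (simp add: A \<Phi>_def)
    have "bij_betw (\<lambda>q. A $$ (p, q)) {..<m} {..<m}" if "p < i" for p
    proof -
      have "bij_betw (\<lambda>q. e q (fst (\<pi> (p, q)))) {..<m} {..<m}" using \<pi> that by (simp add: good_def)
      then show ?thesis using idx[OF that] by (subst bij_betw_cong) auto
    qed
    moreover have "bij_betw (\<lambda>p. A $$ (p, q)) {..<i} (P ! q)" if "q < m" for q
    proof -
      have "bij_betw (e q \<circ> (\<lambda>p. fst (\<pi> (p, q)))) {..<i} (P ! q)"
        using e[OF that] permutes_imp_bij[OF tau[OF \<pi>]] by (rule bij_betw_trans[rotated])
      then show ?thesis using idx[OF _ that] by (subst bij_betw_cong) auto
    qed
    moreover have "A \<in> carrier_mat i m" by (simp add: A \<Phi>_def)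
    ultimately show "A \<in> {A. latin_rectangle i m A \<and> has_pattern A P}"
      using P by (auto simp: latin_rectangle_def has_pattern_def bij_betw_def)
  next
    fix A assume "A \<in> {A. latin_rectangle i m A \<and> has_pattern A P}"
    then have L: "latin_rectangle i m A" and H: "has_pattern A P" by simp_all
    have A: "A \<in> carrier_mat i m" using L by (simp add: latin_rectangle_def)
    have rows: "bij_betw (\<lambda>q. A $$ (p, q)) {..<m} {..<m}" if "p < i" for p
      using L that by (simp add: latin_rectangle_def)
    have inj: "inj_on (\<lambda>p. A $$ (p, q)) {..<i}" if "q < m" for q
      using L that by (simp add: latin_rectangle_def)
    have im: "(\<lambda>p. A $$ (p, q)) ` {..<i} = P ! q" if "q < m" for q
      using H that carrier_matD[OF A] unfolding has_pattern_def by simp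
    define t where "t = (\<lambda>q p. if p < i then inv_into {..<i} (e q) (A $$ (p, q)) else p)"
    have t: "t q permutes {..<i}" if q: "q < m" for q
    proof (rule bij_imp_permutes)
      have "bij_betw (\<lambda>p. A $$ (p, q)) {..<i} (P ! q)" using inj[OF q] im[OF q] by (simp add: bij_betw_def)
      then have "bij_betw (inv_into {..<i} (e q) \<circ> (\<lambda>p. A $$ (p, q))) {..<i} {..<i}"
        using bij_betw_inv_into[OF e[OF q]] by (rule bij_betw_trans)
      then show "bij_betw (t q) {..<i} {..<i}" by (subst bij_betw_cong) (auto simp: t_def)
    qed (simp add: t_def)
    define \<pi> where "\<pi> = (\<lambda>(p, q). if q < m then (t q p, q) else (p, q))"
    have \<pi>C: "\<pi> \<in> col_group i m" unfolding \<pi>_def by (rule col_perm_in_col_group[OF t])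
    have eA: "e q (fst (\<pi> (p, q))) = A $$ (p, q)" if "p < i" "q < m" for p q
    proof -
      have "A $$ (p, q) \<in> e q ` {..<i}" using im[OF that(2)] eimg[OF that(2)] that(1) by auto
      then show ?thesis using that by (simp add: \<pi>_def t_def f_inv_into_f)
    qed
    have "bij_betw (\<lambda>q. e q (fst (\<pi> (p, q)))) {..<m} {..<m}" if "p < i" for p
      using rows[OF that] eA[OF that] by (subst bij_betw_cong) auto
    then have "\<pi> \<in> good" using \<pi>C by (simp add: good_def)
    moreover have "A = \<Phi> \<pi>" using A eA by (intro eq_matI) (auto simp: \<Phi>_def)
    ultimately show "A \<in> \<Phi> ` good" by blast
  qed
  have even: "column_even (\<Phi> \<pi>) \<longleftrightarrow> col_sign m \<pi> = 1" if \<pi>: "\<pi> \<in> good" for \<pi>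
  proof -
    have "column_sign (\<Phi> \<pi>) q = sign (\<lambda>p. fst (\<pi> (p, q)))" if q: "q < m" for q
    proof -
      have "column_sign (\<Phi> \<pi>) q
        = sgn (\<Prod>p'<i. \<Prod>p<p'. int (e q (fst (\<pi> (p', q)))) - int (e q (fst (\<pi> (p, q)))))"
        unfolding column_sign_def using q by (auto simp: \<Phi>_def intro!: arg_cong[where f = sgn] prod.cong)
      also have "\<dots> = sign (\<lambda>p. fst (\<pi> (p, q)))" by (rule column_sign_permuted[OF tau[OF \<pi>] mono[OF q]])
      finally show ?thesis .
    qed
    then have "(\<Prod>q<dim_col (\<Phi> \<pi>). column_sign (\<Phi> \<pi>) q) = col_sign m \<pi>"
      by (simp add: col_sign_def \<Phi>_def)
    then show ?thesis by (simp add: column_even_def)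
  qed
  have fin: "finite good"
    using perm_group_finite[OF perm_group_col[of i m]] by (simp add: good_def)
  have "L_plus i m P = {A \<in> \<Phi> ` good. column_even A}" unfolding img L_plus_def by blast
  also have "\<dots> = \<Phi> ` {\<pi> \<in> good. column_even (\<Phi> \<pi>)}" by blast
  also have "{\<pi> \<in> good. column_even (\<Phi> \<pi>)} = {\<pi> \<in> good. col_sign m \<pi> = 1}"
    by (intro Collect_cong conj_cong refl even)
  finally have plus: "card (L_plus i m P) = card {\<pi> \<in> good. col_sign m \<pi> = 1}"
    using inj by (simp add: card_image inj_on_subset)
  have "L_minus i m P = {A \<in> \<Phi> ` good. column_odd A}" unfolding img L_minus_def by blast
  also have "\<dots> = \<Phi> ` {\<pi> \<in> good. column_odd (\<Phi> \<pi>)}" by blast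
  also have "{\<pi> \<in> good. column_odd (\<Phi> \<pi>)} = {\<pi> \<in> good. col_sign m \<pi> \<noteq> 1}"
    by (intro Collect_cong conj_cong refl arg_cong[where f = Not] even)
  finally have minus: "card (L_minus i m P) = card {\<pi> \<in> good. col_sign m \<pi> \<noteq> 1}"
    using inj by (simp add: card_image inj_on_subset)
  have pm: "col_sign m \<pi> = -1" if "col_sign m \<pi> \<noteq> 1" for \<pi>
    using col_sign_square[of m \<pi>] that by (simp add: zmult_eq_1_iff)
  have "latin_sum i m (\<lambda>(p, q). e q p) = (\<Sum>\<pi>\<in>col_group i m. if \<pi> \<in> good then of_int (col_sign m \<pi>) else 0)"
    unfolding latin_sum_def
  proof (rule sum.cong[OF refl])
    fix \<pi> assume \<pi>: "\<pi> \<in> col_group i m"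
    have "((\<lambda>(p, q). e q p) \<circ> \<pi>) (p, q) = e q (fst (\<pi> (p, q)))" for p q
      unfolding comp_def by (subst col_group_eq[OF \<pi>]) simp
    then have "latin_rows i m ((\<lambda>(p, q). e q p) \<circ> \<pi>) = (if \<pi> \<in> good then 1 else 0)"
      using \<pi> by (simp add: latin_rows_def good_def del: comp_apply)
    then show "of_int (col_sign m \<pi>) * latin_rows i m ((\<lambda>(p, q). e q p) \<circ> \<pi>) = (if \<pi> \<in> good then of_int (col_sign m \<pi>) else 0)"
      by simp
  qed
  also have "\<dots> = (\<Sum>\<pi>\<in>good. of_int (col_sign m \<pi>))"
    by (rule sum.mono_neutral_cong_right[OF perm_group_finite[OF perm_group_col finite_cells]]) (auto simp: good_def)
  also have "\<dots> = (\<Sum>\<pi>\<in>good. if col_sign m \<pi> = 1 then 1 else -1)"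
  proof (rule sum.cong[OF refl])
    fix \<pi>
    show "of_int (col_sign m \<pi>) = (if col_sign m \<pi> = 1 then 1 else (-1 :: complex))"
    proof (cases "col_sign m \<pi> = 1")
      case False
      then show ?thesis by (simp only: pm[OF False]) simp
    qed simp
  qed
  also have "\<dots> = of_nat (card {\<pi> \<in> good. col_sign m \<pi> = 1}) - of_nat (card {\<pi> \<in> good. col_sign m \<pi> \<noteq> 1})"
    using fin by (simp add: sum.If_cases Collect_conj_eq[symmetric] Int_def)
  finally show ?thesis by (simp add: plus minus)
qed

text \<open>In a Latin square every column uses all symbols, so there is a single pattern. Its
  sorted filling has the row index as entry, which is \<open>fst\<close>.\<close>

lemma card_CELS_COLS:
  "of_nat (card (CELS m)) - of_nat (card (COLS m)) = latin_sum m m fst"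
proof -
  let ?P = "replicate m {..<m}"
  have pat: "has_pattern A ?P" if A: "latin_rectangle m m A" for A
  proof -
    have dim: "dim_row A = m" "dim_col A = m" using A by (auto simp: latin_rectangle_def)
    have "(\<lambda>p. A $$ (p, q)) ` {..<m} = {..<m}" if q: "q < m" for q
    proof (rule endo_inj_surj)
      show "(\<lambda>p. A $$ (p, q)) ` {..<m} \<subseteq> {..<m}"
        using A q by (auto simp: latin_rectangle_def dest!: bij_betwE)
      show "inj_on (\<lambda>p. A $$ (p, q)) {..<m}" using A q by (simp add: latin_rectangle_def)
    qed simp
    then show ?thesis unfolding has_pattern_def dim by simp
  qed
  have "CELS m = L_plus m m ?P" "COLS m = L_minus m m ?P"
    using pat by (auto simp: CELS_def COLS_def L_plus_def L_minus_def)
  moreover have "of_nat (card (L_plus m m ?P)) - of_nat (card (L_minus m m ?P)) = latin_sum m m (\<lambda>(p, q). p)"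
    using card_latin_rectangles[of ?P m "\<lambda>q p. p" m]
    by (simp add: bij_betw_def strict_mono_on_def)
  moreover have "(\<lambda>(p, q). p) = (fst :: nat \<times> nat \<Rightarrow> nat)" by auto
  ultimately show ?thesis by simp
qed

lemma pattern_latin_sum:
  assumes P: "is_pattern i m P" and ne: "card (L_plus i m P) \<noteq> card (L_minus i m P)"
  obtains A where "A \<in> fillings i m" "latin_sum i m A \<noteq> 0"
proof -
  have "\<exists>h. bij_betw h {..<i} (P ! q) \<and> strict_mono_on {..<i} h" if "q < m" for q
  proof -
    have "P ! q \<subseteq> {..<m}" "card (P ! q) = i" using P that by (auto simp: is_pattern_def)
    then have "finite (P ! q)" by (auto intro: finite_subset)
    then obtain h where "bij_betw h {..<card (P ! q)} (P ! q)" "strict_mono_on {..<card (P ! q)} h"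
      by (rule ex_bij_betw_strict_mono_card)
    with \<open>card (P ! q) = i\<close> show ?thesis by auto
  qed
  then obtain e where e: "\<And>q. q < m \<Longrightarrow> bij_betw (e q) {..<i} (P ! q)"
    "\<And>q. q < m \<Longrightarrow> strict_mono_on {..<i} (e q)" by metis
  have "length P = m" using P by (simp add: is_pattern_def)
  from card_latin_rectangles[OF this e]
  have ne': "latin_sum i m (\<lambda>(p, q). e q p) \<noteq> 0" using ne by (metis eq_iff_diff_eq_0 of_nat_eq_iff)
  let ?A = "restrict (\<lambda>(p, q). e q p) (cells i m)"
  have "e q p < m" if "p < i" "q < m" for p q
  proof -
    have "e q p \<in> P ! q" using bij_betwE[OF e(1)[OF that(2)]] that(1) by simp
    moreover have "P ! q \<subseteq> {..<m}" using P that(2) by (simp add: is_pattern_def)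
    ultimately show ?thesis by auto
  qed
  then have "?A \<in> fillings i m" by (auto simp: fillings_def cells_def)
  moreover have "latin_sum i m ?A \<noteq> 0"
    using ne' latin_sum_cong[of i m ?A "\<lambda>(p, q). e q p"] by simp
  ultimately show ?thesis by (rule that)
qed

section \<open>The generator \<open>v\<^sub>o\<^sup>\<otimes>\<^sup>i\<close>\<close>

abbreviation generator :: "nat \<Rightarrow> nat \<Rightarrow> nat list list \<Rightarrow> complex" where
  "generator i m \<equiv> pure_tensor (replicate i (v_o m))"

lemma v_o_sym_basis: "v_o m = sym_basis m [0..<m]"
proof -
  have eq: "map (\<lambda>j. v_star (\<sigma> j)) [0..<m] = map (\<lambda>j. v_star ([0..<m] ! \<sigma> j)) [0..<m]" if "\<sigma> permutes {..<m}" for \<sigma>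
    using permutes_in_image[OF that] by simp
  show ?thesis
    unfolding v_o_def sym_basis_def
    by (intro arg_cong[where f = "fscale _"] sum.cong refl arg_cong[where f = pure_tensor] eq) simp
qed

lemma v_o_in: "v_o m \<in> sym_tensors m (V_dual m)"
  unfolding v_o_sym_basis by (rule sym_basis_in_sym_tensors) (auto simp: words_def)

lemma v_o_apply:
  assumes b: "length b = m"
  shows "v_o m b = (if bij_betw (\<lambda>q. b ! q) {..<m} {..<m} then 1 / fact m else 0)"
proof -
  have "v_o m b = (\<Sum>\<sigma> | \<sigma> permutes {..<m}. if b = map \<sigma> [0..<m] then 1 else 0) / fact m"
    unfolding v_o_sym_basis sym_basis_apply
  proof (intro arg_cong[where f = "\<lambda>x. x / fact m"] sum.cong refl)
    fix \<sigma> assume "\<sigma> \<in> {\<sigma>. \<sigma> permutes {..<m}}"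
    then have "map (\<lambda>j. [0..<m] ! \<sigma> j) [0..<m] = map \<sigma> [0..<m]"
      using permutes_in_image[of \<sigma> "{..<m}"] by simp
    then show "pure_tensor (map (\<lambda>j. v_star ([0..<m] ! \<sigma> j)) [0..<m]) b = (if b = map \<sigma> [0..<m] then 1 else 0)"
      by (simp add: pure_tensor_v_star[OF b])
  qed
  also have "(\<Sum>\<sigma> | \<sigma> permutes {..<m}. if b = map \<sigma> [0..<m] then 1 else (0::complex))
    = of_nat (card {\<sigma>. \<sigma> permutes {..<m} \<and> b = map \<sigma> [0..<m]})"
    by (simp add: sum.If_cases finite_permutations Int_def)
  also have "card {\<sigma>. \<sigma> permutes {..<m} \<and> b = map \<sigma> [0..<m]} = (if bij_betw (\<lambda>q. b ! q) {..<m} {..<m} then 1 else 0)"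
  proof (cases "bij_betw (\<lambda>q. b ! q) {..<m} {..<m}")
    case True
    define s where "s = (\<lambda>q. if q < m then b ! q else q)"
    have "s permutes {..<m}"
    proof (rule bij_imp_permutes)
      show "bij_betw s {..<m} {..<m}" using True by (subst bij_betw_cong) (auto simp: s_def)
    qed (simp add: s_def)
    moreover have "b = map s [0..<m]" using b by (intro nth_equalityI) (auto simp: s_def)
    moreover have "\<sigma> = s" if "\<sigma> permutes {..<m}" "b = map \<sigma> [0..<m]" for \<sigma>
    proof
      fix q show "\<sigma> q = s q" using permutes_not_in[OF that(1), of q] that(2) by (cases "q < m") (auto simp: s_def)
    qed
    ultimately have "{\<sigma>. \<sigma> permutes {..<m} \<and> b = map \<sigma> [0..<m]} = {s}" by blast
    then show ?thesis using True by simp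
  next
    case False
    have "bij_betw (\<lambda>q. b ! q) {..<m} {..<m}" if "\<sigma> permutes {..<m}" "b = map \<sigma> [0..<m]" for \<sigma>
      using permutes_imp_bij[OF that(1)] that(2) by (subst bij_betw_cong[of _ _ \<sigma>]) auto
    then have "{\<sigma>. \<sigma> permutes {..<m} \<and> b = map \<sigma> [0..<m]} = {}" using False by blast
    then show ?thesis using False by (simp only: card.empty if_False)
  qed
  finally show ?thesis by (simp split: if_splits)
qed

lemma generator_filling: "generator i m (rows_of i m A) = (1 / fact m) ^ i * latin_rows i m A"
proof -
  have "generator i m (rows_of i m A) = (\<Prod>p<i. v_o m (map (\<lambda>q. A (p, q)) [0..<m]))"
    by (simp add: pure_tensor_def)
  also have "\<dots> = (\<Prod>p<i. if bij_betw (\<lambda>q. A (p, q)) {..<m} {..<m} then 1 / fact m else 0)"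
  proof (intro prod.cong refl)
    fix p
    have "bij_betw (\<lambda>q. map (\<lambda>q. A (p, q)) [0..<m] ! q) {..<m} {..<m} = bij_betw (\<lambda>q. A (p, q)) {..<m} {..<m}"
      by (intro bij_betw_cong) simp
    then show "v_o m (map (\<lambda>q. A (p, q)) [0..<m]) = (if bij_betw (\<lambda>q. A (p, q)) {..<m} {..<m} then 1 / fact m else 0)"
      by (subst v_o_apply) simp_all
  qed
  also have "\<dots> = (1 / fact m) ^ i * latin_rows i m A"
    by (auto simp: latin_rows_def)
  finally show ?thesis .
qed

lemma generator_in: "generator i m \<in> S_S_space i m"
proof -
  have "generator i m \<in> tensor_power i (sym_tensors m (V_dual m))"
    unfolding tensor_power_def
    by (intro cfun.span_base CollectI exI[of _ "replicate i (v_o m)"]) (use v_o_in in auto)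
  moreover have "generator i m (permute_list \<sigma> bs) = generator i m bs"
    if \<sigma>: "\<sigma> permutes {..<i}" and bs: "length bs = i" for \<sigma> bs
  proof -
    have "generator i m (permute_list \<sigma> bs) = (\<Prod>j<i. v_o m (bs ! \<sigma> j))"
      using \<sigma> bs by (auto simp: pure_tensor_def permute_list_nth intro!: prod.cong)
    also have "\<dots> = (\<Prod>j<i. v_o m (bs ! j))"
      using prod.permute[OF \<sigma>, of "\<lambda>j. v_o m (bs ! j)"] by (simp add: comp_def)
    finally show ?thesis using bs by (simp add: pure_tensor_def)
  qed
  ultimately show ?thesis by (simp add: S_S_space_def sym_tensors_def)
qed

lemma row_invariant_latin_rows: "row_invariant i m (latin_rows i m)"
proof -
  have "row_invariant i m (\<lambda>A. generator i m (rows_of i m A))"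
    using generator_in unfolding S_S_space_iff by blast
  then show ?thesis unfolding row_invariant_def generator_filling by simp
qed

text \<open>The translate of the generator is row invariant, so f_0 may be replaced by its
  column-alternating version. Reindexing fillings by \<open>\<pi>\<close> then shifts the
  alternation onto the generator, leaving the monomials in the rows of the inverse of
  \<open>g\<close>.\<close>

lemma cip_lowest_tensor_generator:
  assumes g: "g \<in> carrier (GL m)" and i: "i \<le> m"
  shows "ip i m (S_S_action i m g (lowest_tensor i m)) (generator i m)
    = (1 / fact m) ^ i * ev i m (latin_sum i m) (\<lambda>p r. (inv\<^bsub>GL m\<^esub> g) $$ (p, r))"
proof -
  let ?g = "inv\<^bsub>GL m\<^esub> g" and ?F = "fillings i m" and ?l = "latin_rows i m"
  \<comment> \<open>The kernel of \<open>g\<close> transposed and applied to the Latin row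
    indicator, that is, the pairing with \<open>g\<close> moved to the second argument.\<close>
  define X where "X = (\<lambda>C. \<Sum>A\<in>?F. (\<Prod>c\<in>cells i m. ?g $$ (C c, A c)) * ?l A)"
  have X: "row_invariant i m X"
    unfolding row_invariant_def
  proof (intro ballI)
    fix \<rho> C assume \<rho>: "\<rho> \<in> row_group i m"
    have "X (C \<circ> \<rho>) = (\<Sum>A\<in>?F. (\<Prod>c\<in>cells i m. ?g $$ ((C \<circ> \<rho>) c, (A \<circ> \<rho>) c)) * ?l (A \<circ> \<rho>))"
      unfolding X_def by (rule sum_fillings_comp[OF row_group_permutes[OF \<rho>], symmetric])
    also have "\<dots> = X C"
      unfolding X_def
    proof (intro sum.cong refl arg_cong2[where f = "(*)"])
      fix A assume "A \<in> ?F"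
      then show "?l (A \<circ> \<rho>) = ?l A" using row_invariant_latin_rows \<rho> unfolding row_invariant_def by blast
      show "(\<Prod>c\<in>cells i m. ?g $$ ((C \<circ> \<rho>) c, (A \<circ> \<rho>) c)) = (\<Prod>c\<in>cells i m. ?g $$ (C c, A c))"
        using prod_cells_permute[OF row_group_permutes[OF \<rho>], of "\<lambda>c. ?g $$ (C c, A c)"] by simp
    qed
    finally show "X (C \<circ> \<rho>) = X C" .
  qed
  have "cnj (?l A) = ?l A" for A by (simp add: latin_rows_def)
  then have "ip i m (S_S_action i m g (lowest_tensor i m)) (generator i m)
    = (\<Sum>A\<in>?F. \<Sum>C\<in>?F. (1 / fact m) ^ i * (lowest_tensor i m (rows_of i m C) * ((\<Prod>c\<in>cells i m. ?g $$ (C c, A c)) * ?l A)))"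
    unfolding ip_fillings
    by (intro sum.cong refl) (simp add: S_S_action_filling generator_filling sum_distrib_left sum_distrib_right mult_ac)
  also have "\<dots> = (1 / fact m) ^ i * (\<Sum>C\<in>?F. lowest_tensor i m (rows_of i m C) * X C)"
    unfolding X_def sum_distrib_left by (rule sum.swap)
  also have "(\<Sum>C\<in>?F. lowest_tensor i m (rows_of i m C) * X C)
    = (\<Sum>\<pi>\<in>col_group i m. of_int (col_sign m \<pi>) * X (restrict (\<lambda>c. fst (\<pi> c)) (cells i m)))"
    by (rule sum_lowest_tensor[OF i X])
  also have "\<dots> = (\<Sum>\<pi>\<in>col_group i m. \<Sum>A\<in>?F. of_int (col_sign m \<pi>) * ?l (A \<circ> \<pi>) * (\<Prod>c\<in>cells i m. ?g $$ (fst c, A c)))"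
  proof (rule sum.cong[OF refl])
    fix \<pi> assume \<pi>: "\<pi> \<in> col_group i m"
    have "X (restrict (\<lambda>c. fst (\<pi> c)) (cells i m)) = (\<Sum>A\<in>?F. (\<Prod>c\<in>cells i m. ?g $$ (fst (\<pi> c), A c)) * ?l A)"
      unfolding X_def by (intro sum.cong refl arg_cong2[where f = "(*)"] prod.cong) simp
    also have "\<dots> = (\<Sum>A\<in>?F. (\<Prod>c\<in>cells i m. ?g $$ (fst (\<pi> c), (A \<circ> \<pi>) c)) * ?l (A \<circ> \<pi>))"
      by (rule sum_fillings_comp[OF col_group_permutes[OF \<pi>], symmetric])
    also have "\<dots> = (\<Sum>A\<in>?F. (\<Prod>c\<in>cells i m. ?g $$ (fst c, A c)) * ?l (A \<circ> \<pi>))"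
      using prod_cells_permute[OF col_group_permutes[OF \<pi>], of "\<lambda>c. ?g $$ (fst c, A c)" for A] by simp
    finally show "of_int (col_sign m \<pi>) * X (restrict (\<lambda>c. fst (\<pi> c)) (cells i m))
      = (\<Sum>A\<in>?F. of_int (col_sign m \<pi>) * ?l (A \<circ> \<pi>) * (\<Prod>c\<in>cells i m. ?g $$ (fst c, A c)))"
      by (simp add: sum_distrib_left mult_ac)
  qed
  also have "\<dots> = ev i m (latin_sum i m) (\<lambda>p r. ?g $$ (p, r))"
    unfolding ev_def latin_sum_def sum_distrib_right by (rule sum.swap)
  finally show ?thesis .
qed

lemma latin_sum_zero_if_orthogonal:
  assumes i: "i \<le> m" and A: "A \<in> fillings i m"
    and orth: "\<And>g. g \<in> carrier (GL m) \<Longrightarrow>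
      ip i m (S_S_action i m g (lowest_tensor i m)) (generator i m) = 0"
  shows "latin_sum i m A = 0"
proof (rule latin_sum_zero[OF row_invariant_latin_rows ev_GL_zero[OF _ i] A])
  fix h assume h: "h \<in> carrier (GL m)"
  have hm: "h \<in> carrier_mat m m" using h by (simp add: GL_iff)
  \<comment> \<open>Chosen so that the rows of the inverse of \<open>g\<close> are the columns of
    \<open>h\<close>, the form in which density of invertible matrices was stated.\<close>
  define g where "g = inv\<^bsub>GL m\<^esub> (transpose_mat h)"
  have hT: "transpose_mat h \<in> carrier (GL m)" using h by (auto simp: GL_iff det_transpose)
  have g: "g \<in> carrier (GL m)" "inv\<^bsub>GL m\<^esub> g = transpose_mat h"
    using GL_inv(1,5)[OF hT] by (simp_all add: g_def)
  have "ev i m (latin_sum i m) (\<lambda>p r. (transpose_mat h) $$ (p, r)) = 0"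
    using cip_lowest_tensor_generator[OF g(1) i] orth[OF g(1)] g(2) by simp
  moreover have "ev i m (latin_sum i m) (\<lambda>p r. (transpose_mat h) $$ (p, r)) = ev i m (latin_sum i m) (columns h)"
    using hm i by (intro ev_cong) (auto simp: columns_def)
  ultimately show "ev i m (latin_sum i m) (columns h) = 0" by simp
qed

section \<open>The submodule \<open>U\<^sub>i\<close>\<close>

lemma U_submodule: "GL_submodule m (S_S_action i m) (U i m) (S_S_space i m)"
proof -
  let ?N = "{N. GL_submodule m (S_S_action i m) N (S_S_space i m) \<and> generator i m \<in> N}"
  have "S_S_space i m \<in> ?N" using GL_submodule_S_S_space generator_in by blast
  then have sub: "\<Inter> ?N \<subseteq> S_S_space i m" by blast
  have "cfun.subspace (\<Inter> ?N)" by (rule cfun.subspace_Inter) (auto simp: GL_submodule_def)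
  with sub show ?thesis unfolding U_def generated_GL_submodule_def GL_submodule_def by blast
qed

lemma generator_in_U: "generator i m \<in> U i m"
  by (auto simp: U_def generated_GL_submodule_def)

lemma U_minimal:
  "GL_submodule m (S_S_action i m) N (S_S_space i m) \<Longrightarrow> generator i m \<in> N \<Longrightarrow> U i m \<subseteq> N"
  unfolding U_def generated_GL_submodule_def by blast

lemma ev_add: "ev i m (\<lambda>A. (f + h) (rows_of i m A)) x
    = ev i m (\<lambda>A. f (rows_of i m A)) x + ev i m (\<lambda>A. h (rows_of i m A)) x"
  and ev_scale: "ev i m (\<lambda>A. fscale c f (rows_of i m A)) x = c * ev i m (\<lambda>A. f (rows_of i m A)) x"
  by (simp_all add: ev_def fscale_def distrib_right sum.distrib sum_distrib_left mult.assoc)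

lemma dual_action_linear:
  "dual_action m E \<rho> g 0 = 0"
  "dual_action m E \<rho> g (\<phi> + \<psi>) = dual_action m E \<rho> g \<phi> + dual_action m E \<rho> g \<psi>"
  "dual_action m E \<rho> g (fscale c \<phi>) = fscale c (dual_action m E \<rho> g \<phi>)"
  by (auto simp: dual_action_def fscale_def fun_eq_iff)

locale rectangular_module = highest_weight_module m E \<rho> "m_delta m i" w
  for m E \<rho> i w +
  assumes even: "even m" and i: "i \<le> m"
begin

abbreviation W :: "(nat list list \<Rightarrow> complex) set" where "W \<equiv> S_S_space i m"
abbreviation act :: "complex mat \<Rightarrow> (nat list list \<Rightarrow> complex) \<Rightarrow> nat list list \<Rightarrow> complex" where
  "act \<equiv> S_S_action i m"
abbreviation pl :: "(nat list list \<Rightarrow> complex) \<Rightarrow> complex mat \<Rightarrow> complex" where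
  "pl f h \<equiv> ev i m (\<lambda>A. f (rows_of i m A)) (columns h)"

text \<open>Equality of matrix coefficient functions on the group. Since each side determines the
  other, this is the graph of the equivariant embedding of the dual of \<open>E\<close> into the
  tensor space; as a relation, its linearity and equivariance can be proved before its
  totality.\<close>

definition represents :: "(nat list list \<Rightarrow> complex) \<Rightarrow> (('a \<Rightarrow> complex) \<Rightarrow> complex) \<Rightarrow> bool" where
  "represents f \<phi> \<longleftrightarrow> f \<in> W \<and> \<phi> \<in> dual_space E \<and> (\<forall>h\<in>carrier (GL m). pl f h = \<phi> (\<rho> h w))"

lemma subspace_dual: "cfun.subspace (dual_space E)"
  by (auto simp: cfun.subspace_def dual_space_def fscale_def algebra_simps)

lemma represents_add: "represents f \<phi> \<Longrightarrow> represents h \<psi> \<Longrightarrow> represents (f + h) (\<phi> + \<psi>)"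
  using cfun.subspace_add[OF subspace_S_S_space] cfun.subspace_add[OF subspace_dual]
  unfolding represents_def ev_add by simp

lemma represents_scale: "represents f \<phi> \<Longrightarrow> represents (fscale c f) (fscale c \<phi>)"
  using cfun.subspace_scale[OF subspace_S_S_space] cfun.subspace_scale[OF subspace_dual]
  unfolding represents_def ev_scale by (simp add: fscale_def)

lemma represents_act:
  assumes f: "represents f \<phi>" and g: "g \<in> carrier (GL m)"
  shows "represents (act g f) (dual_action m E \<rho> g \<phi>)"
  unfolding represents_def
proof (intro conjI ballI)
  show "act g f \<in> W" "dual_action m E \<rho> g \<phi> \<in> dual_space E"
    using f g S_S_action_closed dual_action_closed by (auto simp: represents_def)
  fix h assume h: "h \<in> carrier (GL m)"
  have gi: "inv\<^bsub>GL m\<^esub> g \<in> carrier (GL m)" by (rule GL_inv(1)[OF g])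
  have "pl (act g f) h = pl f (inv\<^bsub>GL m\<^esub> g * h)" by (rule ev_action_columns[OF g h i])
  also have "\<dots> = \<phi> (\<rho> (inv\<^bsub>GL m\<^esub> g * h) w)"
    using f GL_mult_closed[OF gi h] by (simp add: represents_def)
  also have "\<dots> = dual_action m E \<rho> g \<phi> (\<rho> h w)"
    using action_mult[OF gi h w] action_closed[OF h w] by (simp add: dual_action_def)
  finally show "pl (act g f) h = dual_action m E \<rho> g \<phi> (\<rho> h w)" .
qed

lemma represents_unique: "represents f \<phi> \<Longrightarrow> represents h \<phi> \<Longrightarrow> f = h"
  unfolding represents_def by (intro S_S_space_eqI[OF _ _ i]) auto

definition \<phi>\<^sub>0 :: "('a \<Rightarrow> complex) \<Rightarrow> complex" where
  "\<phi>\<^sub>0 = (SOME \<phi>. \<phi> \<in> dual_space E \<and> (\<forall>g\<in>carrier (GL m). \<phi> (\<rho> g w) = det (leading i g) ^ m))"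

lemma \<phi>\<^sub>0: "\<phi>\<^sub>0 \<in> dual_space E" "g \<in> carrier (GL m) \<Longrightarrow> \<phi>\<^sub>0 (\<rho> g w) = det (leading i g) ^ m"
proof -
  have "\<exists>\<phi>. \<phi> \<in> dual_space E \<and> (\<forall>g\<in>carrier (GL m). \<phi> (\<rho> g w) = det (leading i g) ^ m)"
    by (rule minor_functional[OF refl i]) blast
  from someI_ex[OF this]
  show "\<phi>\<^sub>0 \<in> dual_space E" "g \<in> carrier (GL m) \<Longrightarrow> \<phi>\<^sub>0 (\<rho> g w) = det (leading i g) ^ m"
    unfolding \<phi>\<^sub>0_def by blast+
qed

lemma \<phi>\<^sub>0_nonzero: "\<phi>\<^sub>0 \<noteq> 0"
proof
  assume "\<phi>\<^sub>0 = 0"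
  moreover have "leading i (1\<^sub>m m) = 1\<^sub>m i" using i by (intro eq_matI) auto
  ultimately show False using \<phi>\<^sub>0(2)[OF GL_one_closed] by simp
qed

lemma represents_\<phi>\<^sub>0: "represents (lowest_tensor i m) \<phi>\<^sub>0"
  using lowest_tensor_in[OF even] \<phi>\<^sub>0 ev_lowest_tensor[OF i] by (simp add: represents_def)

lemma represents_zero: "represents 0 0"
  using cfun.subspace_0[OF subspace_S_S_space] cfun.subspace_0[OF subspace_dual]
  by (simp add: represents_def ev_def)

text \<open>The represented functionals form a submodule of the irreducible dual, and it is nonzero
  because it contains \<open>\<phi>\<^sub>0\<close>.\<close>

lemma dual_represented:
  assumes "\<phi> \<in> dual_space E"
  obtains f where "represents f \<phi>"
proof -
  let ?Q = "{\<phi>. \<exists>f. represents f \<phi>}"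
  have "?Q = dual_space E"
  proof (rule dual_irreducible)
    show "?Q \<subseteq> dual_space E" by (auto simp: represents_def)
    show "cfun.subspace ?Q"
      unfolding cfun.subspace_def using represents_add represents_scale represents_zero by blast
    show "?Q \<noteq> {0}" using represents_\<phi>\<^sub>0 \<phi>\<^sub>0_nonzero by blast
    show "dual_action m E \<rho> g \<phi> \<in> ?Q" if "g \<in> carrier (GL m)" "\<phi> \<in> ?Q" for g \<phi>
      using that represents_act by blast
  qed
  with assms that show ?thesis by blast
qed

text \<open>The graph of the composition of \<open>E\<^sup>* \<rightarrow> W\<close> with the orthogonal projection onto \<open>U\<^sub>i\<close>.\<close>

definition proj :: "(('a \<Rightarrow> complex) \<Rightarrow> complex) \<Rightarrow> (nat list list \<Rightarrow> complex) \<Rightarrow> bool" where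
  "proj \<phi> u \<longleftrightarrow> u \<in> U i m \<and> (\<exists>f. represents f \<phi> \<and> (\<forall>v\<in>U i m. ip i m (f - u) v = 0))"

lemma subspace_U: "cfun.subspace (U i m)"
  and U_sub: "U i m \<subseteq> W"
  and U_act: "g \<in> carrier (GL m) \<Longrightarrow> u \<in> U i m \<Longrightarrow> act g u \<in> U i m"
  using U_submodule[of m i] by (auto simp: GL_submodule_def)

lemma W_off: "f \<in> W \<Longrightarrow> bs \<notin> arrays i m \<Longrightarrow> f bs = 0"
  unfolding S_S_space_iff by blast

lemma ip_self: "f \<in> W \<Longrightarrow> ip i m f f = 0 \<Longrightarrow> f = 0"
  by (rule ext) (metis W_off cip_self_eq_0 finite_words finite_lessThan zero_fun_def)

lemma proj_total:
  assumes "\<phi> \<in> dual_space E"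
  obtains u where "proj \<phi> u"
proof -
  obtain f where f: "represents f \<phi>" using dual_represented[OF assms] .
  have "\<exists>u\<in>U i m. \<forall>v\<in>U i m. ip i m (f - u) v = 0"
    using W_off U_sub by (intro cip_projection subspace_U) auto
  with f that show ?thesis unfolding proj_def by blast
qed

lemma proj_add:
  assumes "proj \<phi> u" "proj \<psi> v" shows "proj (\<phi> + \<psi>) (u + v)"
proof -
  obtain f h where fh: "represents f \<phi>" "represents h \<psi>" "\<forall>v\<in>U i m. ip i m (f - u) v = 0" "\<forall>u\<in>U i m. ip i m (h - v) u = 0"
    using assms unfolding proj_def by blast
  have "\<forall>x\<in>U i m. ip i m ((f + h) - (u + v)) x = 0"
    using fh(3,4) by (simp add: cip_simps)
  then show ?thesis
    using represents_add[OF fh(1,2)] assms cfun.subspace_add[OF subspace_U] unfolding proj_def by blast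
qed

lemma proj_scale:
  assumes "proj \<phi> u" shows "proj (fscale c \<phi>) (fscale c u)"
proof -
  obtain f where f: "represents f \<phi>" "\<forall>v\<in>U i m. ip i m (f - u) v = 0"
    using assms unfolding proj_def by blast
  have "\<forall>x\<in>U i m. ip i m (fscale c f - fscale c u) x = 0"
    using f(2) by (simp add: cip_simps)
  then show ?thesis
    using represents_scale[OF f(1)] assms cfun.subspace_scale[OF subspace_U] unfolding proj_def by blast
qed

lemma proj_act:
  assumes "proj \<phi> u" and g: "g \<in> carrier (GL m)" shows "proj (dual_action m E \<rho> g \<phi>) (act g u)"
proof -
  obtain f where f: "represents f \<phi>" "\<forall>v\<in>U i m. ip i m (f - u) v = 0" and u: "u \<in> U i m"
    using assms unfolding proj_def by blast
  obtain g' where g': "g' \<in> carrier (GL m)" "\<And>f h. ip i m (act g f) h = ip i m f (act g' h)"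
    using S_S_action_adjoint[OF g] by blast
  have "ip i m (act g f - act g u) v = 0" if "v \<in> U i m" for v
    using f(2) U_act[OF g'(1) that] by (simp add: cip_simps g'(2))
  then show ?thesis
    using represents_act[OF f(1) g] U_act[OF g u] unfolding proj_def by blast
qed

lemma proj_unique:
  assumes "proj \<phi> u" "proj \<phi> v" shows "u = v"
proof -
  obtain f h where fh: "represents f \<phi>" "represents h \<phi>" "\<forall>v\<in>U i m. ip i m (f - u) v = 0" "\<forall>u\<in>U i m. ip i m (h - v) u = 0"
    and uv: "u \<in> U i m" "v \<in> U i m"
    using assms unfolding proj_def by blast
  have "f = h" by (rule represents_unique[OF fh(1,2)])
  have d: "u - v \<in> U i m" using uv cfun.subspace_diff[OF subspace_U] by blast
  have "ip i m (u - v) (u - v) = ip i m (h - v) (u - v) - ip i m (f - u) (u - v)"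
    unfolding \<open>f = h\<close> by (simp add: cip_simps)
  also have "\<dots> = 0" using fh(3,4) d by simp
  finally have "u - v = 0" using ip_self d U_sub by blast
  then show ?thesis by simp
qed

text \<open>The kernel \<open>K\<close> of the projection is a submodule of the irreducible dual, so
  it is zero or everything. The second case would make all the Latin sums vanish. Hence the
  projection is injective and its image \<open>N\<close> is a copy of the dual inside
  \<open>U i m\<close>.\<close>

theorem U_meets_dual_isotypic:
  assumes A: "A \<in> fillings i m" "latin_sum i m A \<noteq> 0"
  shows "U i m \<inter> dual_isotypic i m E \<rho> \<noteq> {0}"
proof -
  define K where "K = {\<phi> \<in> dual_space E. proj \<phi> 0}"
  have "proj 0 0"
    unfolding proj_def using represents_zero cfun.subspace_0[OF subspace_U]
    by (intro conjI exI[of _ 0]) (auto simp: cip_def)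
  have "K \<noteq> dual_space E"
  proof
    assume "K = dual_space E"
    then have "proj \<phi>\<^sub>0 0" using \<phi>\<^sub>0(1) by (auto simp: K_def)
    then obtain f where "represents f \<phi>\<^sub>0" "\<forall>v\<in>U i m. ip i m (f - 0) v = 0" unfolding proj_def by blast
    then have orth: "ip i m (lowest_tensor i m) v = 0" if "v \<in> U i m" for v
      using represents_unique[OF _ represents_\<phi>\<^sub>0] that by (simp add: cip_simps)
    \<comment> \<open>Passing \<open>g\<close> to the other side as its adjoint keeps the generator
      inside \<open>U i m\<close>, so orthogonality of f_0 to \<open>U i m\<close> extends to its
      whole orbit.\<close>
    have "ip i m (act g (lowest_tensor i m)) (generator i m) = 0" if g: "g \<in> carrier (GL m)" for g
    proof -
      obtain g' where g': "g' \<in> carrier (GL m)" "\<And>f h. ip i m (act g f) h = ip i m f (act g' h)"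
        using S_S_action_adjoint[OF g] by blast
      show ?thesis unfolding g'(2) by (intro orth U_act g' generator_in_U)
    qed
    with A show False using latin_sum_zero_if_orthogonal[OF i A(1)] by blast
  qed
  moreover have "K \<noteq> {0} \<Longrightarrow> K = dual_space E"
  proof (rule dual_irreducible)
    show "cfun.subspace K"
      unfolding cfun.subspace_def
    proof (intro conjI ballI allI)
      show "0 \<in> K" using \<open>proj 0 0\<close> cfun.subspace_0[OF subspace_dual] by (simp add: K_def)
      show "\<phi> + \<psi> \<in> K" if "\<phi> \<in> K" "\<psi> \<in> K" for \<phi> \<psi>
        using that proj_add[of \<phi> 0 \<psi> 0] cfun.subspace_add[OF subspace_dual] by (simp add: K_def)
      show "fscale c \<phi> \<in> K" if "\<phi> \<in> K" for c \<phi>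
        using that proj_scale[of \<phi> 0 c] cfun.subspace_scale[OF subspace_dual] by (simp add: K_def)
    qed
    show "dual_action m E \<rho> g \<phi> \<in> K" if "g \<in> carrier (GL m)" "\<phi> \<in> K" for g \<phi>
    proof -
      have "act g 0 = 0" by (simp add: S_S_action_def kernel_map_def fun_eq_iff)
      then show ?thesis using that proj_act[of \<phi> 0 g] dual_action_closed by (simp add: K_def)
    qed
  qed (auto simp: K_def)
  ultimately have K: "K = {0}" by blast
  have inj: "\<phi> = \<psi>" if "proj \<phi> u" "proj \<psi> u" for \<phi> \<psi> u
  proof -
    have "proj (\<phi> + fscale (-1) \<psi>) (u + fscale (-1) u)"
      by (intro proj_add proj_scale that)
    moreover have "u + fscale (-1) u = 0" by (auto simp: fscale_def)
    moreover have "\<phi> \<in> dual_space E" "\<psi> \<in> dual_space E"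
      using that by (auto simp: proj_def represents_def)
    then have "\<phi> + fscale (-1) \<psi> \<in> dual_space E"
      by (intro cfun.subspace_add[OF subspace_dual] cfun.subspace_scale[OF subspace_dual])
    ultimately have "\<phi> + fscale (-1) \<psi> \<in> K" by (simp add: K_def)
    then have "\<phi> + fscale (-1) \<psi> = 0" using K by simp
    then show ?thesis by (simp add: fscale_def fun_eq_iff)
  qed
  define N where "N = {u. \<exists>\<phi>. proj \<phi> u}"
  define F where "F = (\<lambda>u. THE \<phi>. proj \<phi> u)"
  have F: "F u = \<phi>" if "proj \<phi> u" for u \<phi> unfolding F_def using that inj by blast
  have FN: "proj (F u) u" if "u \<in> N" for u
  proof -
    obtain \<phi> where "proj \<phi> u" using \<open>u \<in> N\<close> unfolding N_def by blast
    then show ?thesis using F by metis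
  qed
  have proj_dual: "\<phi> \<in> dual_space E" if "proj \<phi> u" for \<phi> u
    using that by (auto simp: proj_def represents_def)
  have sub: "GL_submodule m act N W"
    unfolding GL_submodule_def
  proof (intro conjI ballI image_subsetI)
    show "cfun.subspace N"
      unfolding cfun.subspace_def N_def using \<open>proj 0 0\<close> proj_add proj_scale by blast
    show "N \<subseteq> W" using U_sub by (auto simp: N_def proj_def)
    show "act g u \<in> N" if "g \<in> carrier (GL m)" "u \<in> N" for g u
      using that proj_act unfolding N_def by blast
  qed
  moreover have "GL_isomorphic m N act (dual_space E) (dual_action m E \<rho>)"
    unfolding GL_isomorphic_def
  proof (intro exI conjI ballI)
    show "linear_map_on N F"
      unfolding linear_map_on_def by (auto intro!: F proj_add proj_scale FN)
    show "bij_betw F N (dual_space E)"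
      unfolding bij_betw_def
    proof
      show "inj_on F N" by (rule inj_onI) (metis FN proj_unique)
      show "F ` N = dual_space E"
      proof
        show "F ` N \<subseteq> dual_space E" using FN proj_dual by blast
        show "dual_space E \<subseteq> F ` N"
        proof
          fix \<phi> assume "\<phi> \<in> dual_space E"
          then obtain u where "proj \<phi> u" by (rule proj_total)
          then show "\<phi> \<in> F ` N" using F by (force simp: N_def)
        qed
      qed
    qed
    show "F (act g u) = dual_action m E \<rho> g (F u)" if "g \<in> carrier (GL m)" "u \<in> N" for g u
      using that by (intro F proj_act FN)
  qed
  ultimately have iso: "N \<subseteq> dual_isotypic i m E \<rho>"
    unfolding dual_isotypic_def isotypic_component_def
    by (intro subset_trans[OF _ cfun.span_superset]) blast
  obtain u where u: "proj \<phi>\<^sub>0 u" using proj_total[OF \<phi>\<^sub>0(1)] .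
  have "u \<noteq> 0"
  proof
    assume "u = 0"
    then have "\<phi>\<^sub>0 \<in> K" using u \<phi>\<^sub>0(1) by (simp add: K_def)
    then show False using K \<phi>\<^sub>0_nonzero by simp
  qed
  moreover have "u \<in> U i m" "u \<in> N" using u by (auto simp: proj_def N_def)
  ultimately show ?thesis using iso by blast
qed

end

section \<open>The case \<open>i = m\<close>: the determinant character\<close>

text \<open>For \<open>i = m\<close> the leading minor is the full determinant, so
  \<open>\<phi>\<^sub>0\<close> spans an invariant line. The functionals with the same character
  form a nonzero submodule, hence the whole dual, and the character is inherited by every isomorphic
  copy among the tensors and by their span.\<close>

lemma (in rectangular_module) dual_isotypic_det:
  assumes im: "i = m" and f: "f \<in> dual_isotypic i m E \<rho>"
  shows "f \<in> W" "g \<in> carrier (GL m) \<Longrightarrow> act g f = fscale (1 / det g ^ m) f"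
proof -
  define Q where "Q = {\<phi> \<in> dual_space E. \<forall>g\<in>carrier (GL m). dual_action m E \<rho> g \<phi> = fscale (1 / det g ^ m) \<phi>}"
  have "Q = dual_space E"
  proof (rule dual_irreducible)
    show sQ: "cfun.subspace Q"
      unfolding cfun.subspace_def
    proof (intro conjI ballI allI)
      show "0 \<in> Q" using cfun.subspace_0[OF subspace_dual] unfolding Q_def
        by (simp add: dual_action_linear)
      show "\<phi> + \<psi> \<in> Q" if "\<phi> \<in> Q" "\<psi> \<in> Q" for \<phi> \<psi>
      proof -
        have "dual_action m E \<rho> g (\<phi> + \<psi>) = fscale (1 / det g ^ m) (\<phi> + \<psi>)" if "g \<in> carrier (GL m)" for g
          using that \<open>\<phi> \<in> Q\<close> \<open>\<psi> \<in> Q\<close>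
          unfolding dual_action_linear cfun.scale_right_distrib Q_def by simp
        then show ?thesis using that cfun.subspace_add[OF subspace_dual] unfolding Q_def by blast
      qed
      show "fscale c \<phi> \<in> Q" if "\<phi> \<in> Q" for c \<phi>
      proof -
        have "dual_action m E \<rho> g (fscale c \<phi>) = fscale (1 / det g ^ m) (fscale c \<phi>)" if "g \<in> carrier (GL m)" for g
          using that \<open>\<phi> \<in> Q\<close>
          unfolding dual_action_linear cfun.scale_left_commute[of _ c] Q_def by simp
        then show ?thesis using that cfun.subspace_scale[OF subspace_dual] unfolding Q_def by blast
      qed
    qed
    show "Q \<noteq> {0}"
    proof -
      have "dual_action m E \<rho> g \<phi>\<^sub>0 = fscale (1 / det g ^ m) \<phi>\<^sub>0" if g: "g \<in> carrier (GL m)" for g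
      proof (rule dual_eqI)
        show "dual_action m E \<rho> g \<phi>\<^sub>0 \<in> dual_space E" by (rule dual_action_closed[OF g \<phi>\<^sub>0(1)])
        show "fscale (1 / det g ^ m) \<phi>\<^sub>0 \<in> dual_space E" by (rule cfun.subspace_scale[OF subspace_dual \<phi>\<^sub>0(1)])
        fix h assume h: "h \<in> carrier (GL m)"
        have gi: "inv\<^bsub>GL m\<^esub> g \<in> carrier (GL m)" by (rule GL_inv(1)[OF g])
        have hm: "h \<in> carrier_mat m m" using h by (simp add: GL_iff)
        have "dual_action m E \<rho> g \<phi>\<^sub>0 (\<rho> h w) = \<phi>\<^sub>0 (\<rho> (inv\<^bsub>GL m\<^esub> g * h) w)"
          using action_mult[OF gi h w] action_closed[OF h w] by (simp add: dual_action_def)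
        also have "\<dots> = det (leading i (inv\<^bsub>GL m\<^esub> g * h)) ^ m"
          by (rule \<phi>\<^sub>0(2)[OF GL_mult_closed[OF gi h]])
        also have "\<dots> = (1 / det g * det h) ^ m"
          unfolding im using leading_self[of "inv\<^bsub>GL m\<^esub> g * h" m] GL_inv(2)[OF g] hm
            det_mult[OF GL_inv(2)[OF g] hm] det_GL_inv[OF g] by simp
        also have "\<dots> = fscale (1 / det g ^ m) \<phi>\<^sub>0 (\<rho> h w)"
          using \<phi>\<^sub>0(2)[OF h] leading_self[OF hm] im by (simp add: fscale_def power_mult_distrib power_divide)
        finally show "dual_action m E \<rho> g \<phi>\<^sub>0 (\<rho> h w) = fscale (1 / det g ^ m) \<phi>\<^sub>0 (\<rho> h w)" .
      qed
      then have "\<phi>\<^sub>0 \<in> Q" using \<phi>\<^sub>0(1) by (simp add: Q_def)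
      then show ?thesis using \<phi>\<^sub>0_nonzero by blast
    qed
    show "dual_action m E \<rho> g \<phi> \<in> Q" if "g \<in> carrier (GL m)" "\<phi> \<in> Q" for g \<phi>
    proof -
      have "dual_action m E \<rho> g \<phi> = fscale (1 / det g ^ m) \<phi>" using that by (simp add: Q_def)
      then show ?thesis using cfun.subspace_scale[OF sQ that(2)] by simp
    qed
  qed (auto simp: Q_def)
  define D where "D = {f \<in> W. \<forall>g\<in>carrier (GL m). act g f = fscale (1 / det g ^ m) f}"
  have act0: "act g 0 = 0" for g by (simp add: S_S_action_def kernel_map_def fun_eq_iff)
  have "cfun.subspace D"
    unfolding cfun.subspace_def
  proof (intro conjI ballI allI)
    show "0 \<in> D" using cfun.subspace_0[OF subspace_S_S_space] by (simp add: D_def act0)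
    show "x + y \<in> D" if "x \<in> D" "y \<in> D" for x y
      using that cfun.subspace_add[OF subspace_S_S_space]
      by (simp add: D_def S_S_action_linear cfun.scale_right_distrib)
    show "fscale c x \<in> D" if "x \<in> D" for c x
      using that cfun.subspace_scale[OF subspace_S_S_space]
      by (simp add: D_def S_S_action_linear mult.commute)
  qed
  moreover have "\<Union> {N. GL_submodule m act N W \<and> GL_isomorphic m N act (dual_space E) (dual_action m E \<rho>)} \<subseteq> D"
  proof
    fix x assume "x \<in> \<Union> {N. GL_submodule m act N W \<and> GL_isomorphic m N act (dual_space E) (dual_action m E \<rho>)}"
    then obtain N F where N: "GL_submodule m act N W" and x: "x \<in> N" and lin: "linear_map_on N F"
      and bij: "bij_betw F N (dual_space E)"
      and eq: "\<forall>g\<in>carrier (GL m). \<forall>x\<in>N. F (act g x) = dual_action m E \<rho> g (F x)"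
      unfolding GL_isomorphic_def by blast
    have "act g x = fscale (1 / det g ^ m) x" if g: "g \<in> carrier (GL m)" for g
    proof -
      have Fx: "F x \<in> Q" using bij_betwE[OF bij] x \<open>Q = dual_space E\<close> by blast
      have "F (act g x) = dual_action m E \<rho> g (F x)" using eq g x by blast
      also have "\<dots> = fscale (1 / det g ^ m) (F x)" using Fx g by (simp add: Q_def)
      also have "\<dots> = F (fscale (1 / det g ^ m) x)" using lin x unfolding linear_map_on_def by simp
      finally have eqF: "F (act g x) = F (fscale (1 / det g ^ m) x)" .
      have "act g x \<in> N" using N g x unfolding GL_submodule_def by blast
      moreover have "fscale (1 / det g ^ m) x \<in> N"
        using N x cfun.subspace_scale unfolding GL_submodule_def by blast
      ultimately show ?thesis using eqF bij unfolding bij_betw_def by (blast dest: inj_onD)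
    qed
    moreover have "x \<in> W" using N x unfolding GL_submodule_def by blast
    ultimately show "x \<in> D" by (simp add: D_def)
  qed
  ultimately have "dual_isotypic i m E \<rho> \<subseteq> D"
    unfolding dual_isotypic_def isotypic_component_def by (rule cfun.span_minimal[rotated])
  then have "f \<in> D" using f by blast
  then show "f \<in> W" "g \<in> carrier (GL m) \<Longrightarrow> act g f = fscale (1 / det g ^ m) f"
    by (simp_all add: D_def)
qed

text \<open>A common element \<open>f\<close> transforms by a power of the determinant, which fixes
  its polynomial up to a scalar and makes it a multiple of f_0. If the Latin sum vanished,
  \<open>f\<close> would be orthogonal to the generator, then to all of \<open>U i m\<close>, and so
  to itself.\<close>

lemma (in rectangular_module) latin_sum_nonzero_if_meets:
  assumes im: "i = m" and ne: "U i m \<inter> dual_isotypic i m E \<rho> \<noteq> {0}"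
  shows "latin_sum i m fst \<noteq> 0"
proof
  assume zero: "latin_sum i m fst = 0"
  have "0 \<in> U i m \<inter> dual_isotypic i m E \<rho>"
    using cfun.subspace_0[OF subspace_U]
    by (auto simp: dual_isotypic_def isotypic_component_def intro: cfun.span_zero)
  then obtain f where fU: "f \<in> U i m" and fI: "f \<in> dual_isotypic i m E \<rho>" and f0: "f \<noteq> 0"
    using ne by blast
  note fW = dual_isotypic_det(1)[OF im fI] and fact = dual_isotypic_det(2)[OF im fI]
  define c where "c = pl f (1\<^sub>m m)"
  have "f = fscale c (lowest_tensor i m)"
  proof (rule S_S_space_eqI[OF fW _ i])
    show "fscale c (lowest_tensor i m) \<in> W"
      by (rule cfun.subspace_scale[OF subspace_S_S_space lowest_tensor_in[OF even]])
    fix h assume h: "h \<in> carrier (GL m)"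
    \<comment> \<open>The character at the inverse of \<open>h\<close> expresses the polynomial at
      \<open>h\<close> as \<open>det h ^ m\<close> times its value at the identity.\<close>
    let ?k = "inv\<^bsub>GL m\<^esub> h"
    have k: "?k \<in> carrier (GL m)" and hm: "h \<in> carrier_mat m m" "det h \<noteq> 0"
      using GL_inv(1)[OF h] h by (auto simp: GL_iff)
    have kd: "1 / det ?k ^ m = det h ^ m"
      using hm(2) by (simp add: det_GL_inv[OF h] power_divide)
    have "pl f h = pl (act ?k f) (1\<^sub>m m)"
      using ev_action_columns[OF k GL_one_closed i, of f] GL_inv(5)[OF h] hm by simp
    also have "\<dots> = det h ^ m * c"
      unfolding fact[OF k] kd ev_scale c_def ..
    also have "\<dots> = pl (fscale c (lowest_tensor i m)) h"
      unfolding ev_scale ev_lowest_tensor[OF i] using leading_self[OF hm(1)] im by simp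
    finally show "pl f h = pl (fscale c (lowest_tensor i m)) h" .
  qed
  moreover have "ip i m (lowest_tensor i m) (generator i m) = 0"
  proof -
    have "cnj (latin_rows i m A) = latin_rows i m A" for A by (simp add: latin_rows_def)
    then have "ip i m (lowest_tensor i m) (generator i m)
      = (1 / fact m) ^ i * (\<Sum>A\<in>fillings i m. lowest_tensor i m (rows_of i m A) * latin_rows i m A)"
      by (simp add: ip_fillings generator_filling sum_distrib_left mult_ac)
    also have "(\<Sum>A\<in>fillings i m. lowest_tensor i m (rows_of i m A) * latin_rows i m A)
      = (\<Sum>\<pi>\<in>col_group i m. of_int (col_sign m \<pi>) * latin_rows i m (restrict (\<lambda>c. fst (\<pi> c)) (cells i m)))"
      by (rule sum_lowest_tensor[OF i row_invariant_latin_rows])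
    also have "\<dots> = latin_sum i m fst"
      unfolding latin_sum_def by (intro sum.cong refl arg_cong2[where f = "(*)"] latin_rows_cong) simp
    finally show ?thesis using zero by simp
  qed
  ultimately have orth: "ip i m f (generator i m) = 0" by (simp add: cip_simps)
  \<comment> \<open>Every adjoint group element multiplies \<open>f\<close> by a scalar, so the
    orthogonal complement of \<open>f\<close> is a submodule. Containing the generator, it contains
    \<open>U i m\<close>.\<close>
  let ?N = "{u \<in> W. ip i m f u = 0}"
  have "U i m \<subseteq> ?N"
  proof (rule U_minimal)
    show "generator i m \<in> ?N" using generator_in orth by simp
    show "GL_submodule m act ?N W"
      unfolding GL_submodule_def
    proof (intro conjI ballI image_subsetI)
      show "cfun.subspace ?N"
        using subspace_S_S_space[of i m] by (auto simp: cfun.subspace_def cip_simps)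
      fix g u assume g: "g \<in> carrier (GL m)" and u: "u \<in> ?N"
      obtain g' where g': "g' \<in> carrier (GL m)" "\<And>f h. ip i m f (act g h) = ip i m (act g' f) h"
        using S_S_action_adjoint'[OF g] by blast
      have "ip i m f (act g u) = 0"
        unfolding g'(2) fact[OF g'(1)] using u by (simp add: cip_simps)
      then show "act g u \<in> ?N" using u S_S_action_closed by simp
    qed auto
  qed
  then have "ip i m f f = 0" using fU by blast
  with ip_self[OF fW] f0 show False by blast
qed

theorem theorem5p6:
  fixes m :: nat
    and V :: "nat \<Rightarrow> ('x \<Rightarrow> complex) set"
    and \<rho> :: "nat \<Rightarrow> complex mat \<Rightarrow> ('x \<Rightarrow> complex) \<Rightarrow> 'x \<Rightarrow> complex"
  assumes "even m" and "m > 0"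
    and "\<And>i. 1 \<le> i \<Longrightarrow> i \<le> m \<Longrightarrow> irreducible_with_highest_weight m (m_delta m i) (V i) (\<rho> i)"
  shows "(\<forall>i. 1 \<le> i \<and> i \<le> m \<longrightarrow>
            (\<exists>B. is_pattern i m B \<and> card (L_plus i m B) \<noteq> card (L_minus i m B)) \<longrightarrow>
            U i m \<inter> dual_isotypic i m (V i) (\<rho> i) \<noteq> {0})
       \<and> (card (CELS m) \<noteq> card (COLS m) \<longrightarrow>
            (\<forall>i. 1 \<le> i \<and> i \<le> m \<longrightarrow> U i m \<inter> dual_isotypic i m (V i) (\<rho> i) \<noteq> {0}))
       \<and> (U m m \<inter> dual_isotypic m m (V m) (\<rho> m) \<noteq> {0} \<longleftrightarrow> card (CELS m) \<noteq> card (COLS m))"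
proof -
  have module: "\<exists>w. rectangular_module m (V i) (\<rho> i) i w" if i: "1 \<le> i" "i \<le> m" for i
  proof -
    obtain w where "irreducible_GL_module m (V i) (\<rho> i)" "w \<in> V i" "highest_weight_vector m (\<rho> i) (m_delta m i) w"
      using assms(3)[OF i] unfolding irreducible_with_highest_weight_def by blast
    then have "rectangular_module m (V i) (\<rho> i) i w"
      using assms(1) i(2) by unfold_locales
    then show ?thesis by blast
  qed
  have meets: "U i m \<inter> dual_isotypic i m (V i) (\<rho> i) \<noteq> {0}"
    if i: "1 \<le> i" "i \<le> m" and A: "A \<in> fillings i m" "latin_sum i m A \<noteq> 0" for i A
    using module[OF i] rectangular_module.U_meets_dual_isotypic[OF _ A] by blast
  have squares: "latin_sum m m fst \<noteq> 0 \<longleftrightarrow> card (CELS m) \<noteq> card (COLS m)"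
    unfolding card_CELS_COLS[symmetric] by simp
  have all: "U i m \<inter> dual_isotypic i m (V i) (\<rho> i) \<noteq> {0}"
    if ne: "card (CELS m) \<noteq> card (COLS m)" and i: "1 \<le> i" "i \<le> m" for i
  proof -
    let ?A = "restrict fst (cells m m)"
    have "latin_sum m m ?A \<noteq> 0"
      using ne squares latin_sum_cong[of m m ?A fst] by simp
    moreover have "?A \<in> fillings m m" by (auto simp: fillings_def cells_def)
    \<comment> \<open>Contrapositive of \<open>latin_sum_zero_mono\<close>: if all sums for
      \<open>i\<close> rows were zero, the sum for the full square would be zero as well.\<close>
    ultimately have "\<exists>A\<in>fillings i m. latin_sum i m A \<noteq> 0"
      using latin_sum_zero_mono[OF _ i(2)] by blast
    then show ?thesis using meets[OF i] by blast
  qed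
  have m: "1 \<le> m" using assms(2) by simp
  show ?thesis
  proof (intro conjI allI impI)
    fix i assume i: "1 \<le> i \<and> i \<le> m" and "\<exists>B. is_pattern i m B \<and> card (L_plus i m B) \<noteq> card (L_minus i m B)"
    then obtain A where "A \<in> fillings i m" "latin_sum i m A \<noteq> 0" using pattern_latin_sum by blast
    then show "U i m \<inter> dual_isotypic i m (V i) (\<rho> i) \<noteq> {0}" using meets i by blast
  next
    show "U i m \<inter> dual_isotypic i m (V i) (\<rho> i) \<noteq> {0}" if "card (CELS m) \<noteq> card (COLS m)" "1 \<le> i \<and> i \<le> m" for i
      using all that by blast
    show "U m m \<inter> dual_isotypic m m (V m) (\<rho> m) \<noteq> {0} \<longleftrightarrow> card (CELS m) \<noteq> card (COLS m)"
      using all[OF _ m] module[OF m] rectangular_module.latin_sum_nonzero_if_meets[OF _ refl] squares by blast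
  qed
qed

end
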